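(* Let $V$ be any vertex algebra and let $\ell$ be any complex number. Then $V^{[\ell]}$ has a natural vertex algebra structure.
   Context: A vertex algebra $(V,Y,\mathbf{1})$ over $\mathbb{C}$ is taken in the usual sense (truncation, vacuum and creation properties, Jacobi identity; no grading or conformal vector assumed). Write $Y(a,x)=\sum_{n\in\mathbb{Z}}a_nx^{-n-1}$ and $D(a)=a_{-2}\mathbf{1}$. Put $\hat V=V\otimes\mathbb{C}[t,t^{-1}]$, $\hat D=D\otimes1+1\otimes\frac{d}{dt}$, and $g(V)=\hat V/\hat D\hat V$; write $a(m)$ for $a\otimes t^m+\hat D\hat V$. Then $g(V)$ is a Lie algebra with bracket $[a(m),b(n)]=\sum_{i\ge0}\binom{m}{i}(a_ib)(m+n-i)$. One has $\mathbf{1}(n)=0$ for $n\neq-1$ and $\mathbf{1}(-1)$ is central. Let $g(V)^{+}$ be the subalgebra spanned by all $a(n)$ with $a\in V$, $n\ge0$. Let $I(V)=U(g(V))\otimes_{U(g(V)^{+})}\mathbb{C}$ be the $g(V)$-module induced from the trivial one-dimensional module, and $V^{[\ell]}=I(V)/(\mathbf{1}(-1)-\ell)I(V)$, a $g(V)$-module on which $\mathbf{1}(-1)$ acts as $\ell$. Let $1\in V^{[\ell]}$ be the image of $1\otimes1$. "Natural" means that the vacuum vector is $1$ and $Y(a(-1)1,z)=\sum_{n\in\mathbb{Z}}a(n)z^{-n-1}$ (action of $g(V)$ on $V^{[\ell]}$) for all $a\in V$. *)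

theory Defs
  imports Complex_Main "HOL-Library.Poly_Mapping" "HOL-Algebra.QuotRing" "HOL-Algebra.Module"
begin

section \<open>Complex vector spaces as HOL-Algebra modules\<close>

text \<open>
  Complex vector spaces are modules (in the sense of HOL-Algebra) over the following record.
  The ring multiplication slot of a module record is used for the multiplication of an associative
  algebra, or for the bracket of a Lie algebra, and is junk if there is no such structure.
\<close>

definition cfield :: "(complex, complex) module" where
  "cfield = \<lparr>carrier = UNIV, mult = (*), one = 1, zero = 0, add = (+), smult = (*)\<rparr>"

definition lin_span :: "(complex, 'a) module \<Rightarrow> 'a set \<Rightarrow> 'a set" where
  "lin_span M S = (\<lambda>H. submodule H cfield M) hull S"

text \<open>Meant for families with only finitely many nonzero members.\<close>

definition supp_sum :: "(complex, 'a) module \<Rightarrow> ('i \<Rightarrow> 'a) \<Rightarrow> 'a" where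
  "supp_sum M f = (\<Oplus>\<^bsub>M\<^esub>i\<in>{i. f i \<noteq> \<zero>\<^bsub>M\<^esub>}. f i)"

text \<open>
  The map into \<open>M / N\<close> induced by \<open>\<phi>\<close> on cosets (of a subspace which \<open>\<phi>\<close> maps into \<open>N\<close>).
\<close>

definition induced :: "(complex, 'b) module \<Rightarrow> 'b set \<Rightarrow> ('a \<Rightarrow> 'b) \<Rightarrow> 'a set \<Rightarrow> 'b set" where
  "induced M N \<phi> X = (\<Union>x\<in>X. N +>\<^bsub>M\<^esub> \<phi> x)"

text \<open>
  The quotient by a subspace; it extends the library's \<^const>\<open>FactRing\<close> by a scalar multiplication.
\<close>

definition quot :: "(complex, 'a) module \<Rightarrow> 'a set \<Rightarrow> (complex, 'a set) module" where
  "quot M N = \<lparr>carrier = a_rcosets\<^bsub>M\<^esub> N, mult = rcoset_mult M N, one = N +>\<^bsub>M\<^esub> \<one>\<^bsub>M\<^esub>,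
     zero = N, add = set_add M, smult = (\<lambda>c. induced M N (\<lambda>x. c \<odot>\<^bsub>M\<^esub> x))\<rparr>"

section \<open>Vertex algebras\<close>

text \<open>
  \<open>Y a n b\<close> is the \<open>n\<close>-th product \<open>a\<^sub>n b\<close>, that is, the coefficient of \<open>x^(-n-1)\<close> in \<open>Y(a,x)b\<close>.
  The Jacobi identity

    \<open>x0^(-1) \<delta>((x1-x2)/x0) Y(a,x1) Y(b,x2) c - x0^(-1) \<delta>((x2-x1)/(-x0)) Y(b,x2) Y(a,x1) c
       = x2^(-1) \<delta>((x1-x0)/x2) Y(Y(a,x0)b,x2) c\<close>

  is an equality of formal series in \<open>x0, x1, x2\<close> and their inverses; \<open>jacobi\<close> is the equality of the
  coefficients of \<open>x0^(-l-1) x1^(-m-1) x2^(-n-1)\<close>.  By truncation all three sums are finite.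
\<close>

locale vertex_algebra = module cfield V for V :: "(complex, 'a) module" +
  fixes Y :: "'a \<Rightarrow> int \<Rightarrow> 'a \<Rightarrow> 'a" and vac :: 'a
  assumes vac_closed: "vac \<in> carrier V"
    and Y_closed: "\<lbrakk>a \<in> carrier V; b \<in> carrier V\<rbrakk> \<Longrightarrow> Y a n b \<in> carrier V"
    and Y_add_left: "\<lbrakk>a \<in> carrier V; a' \<in> carrier V; b \<in> carrier V\<rbrakk>
      \<Longrightarrow> Y (a \<oplus>\<^bsub>V\<^esub> a') n b = Y a n b \<oplus>\<^bsub>V\<^esub> Y a' n b"
    and Y_smult_left: "\<lbrakk>a \<in> carrier V; b \<in> carrier V\<rbrakk>
      \<Longrightarrow> Y (z \<odot>\<^bsub>V\<^esub> a) n b = z \<odot>\<^bsub>V\<^esub> Y a n b"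
    and Y_add_right: "\<lbrakk>a \<in> carrier V; b \<in> carrier V; b' \<in> carrier V\<rbrakk>
      \<Longrightarrow> Y a n (b \<oplus>\<^bsub>V\<^esub> b') = Y a n b \<oplus>\<^bsub>V\<^esub> Y a n b'"
    and Y_smult_right: "\<lbrakk>a \<in> carrier V; b \<in> carrier V\<rbrakk>
      \<Longrightarrow> Y a n (z \<odot>\<^bsub>V\<^esub> b) = z \<odot>\<^bsub>V\<^esub> Y a n b"
    and truncation: "\<lbrakk>a \<in> carrier V; b \<in> carrier V\<rbrakk> \<Longrightarrow> \<exists>N. \<forall>n\<ge>N. Y a n b = \<zero>\<^bsub>V\<^esub>"
    and vacuum: "b \<in> carrier V \<Longrightarrow> Y vac n b = (if n = -1 then b else \<zero>\<^bsub>V\<^esub>)"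
    and creation: "a \<in> carrier V \<Longrightarrow> Y a (-1) vac = a"
      "\<lbrakk>a \<in> carrier V; n \<ge> 0\<rbrakk> \<Longrightarrow> Y a n vac = \<zero>\<^bsub>V\<^esub>"
    and jacobi: "\<lbrakk>a \<in> carrier V; b \<in> carrier V; c \<in> carrier V\<rbrakk> \<Longrightarrow>
      supp_sum V (\<lambda>i::nat. ((-1) ^ i * (of_int l gchoose i))
          \<odot>\<^bsub>V\<^esub> Y a (l + m - int i) (Y b (n + int i) c))
      \<ominus>\<^bsub>V\<^esub> supp_sum V (\<lambda>i::nat. ((-1) powi l * (-1) ^ i * (of_int l gchoose i))
          \<odot>\<^bsub>V\<^esub> Y b (l + n - int i) (Y a (m + int i) c))
      = supp_sum V (\<lambda>i::nat. (of_int m gchoose i)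
          \<odot>\<^bsub>V\<^esub> Y (Y a (l + int i) b) (m + n - int i) c)"

section \<open>The Lie algebra \<open>g(V)\<close>\<close>

text \<open>
  The space \<open>V \<otimes> \<complex>[t,t\<^sup>-\<^sup>1]\<close> is realised as the space of Laurent polynomials with coefficients in \<open>V\<close>:
  \<open>f\<close> stands for the sum of all \<open>f n \<otimes> t^n\<close>.
\<close>

definition tmono :: "(complex, 'a) module \<Rightarrow> 'a \<Rightarrow> int \<Rightarrow> int \<Rightarrow> 'a" where
  "tmono V a m = (\<lambda>k. if k = m then a else \<zero>\<^bsub>V\<^esub>)"

definition laurent_space :: "(complex, 'a) module \<Rightarrow> (complex, int \<Rightarrow> 'a) module" where
  "laurent_space V = \<lparr>carrier = {f. (\<forall>n. f n \<in> carrier V) \<and> finite {n. f n \<noteq> \<zero>\<^bsub>V\<^esub>}},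
     mult = (\<lambda>_ _ _. \<zero>\<^bsub>V\<^esub>), one = (\<lambda>_. \<zero>\<^bsub>V\<^esub>), zero = (\<lambda>_. \<zero>\<^bsub>V\<^esub>),
     add = (\<lambda>f g n. f n \<oplus>\<^bsub>V\<^esub> g n), smult = (\<lambda>c f n. c \<odot>\<^bsub>V\<^esub> f n)\<rparr>"

text \<open>
  The bilinear operation \<open>[a \<otimes> t^m, b \<otimes> t^n] = (\<Sum>i\<ge>0. (m choose i) (a\<^sub>i b) \<otimes> t^(m+n-i))\<close>
  is put into the multiplication slot.  It becomes a Lie bracket only on the quotient \<open>g(V)\<close>.
\<close>

definition hat_bracket ::
    "(complex, 'a) module \<Rightarrow> ('a \<Rightarrow> int \<Rightarrow> 'a \<Rightarrow> 'a) \<Rightarrow> (int \<Rightarrow> 'a) \<Rightarrow> (int \<Rightarrow> 'a) \<Rightarrow> (int \<Rightarrow> 'a)" where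
  "hat_bracket V Y f g =
     (\<Oplus>\<^bsub>laurent_space V\<^esub>m\<in>{m. f m \<noteq> \<zero>\<^bsub>V\<^esub>}. \<Oplus>\<^bsub>laurent_space V\<^esub>n\<in>{n. g n \<noteq> \<zero>\<^bsub>V\<^esub>}.
        supp_sum (laurent_space V) (\<lambda>i::nat.
          tmono V ((of_int m gchoose i) \<odot>\<^bsub>V\<^esub> Y (f m) (int i) (g n)) (m + n - int i)))"

definition hat_space ::
    "(complex, 'a) module \<Rightarrow> ('a \<Rightarrow> int \<Rightarrow> 'a \<Rightarrow> 'a) \<Rightarrow> (complex, int \<Rightarrow> 'a) module" where
  "hat_space V Y = (laurent_space V)\<lparr>mult := hat_bracket V Y\<rparr>"

definition transl :: "('a \<Rightarrow> int \<Rightarrow> 'a \<Rightarrow> 'a) \<Rightarrow> 'a \<Rightarrow> 'a \<Rightarrow> 'a" where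
  "transl Y vac a = Y a (-2) vac"

text \<open>\<open>D \<otimes> 1 + 1 \<otimes> d/dt\<close>\<close>

definition hat_transl :: "(complex, 'a) module \<Rightarrow> ('a \<Rightarrow> int \<Rightarrow> 'a \<Rightarrow> 'a) \<Rightarrow> 'a \<Rightarrow>
    (int \<Rightarrow> 'a) \<Rightarrow> (int \<Rightarrow> 'a)" where
  "hat_transl V Y vac f = (\<lambda>n. transl Y vac (f n) \<oplus>\<^bsub>V\<^esub> of_int (n + 1) \<odot>\<^bsub>V\<^esub> f (n + 1))"

definition hat_transl_image :: "(complex, 'a) module \<Rightarrow> ('a \<Rightarrow> int \<Rightarrow> 'a \<Rightarrow> 'a) \<Rightarrow> 'a \<Rightarrow>
    (int \<Rightarrow> 'a) set" where
  "hat_transl_image V Y vac = hat_transl V Y vac ` carrier (hat_space V Y)"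

definition gV :: "(complex, 'a) module \<Rightarrow> ('a \<Rightarrow> int \<Rightarrow> 'a \<Rightarrow> 'a) \<Rightarrow> 'a \<Rightarrow>
    (complex, (int \<Rightarrow> 'a) set) module" where
  "gV V Y vac = quot (hat_space V Y) (hat_transl_image V Y vac)"

text \<open>The element \<open>a(m)\<close> of \<open>g(V)\<close>.\<close>

definition gmode :: "(complex, 'a) module \<Rightarrow> ('a \<Rightarrow> int \<Rightarrow> 'a \<Rightarrow> 'a) \<Rightarrow> 'a \<Rightarrow>
    'a \<Rightarrow> int \<Rightarrow> (int \<Rightarrow> 'a) set" where
  "gmode V Y vac a m = hat_transl_image V Y vac +>\<^bsub>hat_space V Y\<^esub> tmono V a m"

definition gV_plus :: "(complex, 'a) module \<Rightarrow> ('a \<Rightarrow> int \<Rightarrow> 'a \<Rightarrow> 'a) \<Rightarrow> 'a \<Rightarrow>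
    (complex, (int \<Rightarrow> 'a) set) module" where
  "gV_plus V Y vac = (gV V Y vac)\<lparr>carrier :=
     lin_span (gV V Y vac) {gmode V Y vac a n | a n. a \<in> carrier V \<and> n \<ge> 0}\<rparr>"

section \<open>Universal enveloping algebras\<close>

definition lin_ext :: "('x \<Rightarrow> 'y) \<Rightarrow> ('x \<Rightarrow>\<^sub>0 complex) \<Rightarrow> ('y \<Rightarrow>\<^sub>0 complex)" where
  "lin_ext \<phi> f = (\<Sum>x\<in>Poly_Mapping.keys f.
     Poly_Mapping.single (\<phi> x) (Poly_Mapping.lookup f x))"

definition free_space :: "'x set \<Rightarrow> (complex, 'x \<Rightarrow>\<^sub>0 complex) module" where
  "free_space X = \<lparr>carrier = {f. Poly_Mapping.keys f \<subseteq> X}, mult = (\<lambda>_ _. 0), one = 0,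
     zero = 0, add = (+), smult = (\<lambda>c. Poly_Mapping.map ((*) c))\<rparr>"

definition free_algebra :: "'x set \<Rightarrow> (complex, 'x list \<Rightarrow>\<^sub>0 complex) module" where
  "free_algebra X = (free_space (lists X))\<lparr>
     mult := (\<lambda>f g. \<Sum>u\<in>Poly_Mapping.keys f. \<Sum>v\<in>Poly_Mapping.keys g.
        Poly_Mapping.single (u @ v) (Poly_Mapping.lookup f u * Poly_Mapping.lookup g v)),
     one := Poly_Mapping.single [] 1\<rparr>"

definition word :: "'x list \<Rightarrow> ('x list \<Rightarrow>\<^sub>0 complex)" where
  "word w = Poly_Mapping.single w 1"

text \<open>
  The tensor algebra of \<open>L\<close> is the free algebra on the set \<open>L\<close> modulo the first two kinds of
  relations, which make the inclusion of \<open>L\<close> linear.  The third kind are the defining relations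
  \<open>x y - y x = [x, y]\<close> of the enveloping algebra.
\<close>

definition env_relations :: "(complex, 'x) module \<Rightarrow> ('x list \<Rightarrow>\<^sub>0 complex) set" where
  "env_relations L =
     {word [x \<oplus>\<^bsub>L\<^esub> y] - word [x] - word [y] | x y. x \<in> carrier L \<and> y \<in> carrier L} \<union>
     {word [c \<odot>\<^bsub>L\<^esub> x] - Poly_Mapping.map ((*) c) (word [x]) | c x. x \<in> carrier L} \<union>
     {word [x, y] - word [y, x] - word [x \<otimes>\<^bsub>L\<^esub> y] | x y. x \<in> carrier L \<and> y \<in> carrier L}"

definition env_ideal :: "(complex, 'x) module \<Rightarrow> ('x list \<Rightarrow>\<^sub>0 complex) set" where
  "env_ideal L = Idl\<^bsub>free_algebra (carrier L)\<^esub> (env_relations L)"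

definition env :: "(complex, 'x) module \<Rightarrow> (complex, ('x list \<Rightarrow>\<^sub>0 complex) set) module" where
  "env L = quot (free_algebra (carrier L)) (env_ideal L)"

definition env_gen :: "(complex, 'x) module \<Rightarrow> 'x \<Rightarrow> ('x list \<Rightarrow>\<^sub>0 complex) set" where
  "env_gen L x = env_ideal L +>\<^bsub>free_algebra (carrier L)\<^esub> word [x]"

text \<open>The algebra homomorphism \<open>U(K) \<rightarrow> U(L)\<close> given by the inclusion of a subalgebra \<open>K\<close> of \<open>L\<close>.\<close>

definition env_incl :: "(complex, 'x) module \<Rightarrow>
    ('x list \<Rightarrow>\<^sub>0 complex) set \<Rightarrow> ('x list \<Rightarrow>\<^sub>0 complex) set" where
  "env_incl L = induced (free_algebra (carrier L)) (env_ideal L) (\<lambda>f. f)"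

text \<open>
  The scalar by which an element of \<open>U(K)\<close> acts on the trivial one-dimensional \<open>K\<close>-module: nonempty
  words act by zero, hence only the coefficient of the empty word of a representative matters.
\<close>

definition env_aug :: "('x list \<Rightarrow>\<^sub>0 complex) set \<Rightarrow> complex" where
  "env_aug X = the_elem ((\<lambda>f. Poly_Mapping.lookup f []) ` X)"

section \<open>Tensor products over an algebra\<close>

text \<open>
  The tensor product of \<open>M\<close> and \<open>N\<close> over a complex algebra with underlying set \<open>R\<close> acting by \<open>ra\<close> on
  \<open>M\<close> from the right and by \<open>la\<close> on \<open>N\<close> from the left.
\<close>

definition tensor_relations :: "'r set \<Rightarrow> (complex, 'm) module \<Rightarrow> ('m \<Rightarrow> 'r \<Rightarrow> 'm) \<Rightarrow>
    (complex, 'n) module \<Rightarrow> ('r \<Rightarrow> 'n \<Rightarrow> 'n) \<Rightarrow> ('m \<times> 'n \<Rightarrow>\<^sub>0 complex) set" where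
  "tensor_relations R M ra N la = (let e = (\<lambda>m n. Poly_Mapping.single (m, n) (1::complex)) in
     {e (m \<oplus>\<^bsub>M\<^esub> m') n - e m n - e m' n | m m' n.
        m \<in> carrier M \<and> m' \<in> carrier M \<and> n \<in> carrier N} \<union>
     {e m (n \<oplus>\<^bsub>N\<^esub> n') - e m n - e m n' | m n n'.
        m \<in> carrier M \<and> n \<in> carrier N \<and> n' \<in> carrier N} \<union>
     {e (c \<odot>\<^bsub>M\<^esub> m) n - Poly_Mapping.map ((*) c) (e m n) | c m n.
        m \<in> carrier M \<and> n \<in> carrier N} \<union>
     {e m (c \<odot>\<^bsub>N\<^esub> n) - Poly_Mapping.map ((*) c) (e m n) | c m n.
        m \<in> carrier M \<and> n \<in> carrier N} \<union>
     {e (ra m r) n - e m (la r n) | m r n. m \<in> carrier M \<and> r \<in> R \<and> n \<in> carrier N})"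

definition tensor_null :: "'r set \<Rightarrow> (complex, 'm) module \<Rightarrow> ('m \<Rightarrow> 'r \<Rightarrow> 'm) \<Rightarrow>
    (complex, 'n) module \<Rightarrow> ('r \<Rightarrow> 'n \<Rightarrow> 'n) \<Rightarrow> ('m \<times> 'n \<Rightarrow>\<^sub>0 complex) set" where
  "tensor_null R M ra N la =
     lin_span (free_space (carrier M \<times> carrier N)) (tensor_relations R M ra N la)"

definition tensor :: "'r set \<Rightarrow> (complex, 'm) module \<Rightarrow> ('m \<Rightarrow> 'r \<Rightarrow> 'm) \<Rightarrow>
    (complex, 'n) module \<Rightarrow> ('r \<Rightarrow> 'n \<Rightarrow> 'n) \<Rightarrow> (complex, ('m \<times> 'n \<Rightarrow>\<^sub>0 complex) set) module" where
  "tensor R M ra N la =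
     quot (free_space (carrier M \<times> carrier N)) (tensor_null R M ra N la)"

section \<open>Modules induced from the trivial module\<close>

type_synonym 'x env_elem = "('x list \<Rightarrow>\<^sub>0 complex) set"
type_synonym 'x ind_elem = "('x env_elem \<times> complex \<Rightarrow>\<^sub>0 complex) set"

text \<open>
  For a Lie algebra \<open>L\<close> and a subalgebra \<open>K\<close>, the \<open>L\<close>-module \<open>U(L) \<otimes>\<^bsub>U(K)\<^esub> \<complex>\<close>.
\<close>

definition ind_null :: "(complex, 'x) module \<Rightarrow> (complex, 'x) module \<Rightarrow> 'x ind_elem" where
  "ind_null L K = tensor_null (carrier (env K)) (env L) (\<lambda>u r. u \<otimes>\<^bsub>env L\<^esub> env_incl L r)
     cfield (\<lambda>r z. env_aug r * z)"

definition ind_module ::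
    "(complex, 'x) module \<Rightarrow> (complex, 'x) module \<Rightarrow> (complex, 'x ind_elem) module" where
  "ind_module L K = tensor (carrier (env K)) (env L) (\<lambda>u r. u \<otimes>\<^bsub>env L\<^esub> env_incl L r)
     cfield (\<lambda>r z. env_aug r * z)"

text \<open>\<open>x (u \<otimes> z) = (x u) \<otimes> z\<close>\<close>

definition ind_act :: "(complex, 'x) module \<Rightarrow> (complex, 'x) module \<Rightarrow>
    'x \<Rightarrow> 'x ind_elem \<Rightarrow> 'x ind_elem" where
  "ind_act L K x = induced (free_space (carrier (env L) \<times> carrier cfield)) (ind_null L K)
     (lin_ext (\<lambda>(u, z). (env_gen L x \<otimes>\<^bsub>env L\<^esub> u, z)))"

text \<open>\<open>1 \<otimes> 1\<close>\<close>

definition ind_one :: "(complex, 'x) module \<Rightarrow> (complex, 'x) module \<Rightarrow> 'x ind_elem" where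
  "ind_one L K = ind_null L K +>\<^bsub>free_space (carrier (env L) \<times> carrier cfield)\<^esub>
     Poly_Mapping.single (\<one>\<^bsub>env L\<^esub>, 1) 1"

section \<open>The \<open>g(V)\<close>-modules \<open>I(V)\<close> and \<open>V\<^bsup>[ell]\<^esup>\<close>\<close>

type_synonym 'a IV_elem = "(int \<Rightarrow> 'a) set ind_elem"

definition IV :: "(complex, 'a) module \<Rightarrow> ('a \<Rightarrow> int \<Rightarrow> 'a \<Rightarrow> 'a) \<Rightarrow> 'a \<Rightarrow>
    (complex, 'a IV_elem) module" where
  "IV V Y vac = ind_module (gV V Y vac) (gV_plus V Y vac)"

definition IV_act :: "(complex, 'a) module \<Rightarrow> ('a \<Rightarrow> int \<Rightarrow> 'a \<Rightarrow> 'a) \<Rightarrow> 'a \<Rightarrow>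
    (int \<Rightarrow> 'a) set \<Rightarrow> 'a IV_elem \<Rightarrow> 'a IV_elem" where
  "IV_act V Y vac = ind_act (gV V Y vac) (gV_plus V Y vac)"

text \<open>\<open>(\<one>(-1) - ell) I(V)\<close>\<close>

definition level_null :: "(complex, 'a) module \<Rightarrow> ('a \<Rightarrow> int \<Rightarrow> 'a \<Rightarrow> 'a) \<Rightarrow> 'a \<Rightarrow>
    complex \<Rightarrow> 'a IV_elem set" where
  "level_null V Y vac ell =
     {IV_act V Y vac (gmode V Y vac vac (-1)) w \<ominus>\<^bsub>IV V Y vac\<^esub> ell \<odot>\<^bsub>IV V Y vac\<^esub> w | w.
        w \<in> carrier (IV V Y vac)}"

definition level_module :: "(complex, 'a) module \<Rightarrow> ('a \<Rightarrow> int \<Rightarrow> 'a \<Rightarrow> 'a) \<Rightarrow> 'a \<Rightarrow>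
    complex \<Rightarrow> (complex, 'a IV_elem set) module" where
  "level_module V Y vac ell = quot (IV V Y vac) (level_null V Y vac ell)"

definition level_act :: "(complex, 'a) module \<Rightarrow> ('a \<Rightarrow> int \<Rightarrow> 'a \<Rightarrow> 'a) \<Rightarrow> 'a \<Rightarrow>
    complex \<Rightarrow> (int \<Rightarrow> 'a) set \<Rightarrow> 'a IV_elem set \<Rightarrow> 'a IV_elem set" where
  "level_act V Y vac ell x = induced (IV V Y vac) (level_null V Y vac ell) (IV_act V Y vac x)"

definition level_one :: "(complex, 'a) module \<Rightarrow> ('a \<Rightarrow> int \<Rightarrow> 'a \<Rightarrow> 'a) \<Rightarrow> 'a \<Rightarrow>
    complex \<Rightarrow> 'a IV_elem set" where
  "level_one V Y vac ell =
     level_null V Y vac ell +>\<^bsub>IV V Y vac\<^esub> ind_one (gV V Y vac) (gV_plus V Y vac)"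

end

theory Submission
  imports Defs "HOL-Library.Function_Algebras"
begin

text \<open>
Write \<open>W\<close> for the module \<open>V^[l]\<close> and \<open>e\<close> for its generator.  The fields \<open>a(x) = \<Sum>n. a(n) x^(-n-1)\<close> on
\<open>W\<close> are pairwise local, because the bracket of \<open>g(V)\<close> expresses \<open>[a(x), b(y)]\<close> by finitely many
derivatives of the delta function.  A vertex algebra structure with \<open>Y(a(-1) e, x) = a(x)\<close> has to send
\<open>a(m) b(n) \<cdots> e\<close> to the iterated product \<open>a(x)\<^sub>m (b(x)\<^sub>n (\<cdots> id))\<close> of fields, and the one
difficulty is that this be well defined, as \<open>W\<close> is given by generators and relations.

It is well defined because fields form a module as well.  Let \<open>E\<close> be the span of all iterated
products, applied to the identity field.  Its members are pairwise local by Dong's lemma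
(\<open>dong\<close>, \<open>fgen_local\<close>).  For pairwise local fields the products satisfy the commutator formula
(\<open>prd_commutator_formula\<close>), so that \<open>C \<mapsto> a(x)\<^sub>n C\<close> represents \<open>g(V)\<close> on \<open>E\<close>.
The element \<open>1(-1)\<close> acts as \<open>l\<close>, and \<open>g(V)\<^sup>+\<close> kills the identity field.  The universal property of \<open>W\<close>
(\<open>W_universal\<close>) gives a module map \<open>Phi\<close> from \<open>W\<close> to \<open>E\<close> with \<open>Phi e = id\<close>, and this is the
state-field correspondence (\<open>reconstruction\<close>): creation follows by induction along the
generation of \<open>W\<close> from \<open>e\<close>, the identity \<open>Phi (u\<^sub>n v) = (Phi u)\<^sub>n (Phi v)\<close> by induction on \<open>u\<close> from the
associativity formula (\<open>prd_assoc_formula\<close>), and the Jacobi identity is the one that holds for any two local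
fields (\<open>prd_jacobi\<close>).

Commutator formula and associativity are obtained one level up.  Left multiplications \<open>C \<mapsto> A\<^sub>n C\<close>
form again a field, on a space of fields, and locality of \<open>A\<close> and \<open>B\<close> implies locality of their left
multiplications (\<open>prd_commutator_local\<close>).  The product of two left multiplications agrees with the left
multiplication by the product on the identity field, by a differential equation (\<open>assoc_idf\<close>).  The
difference of the two is local with every left multiplication by a member of the family, and so it kills what
these produce from the identity field (\<open>kill_propagate\<close>, \<open>prd_assoc\<close>).

Fields have values in a type with an addition, whereas \<open>g(V)\<close> and \<open>W\<close> are given by carriers.  Therefore
\<open>W\<close> is embedded linearly into a type of finitely supported functions (\<open>module_embedding\<close>), and fields
live on the image of the carrier.
\<close>

section \<open>Binomially weighted sums\<close>

definition ev0 :: "(nat \<Rightarrow> 'x::zero) \<Rightarrow> bool" where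
  "ev0 g \<longleftrightarrow> (\<exists>K. \<forall>i\<ge>K. g i = 0)"

lemma ev0I: "(\<And>i. i \<ge> K \<Longrightarrow> g i = 0) \<Longrightarrow> ev0 g"
  unfolding ev0_def by blast

lemma ev0_Suc: "ev0 g \<Longrightarrow> ev0 (\<lambda>i. g (Suc i))"
  unfolding ev0_def by (meson le_SucI)

lemma ev0_SucD: assumes "ev0 (\<lambda>i. g (Suc i))" shows "ev0 g"
proof -
  obtain K where K: "\<And>i. i \<ge> K \<Longrightarrow> g (Suc i) = 0" using assms unfolding ev0_def by blast
  have "g i = 0" if "i \<ge> Suc K" for i using K[of "i - 1"] that by (cases i) auto
  then show ?thesis by (rule ev0I)
qed

lemma ev0_map: "ev0 g \<Longrightarrow> (\<And>i. g i = 0 \<Longrightarrow> h i = 0) \<Longrightarrow> ev0 h"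
  unfolding ev0_def by blast

lemma ev0_bound2:
  assumes "ev0 g" "ev0 h" obtains K where "\<And>i. i \<ge> K \<Longrightarrow> g i = 0" "\<And>i. i \<ge> K \<Longrightarrow> h i = 0"
proof -
  from assms obtain K1 K2 where "\<forall>i\<ge>K1. g i = 0" "\<forall>i\<ge>K2. h i = 0" unfolding ev0_def by blast
  then show ?thesis using that[of "max K1 K2"] by auto
qed

lemma ev0_add: "ev0 g \<Longrightarrow> ev0 h \<Longrightarrow> ev0 (\<lambda>i. g i + h i :: 'x::ab_group_add)"
  by (metis (no_types, lifting) ev0I ev0_bound2 add_0_left)

lemma ev0_diff: "ev0 g \<Longrightarrow> ev0 h \<Longrightarrow> ev0 (\<lambda>i. g i - h i :: 'x::ab_group_add)"
  by (metis (no_types, lifting) ev0I ev0_bound2 diff_0_right)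

locale complex_space = vector_space sc for sc :: "complex \<Rightarrow> 'p::ab_group_add \<Rightarrow> 'p"
begin

text \<open>The effect on coefficients of multiplication by \<open>(x + e y)^l\<close>, expanded in nonnegative powers of \<open>y\<close>.
  With \<open>e = -1\<close> these are the sums in the products of fields and on the left of the Jacobi identity, with
  \<open>e = 1\<close> those on its right and in the bracket of \<open>g(V)\<close>.\<close>

definition bin :: "complex \<Rightarrow> int \<Rightarrow> (nat \<Rightarrow> 'p) \<Rightarrow> 'p" where
  "bin e l g = Sum_any (\<lambda>i. sc (e ^ i * (of_int l gchoose i)) (g i))"

lemma bin_eq:
  assumes "\<And>i. i \<ge> K \<Longrightarrow> g i = 0"
  shows "bin e l g = (\<Sum>i<K. sc (e ^ i * (of_int l gchoose i)) (g i))"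
  unfolding bin_def
  by (rule Sum_any.expand_superset) (use assms not_less in auto)

text \<open>Pascal's rule, which drives all recursions in \<open>l\<close>.\<close>

lemma bin_Suc:
  assumes "ev0 g"
  shows "bin e (l + 1) g = bin e l g + sc e (bin e l (\<lambda>i. g (Suc i)))"
proof -
  obtain K where K: "\<And>i. i \<ge> K \<Longrightarrow> g i = 0" using assms unfolding ev0_def by blast
  have 1: "bin e (l+1) g = (\<Sum>i<Suc K. sc (e ^ i * (of_int (l+1) gchoose i)) (g i))"
    by (rule bin_eq) (use K in auto)
  have 2: "bin e l g = (\<Sum>i<Suc K. sc (e ^ i * (of_int l gchoose i)) (g i))"
    by (rule bin_eq) (use K in auto)
  have 3: "bin e l (\<lambda>i. g (Suc i)) = (\<Sum>i<K. sc (e ^ i * (of_int l gchoose i)) (g (Suc i)))"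
    by (rule bin_eq) (use K in auto)
  have 4: "(of_int (l+1) gchoose Suc i :: complex) = (of_int l gchoose i) + (of_int l gchoose Suc i)" for i
    using gbinomial_Suc_Suc[of "of_int l :: complex" i] by simp
  have 5: "e ^ Suc i * (of_int (l+1) gchoose Suc i) = e ^ Suc i * (of_int l gchoose Suc i) + e * (e ^ i * (of_int l gchoose i))" for i
    by (simp only: 4) (simp add: algebra_simps)
  show ?thesis
    unfolding 1 2 3 sum.lessThan_Suc_shift 5 scale_left_distrib sum.distrib scale_sum_right scale_scale
    by simp
qed

lemma bin_0: assumes "ev0 g" shows "bin e 0 g = g 0"
proof -
  obtain K where K: "\<And>i. i \<ge> K \<Longrightarrow> g i = 0" using assms unfolding ev0_def by blast
  have 1: "bin e 0 g = (\<Sum>i<Suc K. sc (e ^ i * (of_int 0 gchoose i)) (g i))"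
    by (rule bin_eq) (use K in auto)
  show ?thesis unfolding 1 sum.lessThan_Suc_shift by simp
qed

lemma bin_zero: "(\<And>i. g i = 0) \<Longrightarrow> bin e l g = 0"
  using bin_eq[of 0 g] by simp

lemma bin_add:
  assumes "ev0 g" "ev0 h" shows "bin e l (\<lambda>i. g i + h i) = bin e l g + bin e l h"
proof -
  obtain K where K: "\<And>i. i \<ge> K \<Longrightarrow> g i = 0" "\<And>i. i \<ge> K \<Longrightarrow> h i = 0"
    using ev0_bound2[OF assms] by blast
  show ?thesis
    by (simp add: bin_eq[of K] K scale_right_distrib sum.distrib)
qed

lemma bin_diff:
  assumes "ev0 g" "ev0 h" shows "bin e l (\<lambda>i. g i - h i) = bin e l g - bin e l h"
proof -
  obtain K where K: "\<And>i. i \<ge> K \<Longrightarrow> g i = 0" "\<And>i. i \<ge> K \<Longrightarrow> h i = 0"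
    using ev0_bound2[OF assms] by blast
  show ?thesis
    by (simp add: bin_eq[of K] K scale_right_diff_distrib sum_subtractf)
qed

lemma bin_scale:
  assumes "ev0 g" shows "bin e l (\<lambda>i. sc c (g i)) = sc c (bin e l g)"
proof -
  obtain K where K: "\<And>i. i \<ge> K \<Longrightarrow> g i = 0" using assms unfolding ev0_def by blast
  show ?thesis
    by (simp add: bin_eq[of K] K scale_sum_right mult.commute)
qed

lemma bin_mem:
  assumes S: "subspace S" and "ev0 g" "\<And>i. g i \<in> S" shows "bin e l g \<in> S"
proof -
  obtain K where K: "\<And>i. i \<ge> K \<Longrightarrow> g i = 0" using assms unfolding ev0_def by blast
  show ?thesis using assms
    by (auto simp: bin_eq[of K] K intro!: subspace_sum[OF S] subspace_scale[OF S])
qed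

lemma bin_swap:
  assumes K: "\<And>i j. i \<ge> K \<Longrightarrow> g i j = 0" "\<And>i j. j \<ge> K \<Longrightarrow> g i j = 0"
  shows "bin e l (\<lambda>i. bin e' l' (\<lambda>j. g i j)) = bin e' l' (\<lambda>j. bin e l (\<lambda>i. g i j))"
proof -
  have 1: "bin e' l' (\<lambda>j. g i j) = (\<Sum>j<K. sc (e' ^ j * (of_int l' gchoose j)) (g i j))" for i
    by (rule bin_eq) (use K in auto)
  have 2: "bin e l (\<lambda>i. g i j) = (\<Sum>i<K. sc (e ^ i * (of_int l gchoose i)) (g i j))" for j
    by (rule bin_eq) (use K in auto)
  have "bin e l (\<lambda>i. bin e' l' (\<lambda>j. g i j)) =
     (\<Sum>i<K. sc (e ^ i * (of_int l gchoose i)) (\<Sum>j<K. sc (e' ^ j * (of_int l' gchoose j)) (g i j)))"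
    unfolding 1 by (rule bin_eq) (use K in auto)
  also have "\<dots> = (\<Sum>j<K. sc (e' ^ j * (of_int l' gchoose j)) (\<Sum>i<K. sc (e ^ i * (of_int l gchoose i)) (g i j)))"
    unfolding scale_sum_right by (subst sum.swap) (simp add: mult.commute)
  also have "\<dots> = bin e' l' (\<lambda>j. bin e l (\<lambda>i. g i j))"
    unfolding 2 by (rule bin_eq[symmetric]) (use K in auto)
  finally show ?thesis .
qed

text \<open>This is \<open>(l - i) (l choose i) = (i + 1) (l choose (i + 1))\<close>; both sides come up when such a sum is
  differentiated.\<close>

lemma bin_weight:
  assumes "ev0 h" and that: "e * e' = 1"
  shows "bin e l (\<lambda>i. sc (of_int (l - int i)) (h (Suc i))) = sc e' (bin e l (\<lambda>i. sc (of_int (int i)) (h i)))"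
proof -
  obtain K where K: "\<And>i. i \<ge> K \<Longrightarrow> h i = 0" using assms unfolding ev0_def by blast
  have 1: "bin e l (\<lambda>i. sc (of_int (l - int i)) (h (Suc i))) =
     (\<Sum>i<K. sc (e ^ i * (of_int l gchoose i)) (sc (of_int (l - int i)) (h (Suc i))))"
    by (rule bin_eq) (use K in auto)
  have 2: "bin e l (\<lambda>i. sc (of_int (int i)) (h i)) =
     (\<Sum>i<Suc K. sc (e ^ i * (of_int l gchoose i)) (sc (of_int (int i)) (h i)))"
    by (rule bin_eq) (use K in auto)
  have 3: "e ^ i * (of_int l gchoose i) * of_int (l - int i) =
    e' * ((e ^ Suc i) * (of_int l gchoose Suc i) * of_int (int (Suc i)))" for i
    using gbinomial_absorb_comp[of "of_int l :: complex" i] that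
     gbinomial_absorption[of i "of_int l :: complex"]
    by (simp add: algebra_simps)
  show ?thesis unfolding 1 2 sum.lessThan_Suc_shift
    by (simp add: scale_sum_right 3 del: of_int_diff power_Suc of_nat_Suc)
qed

end

lemma bin_hom:
  assumes "complex_space s1" "complex_space s2" "module.subspace s1 S"
    and add: "\<And>x y. x \<in> S \<Longrightarrow> y \<in> S \<Longrightarrow> h (x + y) = h x + h y"
    and scale: "\<And>c x. x \<in> S \<Longrightarrow> h (s1 c x) = s2 c (h x)"
    and g: "ev0 g" "\<And>i. g i \<in> S"
  shows "h (complex_space.bin s1 e l g) = complex_space.bin s2 e l (\<lambda>i. h (g i))"
proof -
  interpret A: complex_space s1 by fact
  interpret B: complex_space s2 by fact
  obtain K where K: "\<And>i. i \<ge> K \<Longrightarrow> g i = 0" using g unfolding ev0_def by blast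
  have 0: "0 \<in> S" using assms(3) A.subspace_0 by blast
  have h0: "h 0 = 0" using scale[OF 0, of 0] by simp
  have sum: "h (sum f {..<k}) = (\<Sum>i<k. h (f i))" if "\<And>i. f i \<in> S" for f and k :: nat
    by (induction k) (auto simp: h0 add that A.subspace_sum[OF assms(3)])
  show ?thesis
    using K by (auto simp: A.bin_eq[of K] B.bin_eq[of K] h0 sum scale g A.subspace_scale[OF assms(3)])
qed

section \<open>Differences of coefficient arrays\<close>

text \<open>Multiplication by \<open>x - y\<close>, on the coefficients of a series in \<open>x\<close> and \<open>y\<close>.\<close>

definition dl :: "(int \<Rightarrow> int \<Rightarrow> 'x::ab_group_add) \<Rightarrow> int \<Rightarrow> int \<Rightarrow> 'x" where
  "dl f m n = f (m + 1) n - f m (n + 1)"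

lemma dl_pow_zero: "(\<And>m n. f m n = 0) \<Longrightarrow> (dl ^^ N) f m n = 0"
  by (induction N arbitrary: m n) (auto simp: dl_def)

lemma dl_pow_add: "(dl ^^ N) (\<lambda>m n. f m n + g m n) m n = (dl ^^ N) f m n + (dl ^^ N) g m n"
  by (induction N arbitrary: m n) (auto simp: dl_def)

lemma dl_pow_apply: "(dl ^^ N) f m n x = (dl ^^ N) (\<lambda>m n. f m n x) m n"
  by (induction N arbitrary: m n) (auto simp: dl_def)

lemma dl_pow_shift: "(dl ^^ N) (\<lambda>m n. f (m + i) (n + j)) m n = (dl ^^ N) f (m + i) (n + j)"
  by (induction N arbitrary: m n) (auto simp: dl_def algebra_simps)

lemma dl_pow_mono: "(\<And>m n. (dl ^^ N) f m n = 0) \<Longrightarrow> N \<le> M \<Longrightarrow> (dl ^^ M) f m n = 0"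
  using dl_pow_zero[of "(dl ^^ N) f" "M - N" m n]
  by (metis add.commute comp_apply funpow_add le_add_diff_inverse)

lemma dl_pow_flip: "(dl ^^ N) (\<lambda>m n. - f n m) m n = (if even N then - (dl ^^ N) f n m else (dl ^^ N) f n m)"
  by (induction N arbitrary: m n) (auto simp: dl_def)

lemma dl_pow_hom:
  assumes h: "\<And>x y. x \<in> S \<Longrightarrow> y \<in> S \<Longrightarrow> h (x - y) = h x - h y"
    and S: "\<And>x y. x \<in> S \<Longrightarrow> y \<in> S \<Longrightarrow> x - y \<in> S" and f: "\<And>m n. f m n \<in> S"
  shows "(dl ^^ N) (\<lambda>m n. h (f m n)) m n = h ((dl ^^ N) f m n)"
proof -
  have "(dl ^^ N) f m n \<in> S" for m n by (induction N arbitrary: m n) (auto simp: dl_def f S)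
  then show ?thesis
  proof (induction N arbitrary: m n)
    case (Suc N)
    have *: "(dl ^^ N) f m n \<in> S" for m n by (induction N arbitrary: m n) (auto simp: dl_def f S)
    then show ?case using Suc.IH[OF *] by (simp add: dl_def[of "(dl ^^ N) _"] h)
  qed simp
qed

text \<open>A series that is killed by a power of \<open>x - y\<close> is a combination of derivatives of the delta function, hence
  never truncated in \<open>y\<close> unless it is zero.\<close>

lemma dl_pow_trunc_zero:
  assumes "\<And>m n. (dl ^^ N) f m n = 0" "\<And>m n. n \<ge> (K::int) \<Longrightarrow> f m n = 0"
  shows "f m n = 0"
  using assms
proof (induction N arbitrary: f m n)
  case 0 then show ?case by simp
next
  case (Suc N)
  have "dl f m n = 0" for m n
  proof (rule Suc.IH)
    show "(dl ^^ N) (dl f) m n = 0" for m n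
      using Suc.prems(1)[of m n] by (simp only: funpow_Suc_right comp_apply)
    show "dl f m n = 0" if "n \<ge> K" for m n using Suc.prems(2) that by (simp add: dl_def)
  qed
  \<comment> \<open>Constant along antidiagonals, each of which reaches the region where \<open>f\<close> vanishes.\<close>
  then have step: "f m n = f (m - 1) (n + 1)" for m n
    using dl_def[of f "m - 1" n] by simp
  have "f m n = f (m - int j) (n + int j)" for j
  proof (induction j)
    case (Suc j)
    have "m - int j - 1 = m - int (Suc j)" "n + int j + 1 = n + int (Suc j)" by simp_all
    with Suc step[of "m - int j" "n + int j"] show ?case by (simp only:)
  qed simp
  moreover have "f (m - int (nat (K - n))) (n + int (nat (K - n))) = 0" by (rule Suc.prems(2)) simp
  ultimately show ?case by (simp only:)
qed

text \<open>Multiplication by \<open>x - z\<close> and by \<open>y - z\<close>, on the coefficients of a series in \<open>x\<close>, \<open>y\<close> and \<open>z\<close>.\<close>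

definition d13 :: "(int \<Rightarrow> int \<Rightarrow> int \<Rightarrow> 'x::ab_group_add) \<Rightarrow> int \<Rightarrow> int \<Rightarrow> int \<Rightarrow> 'x" where
  "d13 H m n p = H (m + 1) n p - H m n (p + 1)"

definition d23 :: "(int \<Rightarrow> int \<Rightarrow> int \<Rightarrow> 'x::ab_group_add) \<Rightarrow> int \<Rightarrow> int \<Rightarrow> int \<Rightarrow> 'x" where
  "d23 H m n p = H m (n + 1) p - H m n (p + 1)"

lemma d13_d23: "d13 (d23 H) = d23 (d13 H)"
  by (intro ext) (simp add: d13_def d23_def algebra_simps)

lemma d13_d23_pow1: "d13 ((d23 ^^ b) H) = (d23 ^^ b) (d13 H)"
  by (induction b) (auto simp: d13_d23)

lemma d13_pow_diff: "(d13 ^^ a) (f - g) = (d13 ^^ a) f - (d13 ^^ a) g"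
proof (induction a)
  case (Suc a)
  have "d13 (f - g) = d13 f - d13 g" for f g by (intro ext) (simp add: d13_def)
  with Suc show ?case by (simp only: funpow.simps(2) comp_apply)
qed simp

lemma d23_pow_diff: "(d23 ^^ a) (f - g) = (d23 ^^ a) f - (d23 ^^ a) g"
proof (induction a)
  case (Suc a)
  have "d23 (f - g) = d23 f - d23 g" for f g by (intro ext) (simp add: d23_def)
  with Suc show ?case by (simp only: funpow.simps(2) comp_apply)
qed simp

lemma d13_pow_0: "(d13 ^^ a) 0 = 0"
  using d13_pow_diff[of a 0 0] by (simp only: diff_self)
lemma d23_pow_0: "(d23 ^^ a) 0 = 0"
  using d23_pow_diff[of a 0 0] by (simp only: diff_self)

lemma d_pow_commute: "(d13 ^^ a) ((d23 ^^ b) H) = (d23 ^^ b) ((d13 ^^ a) H)"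
  by (induction a) (auto simp: d13_d23_pow1)

lemma d23_pow_dl: "(d23 ^^ N) H m n p = (dl ^^ N) (H m) n p"
  by (induction N arbitrary: n p) (auto simp: d23_def dl_def)

lemma d13_pow_dl: "(d13 ^^ N) H m n p = (dl ^^ N) (\<lambda>m p. H m n p) m p"
  by (induction N arbitrary: m p) (auto simp: d13_def dl_def)

text \<open>Raising \<open>l\<close> is multiplication by \<open>x - y = (x - z) - (y - z)\<close>.  So one factor \<open>y - z\<close> can be traded for a
  factor \<open>x - z\<close> or for an increase of \<open>l\<close>.  After enough trades, either \<open>l\<close> has reached \<open>N\<close>, or there are
  \<open>N\<close> factors of either kind.\<close>

lemma dong_recursion:
  fixes H :: "int \<Rightarrow> int \<Rightarrow> int \<Rightarrow> int \<Rightarrow> 'x::ab_group_add"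
  assumes rec: "\<And>l. d23 (H l) = d13 (H l) - H (l + 1)"
    and both: "\<And>l. (d13 ^^ N) ((d23 ^^ N) (H l)) = 0"
    and top: "\<And>l. l \<ge> int N \<Longrightarrow> H l = 0"
  shows "(d23 ^^ (2 * N + nat (int N - l))) (H l) = 0"
proof -
  \<comment> \<open>\<open>c\<close> bounds the number of trades that can still be made; each of them costs one of the \<open>b\<close> factors.\<close>
  have "(d13 ^^ a) ((d23 ^^ b) (H l)) = 0" if "(N - a) + nat (int N - l) \<le> c" "b \<ge> N + c" for a b l c
    using that
  proof (induction c arbitrary: a b l)
    case 0
    then have "H l = 0" using top by simp
    then show ?case by (simp only: d13_pow_0 d23_pow_0)
  next
    case (Suc c)
    then obtain b' where b: "b = Suc b'" by (metis Suc_le_D add_Suc_right)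
    consider "a \<ge> N" | "l \<ge> int N" | "a < N" "l < int N" by linarith
    then show ?case
    proof cases
      case 1
      then obtain a' where a': "a = a' + N" by (metis add.commute le_Suc_ex)
      from Suc.prems obtain b'' where b'': "b = b'' + N"
        by (metis add.commute add_leE le_Suc_ex)
      have "(d13 ^^ a) ((d23 ^^ b) (H l)) = (d13 ^^ a') ((d13 ^^ N) ((d23 ^^ b'') ((d23 ^^ N) (H l))))"
        by (simp only: a' b'' funpow_add comp_apply)
      also have "\<dots> = 0" by (subst d_pow_commute) (simp only: both d13_pow_0 d23_pow_0)
      finally show ?thesis .
    next
      case 2
      then have "H l = 0" using top by simp
      then show ?thesis by (simp only: d13_pow_0 d23_pow_0)
    next
      case 3
      have "(d13 ^^ a) ((d23 ^^ b) (H l)) = (d13 ^^ a) ((d23 ^^ b') (d23 (H l)))"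
        by (simp only: b funpow_Suc_right comp_apply)
      also have "\<dots> = (d13 ^^ a) ((d23 ^^ b') (d13 (H l))) - (d13 ^^ a) ((d23 ^^ b') (H (l + 1)))"
        by (simp only: rec d13_pow_diff d23_pow_diff)
      also have "(d13 ^^ a) ((d23 ^^ b') (d13 (H l))) = (d13 ^^ Suc a) ((d23 ^^ b') (H l))"
        by (simp only: d13_d23_pow1[symmetric] funpow_Suc_right comp_apply)
      also have "\<dots> = 0" by (rule Suc.IH) (use Suc.prems b 3 in auto)
      also have "(d13 ^^ a) ((d23 ^^ b') (H (l + 1))) = 0" by (rule Suc.IH) (use Suc.prems b 3 in auto)
      finally show ?thesis by simp
    qed
  qed
  from this[of 0 l "N + nat (int N - l)" "2 * N + nat (int N - l)"] show ?thesis by simp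
qed

section \<open>Fields and their products\<close>

lemma trunc_uniform:
  assumes "\<And>i::nat. i < J \<Longrightarrow> \<exists>K::int. \<forall>n\<ge>K. P n i"
  shows "\<exists>K. \<forall>i<J. \<forall>n\<ge>K. P n i"
  using assms
proof (induction J)
  case (Suc J)
  then obtain K1 K2 where "\<forall>i<J. \<forall>n\<ge>K1. P n i" "\<forall>n\<ge>K2. P n J"
    by (metis less_Suc_eq)
  then show ?case by (intro exI[of _ "max K1 K2"]) (auto simp: less_Suc_eq)
qed simp

locale field_space = complex_space sc for sc :: "complex \<Rightarrow> 'p::ab_group_add \<Rightarrow> 'p" +
  fixes S :: "'p set"
  assumes S: "subspace S"
begin

text \<open>Fields act on a subspace \<open>S\<close> of a type and are zero outside of it, which makes equality of fields an
  equality of functions.  A space of fields is again such a subspace, so that fields can act on fields.\<close>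

definition vfield :: "(int \<Rightarrow> 'p \<Rightarrow> 'p) \<Rightarrow> bool" where
  "vfield A \<longleftrightarrow> (\<forall>n. \<forall>w\<in>S. A n w \<in> S) \<and> (\<forall>n. \<forall>v\<in>S. \<forall>w\<in>S. A n (v + w) = A n v + A n w) \<and>
     (\<forall>n c. \<forall>w\<in>S. A n (sc c w) = sc c (A n w)) \<and> (\<forall>w\<in>S. \<exists>K. \<forall>n\<ge>K. A n w = 0) \<and>
     (\<forall>n w. w \<notin> S \<longrightarrow> A n w = 0)"

text \<open>The two halves of the \<open>m\<close>-th product of fields: the residues in \<open>x\<close> of \<open>(x - y)^m A(x) C(y)\<close> and of
  \<open>(-y + x)^m C(y) A(x)\<close>.\<close>

definition al :: "(int \<Rightarrow> 'p \<Rightarrow> 'p) \<Rightarrow> int \<Rightarrow> (int \<Rightarrow> 'p \<Rightarrow> 'p) \<Rightarrow> int \<Rightarrow> 'p \<Rightarrow> 'p" where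
  "al A m C k w = bin (-1) m (\<lambda>i. A (m - int i) (C (k + int i) w))"

definition be :: "(int \<Rightarrow> 'p \<Rightarrow> 'p) \<Rightarrow> int \<Rightarrow> (int \<Rightarrow> 'p \<Rightarrow> 'p) \<Rightarrow> int \<Rightarrow> 'p \<Rightarrow> 'p" where
  "be A m C k w = sc ((-1) powi m) (bin (-1) m (\<lambda>i. C (m + k - int i) (A (int i) w)))"

definition prd :: "(int \<Rightarrow> 'p \<Rightarrow> 'p) \<Rightarrow> int \<Rightarrow> (int \<Rightarrow> 'p \<Rightarrow> 'p) \<Rightarrow> int \<Rightarrow> 'p \<Rightarrow> 'p" where
  "prd A l B = (\<lambda>n w. al A l B n w - be A l B n w)"

text \<open>The coefficients of \<open>(x - y)^l A(x) B(y) - (-y + x)^l B(y) A(x)\<close>, the left-hand side of the Jacobi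
  identity.\<close>

definition Lf :: "(int \<Rightarrow> 'p \<Rightarrow> 'p) \<Rightarrow> (int \<Rightarrow> 'p \<Rightarrow> 'p) \<Rightarrow> int \<Rightarrow> int \<Rightarrow> int \<Rightarrow> 'p \<Rightarrow> 'p" where
  "Lf A B l m n w = bin (-1) l (\<lambda>i. A (l + m - int i) (B (n + int i) w)) -
     sc ((-1) powi l) (bin (-1) l (\<lambda>i. B (l + n - int i) (A (m + int i) w)))"

definition comm :: "(int \<Rightarrow> 'p \<Rightarrow> 'p) \<Rightarrow> (int \<Rightarrow> 'p \<Rightarrow> 'p) \<Rightarrow> 'p \<Rightarrow> int \<Rightarrow> int \<Rightarrow> 'p" where
  "comm A B w m n = A m (B n w) - B n (A m w)"

text \<open>Locality of order \<open>N\<close>: the product of \<open>(x - y)^N\<close> and \<open>[A(x), B(y)]\<close> is zero.\<close>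

definition loc :: "nat \<Rightarrow> (int \<Rightarrow> 'p \<Rightarrow> 'p) \<Rightarrow> (int \<Rightarrow> 'p \<Rightarrow> 'p) \<Rightarrow> bool" where
  "loc N A B \<longleftrightarrow> (\<forall>w\<in>S. \<forall>m n. (dl ^^ N) (comm A B w) m n = 0)"

definition mlocal :: "(int \<Rightarrow> 'p \<Rightarrow> 'p) \<Rightarrow> (int \<Rightarrow> 'p \<Rightarrow> 'p) \<Rightarrow> bool" where
  "mlocal A B \<longleftrightarrow> (\<exists>N. loc N A B)"

definition idf :: "int \<Rightarrow> 'p \<Rightarrow> 'p" where
  "idf n w = (if n = -1 \<and> w \<in> S then w else 0)"

lemmas S_zero = subspace_0[OF S] and S_add = subspace_add[OF S] and S_diff = subspace_diff[OF S]
  and S_scale = subspace_scale[OF S] and S_neg = subspace_neg[OF S]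

lemma prd_Lf: "prd A l B n w = Lf A B l 0 n w"
  by (simp add: prd_def al_def be_def Lf_def)

lemma vfieldI:
  assumes "\<And>n w. w \<in> S \<Longrightarrow> A n w \<in> S" "\<And>n v w. v \<in> S \<Longrightarrow> w \<in> S \<Longrightarrow> A n (v + w) = A n v + A n w"
    "\<And>n c w. w \<in> S \<Longrightarrow> A n (sc c w) = sc c (A n w)" "\<And>w. w \<in> S \<Longrightarrow> \<exists>K. \<forall>n\<ge>K. A n w = 0"
    "\<And>n w. w \<notin> S \<Longrightarrow> A n w = 0"
  shows "vfield A"
  using assms unfolding vfield_def by blast

lemma vf_mem: "vfield A \<Longrightarrow> w \<in> S \<Longrightarrow> A n w \<in> S"
  and vf_add: "vfield A \<Longrightarrow> v \<in> S \<Longrightarrow> w \<in> S \<Longrightarrow> A n (v + w) = A n v + A n w"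
  and vf_scale: "vfield A \<Longrightarrow> w \<in> S \<Longrightarrow> A n (sc c w) = sc c (A n w)"
  and vf_trunc: "vfield A \<Longrightarrow> w \<in> S \<Longrightarrow> \<exists>K. \<forall>n\<ge>K. A n w = 0"
  and vf_out: "vfield A \<Longrightarrow> w \<notin> S \<Longrightarrow> A n w = 0"
  unfolding vfield_def by blast+

lemma vf_zero: "vfield A \<Longrightarrow> A n 0 = 0"
  using vf_scale[of A 0 n 0] S_zero by simp

lemma vf_neg: "vfield A \<Longrightarrow> w \<in> S \<Longrightarrow> A n (- w) = - A n w"
  using vf_scale[of A w n "-1"] by simp

lemma vf_diff: "vfield A \<Longrightarrow> v \<in> S \<Longrightarrow> w \<in> S \<Longrightarrow> A n (v - w) = A n v - A n w"
  using vf_add[of A v "- w" n] vf_neg[of A w n] S_neg by simp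

lemma vf_mem': "vfield A \<Longrightarrow> A n w \<in> S"
  by (metis vf_mem vf_out S_zero)

lemma vf_ev0: assumes "vfield B" "\<And>i. f i 0 = 0" shows "ev0 (\<lambda>i. f i (B (n + int i) w))"
proof (cases "w \<in> S")
  case True
  then obtain K where K: "\<forall>n\<ge>K. B n w = 0" using vf_trunc assms by blast
  show ?thesis by (rule ev0I[of "nat (K - n)"]) (use K assms in auto)
next
  case False
  then show ?thesis by (intro ev0I) (simp add: vf_out assms)
qed

lemma vf_ev0A: "vfield A \<Longrightarrow> vfield B \<Longrightarrow> ev0 (\<lambda>i. A (f i) (B (n + int i) w))"
  by (rule vf_ev0[of B "\<lambda>i. A (f i)"]) (auto simp: vf_zero)

lemma vf_ev00: "vfield A \<Longrightarrow> vfield B \<Longrightarrow> ev0 (\<lambda>i. A (f i) (B (int i) w))"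
  using vf_ev0A[of A B f 0 w] by simp

lemma vf_bin:
  assumes "vfield A" "ev0 g" "\<And>i. g i \<in> S"
  shows "A n (bin e l g) = bin e l (\<lambda>i. A n (g i))"
  by (rule bin_hom[where S = S]) (use assms S vf_add vf_scale complex_space_axioms in auto)

lemma al_vfield:
  assumes A: "vfield A" and C: "vfield C" shows "vfield (al A m C)"
proof (rule vfieldI)
  fix k w
  show "al A m C k w \<in> S"
    unfolding al_def by (intro bin_mem S vf_ev0A A C vf_mem')
  show "al A m C k w = 0" if "w \<notin> S"
    unfolding al_def by (rule bin_zero) (simp add: vf_out[OF C] vf_zero[OF A] that)
next
  fix k v w assume "v \<in> S" "w \<in> S"
  then show "al A m C k (v + w) = al A m C k v + al A m C k w"
    unfolding al_def bin_add[OF vf_ev0A[OF A C] vf_ev0A[OF A C], symmetric]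
    by (simp add: vf_add[OF A] vf_add[OF C] vf_mem'[OF C])
next
  fix k c w assume "w \<in> S"
  then show "al A m C k (sc c w) = sc c (al A m C k w)"
    unfolding al_def bin_scale[OF vf_ev0A[OF A C], symmetric]
    by (simp add: vf_scale[OF A] vf_scale[OF C] vf_mem'[OF C])
next
  fix w assume "w \<in> S"
  then obtain K where K: "\<forall>n\<ge>K. C n w = 0" using vf_trunc C by blast
  then have "al A m C n w = 0" if "n \<ge> K" for n
    unfolding al_def by (intro bin_zero) (use that in \<open>simp add: vf_zero[OF A]\<close>)
  then show "\<exists>K. \<forall>n\<ge>K. al A m C n w = 0" by blast
qed

lemma be_vfield:
  assumes A: "vfield A" and C: "vfield C" shows "vfield (be A m C)"
proof (rule vfieldI)
  fix k w
  show "be A m C k w \<in> S"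
    unfolding be_def by (intro S_scale bin_mem S vf_ev00 A C vf_mem')
  show "be A m C k w = 0" if "w \<notin> S"
    unfolding be_def by (subst bin_zero) (simp_all add: vf_out[OF A] vf_zero[OF C] that)
next
  fix k v w assume "v \<in> S" "w \<in> S"
  then show "be A m C k (v + w) = be A m C k v + be A m C k w"
    unfolding be_def scale_right_distrib[symmetric] bin_add[OF vf_ev00[OF C A] vf_ev00[OF C A], symmetric]
    by (simp add: vf_add[OF A] vf_add[OF C] vf_mem'[OF A])
next
  fix k c w assume "w \<in> S"
  then have "C (m + k - int i) (A (int i) (sc c w)) = sc c (C (m + k - int i) (A (int i) w))" for i
    by (simp add: vf_scale[OF A] vf_scale[OF C] vf_mem'[OF A])
  then have "be A m C k (sc c w) = sc ((-1) powi m) (sc c (bin (-1) m (\<lambda>i. C (m + k - int i) (A (int i) w))))"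
    by (simp only: be_def bin_scale[OF vf_ev00[OF C A]])
  then show "be A m C k (sc c w) = sc c (be A m C k w)" by (simp add: be_def mult.commute)
next
  fix w assume w: "w \<in> S"
  then obtain J where J: "\<forall>n\<ge>J. A n w = 0" using vf_trunc A by blast
  have "\<exists>K. \<forall>n\<ge>K. C n (A (int i) w) = 0" for i using vf_trunc[OF C vf_mem[OF A w]] by blast
  then obtain K where K: "\<forall>i<nat J. \<forall>n\<ge>K. C n (A (int i) w) = 0"
    using trunc_uniform[of "nat J" "\<lambda>n i. C n (A (int i) w) = 0"] by blast
  have "be A m C n w = 0" if "n \<ge> K + J - m" for n
  proof -
    have "C (m + n - int i) (A (int i) w) = 0" for i
    proof (cases "i < nat J")
      case True
      then have "m + n - int i \<ge> K" using that by linarith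
      then show ?thesis using K True by blast
    next
      case False
      then show ?thesis using J by (simp add: vf_zero[OF C])
    qed
    then show ?thesis unfolding be_def by (subst bin_zero) auto
  qed
  then show "\<exists>K. \<forall>n\<ge>K. be A m C n w = 0" by blast
qed

lemma vfield_add: assumes "vfield A" "vfield B" shows "vfield (\<lambda>n w. A n w + B n w)"
proof (rule vfieldI)
  fix w assume "w \<in> S"
  then obtain K1 K2 where "\<forall>n\<ge>K1. A n w = 0" "\<forall>n\<ge>K2. B n w = 0"
    using vf_trunc[OF assms(1)] vf_trunc[OF assms(2)] by blast
  then show "\<exists>K. \<forall>n\<ge>K. A n w + B n w = 0" by (intro exI[of _ "max K1 K2"]) auto
qed (auto simp: vf_add[OF assms(1)] vf_scale[OF assms(1)] vf_out[OF assms(1)] vf_add[OF assms(2)] vf_scale[OF assms(2)]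
    vf_out[OF assms(2)] scale_right_distrib algebra_simps intro!: S_add vf_mem[OF assms(1)] vf_mem[OF assms(2)])

lemma vfield_scale: assumes "vfield A" shows "vfield (\<lambda>n w. sc c (A n w))"
proof (rule vfieldI)
  fix w assume "w \<in> S"
  then obtain K1 where "\<forall>n\<ge>K1. A n w = 0" using vf_trunc[OF assms] by blast
  then show "\<exists>K. \<forall>n\<ge>K. sc c (A n w) = 0" by (intro exI[of _ "K1"]) auto
qed (auto simp: vf_add[OF assms] vf_scale[OF assms] vf_out[OF assms] scale_right_distrib mult.commute
    intro!: S_scale vf_mem[OF assms])

lemma vfield_diff: assumes "vfield A" "vfield B" shows "vfield (\<lambda>n w. A n w - B n w)"
  using vfield_add[OF assms(1) vfield_scale[OF assms(2), of "-1"]] by simp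

lemma vfield_zero: "vfield (\<lambda>n w. 0)"
  by (rule vfieldI) (auto simp: S_zero)

lemma vfield_idf: "vfield idf"
proof (rule vfieldI)
  fix w show "\<exists>K. \<forall>n\<ge>K. idf n w = 0" by (intro exI[of _ 0]) (auto simp: idf_def)
qed (auto simp: idf_def S_zero S_add S_scale)

lemma prd_vfield: "vfield A \<Longrightarrow> vfield C \<Longrightarrow> vfield (prd A m C)"
  unfolding prd_def by (intro vfield_diff al_vfield be_vfield)

text \<open>Multiplication by \<open>x - y\<close>, on either side of the difference, raises \<open>l\<close>.\<close>

lemma Lf_rec:
  assumes A: "vfield A" and B: "vfield B"
  shows "Lf A B (l + 1) m n w = Lf A B l (m + 1) n w - Lf A B l m (n + 1) w"
proof -
  have e: "l + 1 + m - int i = l + (m + 1) - int i" "l + 1 + m - int (Suc i) = l + m - int i"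
    "n + int (Suc i) = n + 1 + int i" "l + 1 + n - int i = l + (n + 1) - int i"
    "l + 1 + n - int (Suc i) = l + n - int i" "m + int (Suc i) = m + 1 + int i" for i by auto
  have p: "(-1) powi (l + 1) = - ((-1) powi l :: complex)" by (simp add: power_int_add_1)
  show ?thesis
    unfolding Lf_def bin_Suc[OF vf_ev0A[OF A B]] bin_Suc[OF vf_ev0A[OF B A]] p e
    by (simp add: algebra_simps scale_right_diff_distrib)
qed

lemma Lf_0: "vfield A \<Longrightarrow> vfield B \<Longrightarrow> Lf A B 0 m n w = comm A B w m n"
  unfolding Lf_def comm_def by (subst (1 2) bin_0) (auto intro: vf_ev0A)

lemma Lf_nat:
  assumes "vfield A" "vfield B" shows "Lf A B (int k) m n w = (dl ^^ k) (comm A B w) m n"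
proof (induction k arbitrary: m n)
  case 0 then show ?case by (simp add: Lf_0 assms)
next
  case (Suc k)
  have "int (Suc k) = int k + 1" by simp
  then show ?case by (simp only: Lf_rec[OF assms] Suc.IH) (simp add: dl_def)
qed

lemma Lf_out: "vfield A \<Longrightarrow> vfield B \<Longrightarrow> w \<notin> S \<Longrightarrow> Lf A B l m n w = 0"
  unfolding Lf_def by (subst (1 2) bin_zero) (auto simp: vf_out[of A] vf_out[of B] vf_zero[of A] vf_zero[of B])

lemma loc_mono: "loc N A B \<Longrightarrow> N \<le> M \<Longrightarrow> loc M A B"
  unfolding loc_def using dl_pow_mono by metis

lemma Lf_top:
  assumes "vfield A" "vfield B" "loc N A B" "l \<ge> int N" shows "Lf A B l m n w = 0"
proof (cases "w \<in> S")
  case True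
  obtain k where k: "l = int k" using assms(4) by (metis nat_0_le of_nat_0_le_iff order_trans)
  with assms have "loc k A B" using loc_mono by auto
  then show ?thesis unfolding k Lf_nat[OF assms(1,2)] loc_def using True by blast
qed (use Lf_out assms in auto)

lemma prd_top: "vfield A \<Longrightarrow> vfield B \<Longrightarrow> loc N A B \<Longrightarrow> l \<ge> int N \<Longrightarrow> prd A l B = (\<lambda>n w. 0)"
  by (intro ext) (simp add: prd_Lf Lf_top)

lemma loc_sym: assumes "vfield A" "vfield B" "loc N A B" shows "loc N B A"
proof -
  have "comm B A w = (\<lambda>m n. - comm A B w n m)" for w by (intro ext) (simp add: comm_def)
  then show ?thesis using assms(3) by (auto simp: loc_def dl_pow_flip)
qed

lemma mlocal_sym: "vfield A \<Longrightarrow> vfield B \<Longrightarrow> mlocal A B \<Longrightarrow> mlocal B A"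
  unfolding mlocal_def using loc_sym by blast

lemma mlocal_common:
  assumes "mlocal A B" "mlocal C D" obtains N where "loc N A B" "loc N C D"
proof -
  from assms obtain M N where "loc M A B" "loc N C D" unfolding mlocal_def by blast
  then show ?thesis using that[of "max M N"] loc_mono by auto
qed

lemma mlocal_add:
  assumes A: "vfield A" and "vfield B" "vfield C" "mlocal A B" "mlocal A C"
  shows "mlocal A (\<lambda>n w. B n w + C n w)"
proof -
  obtain N where N: "loc N A B" "loc N A C" using mlocal_common assms by metis
  have "comm A (\<lambda>n w. B n w + C n w) w = (\<lambda>m n. comm A B w m n + comm A C w m n)" if "w \<in> S" for w
    by (intro ext) (simp add: comm_def vf_add[OF A] vf_mem' assms)
  then have "loc N A (\<lambda>n w. B n w + C n w)" using N by (auto simp: loc_def dl_pow_add)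
  then show ?thesis unfolding mlocal_def by blast
qed

lemma mlocal_scale:
  assumes A: "vfield A" and "vfield B" "mlocal A B"
  shows "mlocal A (\<lambda>n w. sc c (B n w))"
proof -
  obtain N where N: "loc N A B" using assms unfolding mlocal_def by metis
  have "comm A (\<lambda>n w. sc c (B n w)) w = (\<lambda>m n. sc c (comm A B w m n))" if "w \<in> S" for w
    by (intro ext) (simp add: comm_def vf_scale[OF A] vf_mem' assms scale_right_diff_distrib)
  then have "loc N A (\<lambda>n w. sc c (B n w))" using N
    dl_pow_hom[of UNIV "sc c"]  by (auto simp: loc_def scale_right_diff_distrib)
  then show ?thesis unfolding mlocal_def by blast
qed

lemma mlocal_diff:
  assumes A: "vfield A" and "vfield B" "vfield C" "mlocal A B" "mlocal A C"
  shows "mlocal A (\<lambda>n w. B n w - C n w)"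
  using mlocal_add[OF A assms(2) vfield_scale[OF assms(3), of "-1"]] mlocal_scale[OF A, of C "-1"] assms
  by simp

lemma mlocal_zero: assumes "vfield A" shows "mlocal A (\<lambda>n w. 0)"
proof -
  have "loc 0 A (\<lambda>n w. 0)" by (auto simp: loc_def comm_def vf_zero[OF assms])
  then show ?thesis unfolding mlocal_def by blast
qed

lemma loc_idf: assumes "vfield A" shows "loc 0 A idf"
  by (auto simp: loc_def comm_def idf_def vf_mem'[OF assms] vf_zero[OF assms])

lemma mlocal_idf: "vfield A \<Longrightarrow> mlocal A idf"
  using loc_idf unfolding mlocal_def by blast

subsection \<open>The Jacobi identity of two local fields\<close>

text \<open>Both sides satisfy the recursion of \<open>Lf_rec\<close> in \<open>l\<close>.  They agree at \<open>m = 0\<close>, which is the definition of the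
  products, and they vanish for \<open>l \<ge> N\<close> by locality.  The recursion determines the values at positive \<open>m\<close>
  from those at \<open>m = 0\<close>, and at negative \<open>m\<close> by descent from large \<open>l\<close>.\<close>

lemma prd_jacobi:
  assumes A: "vfield A" and B: "vfield B" and loc: "loc N A B"
  shows "Lf A B l m n w = bin 1 m (\<lambda>i. prd A (l + int i) B (m + n - int i) w)"
proof -
  define R where "R = (\<lambda>l m n. bin 1 m (\<lambda>i. prd A (l + int i) B (m + n - int i) w))"
  define X where "X = (\<lambda>l m n. Lf A B l m n w - R l m n)"
  have top: "prd A l B n v = 0" if "l \<ge> int N" for l n v using prd_top[OF A B loc that] by simp
  have ev: "ev0 (\<lambda>i. prd A (l + int i) B (f i) w)" for l f
    by (rule ev0I[of "nat (int N - l)"]) (rule top, simp)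
  have Rrec: "R l (m + 1) n = R l m (n + 1) + R (l + 1) m n" for l m n
  proof -
    have e: "m + 1 + n - int i = m + (n + 1) - int i" "l + int (Suc i) = l + 1 + int i"
      "m + (n + 1) - int (Suc i) = m + n - int i" for i by auto
    show ?thesis unfolding R_def by (subst bin_Suc[OF ev]) (simp only: e scale_one)
  qed
  have Xrec: "X l (m + 1) n = X l m (n + 1) + X (l + 1) m n" for l m n
    using Rrec Lf_rec[OF A B] by (simp add: X_def)
  have X0: "X l 0 n = 0" for l n
    by (simp add: X_def R_def prd_Lf bin_0[OF ev, unfolded prd_Lf])
  have Xtop: "X l m n = 0" if "l \<ge> int N" for l m n
    using that Lf_top[OF A B loc] by (simp add: X_def R_def top bin_zero)
  \<comment> \<open>Upwards in \<open>m\<close>, for all \<open>l\<close> at once.\<close>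
  have pos: "X l (int k) n = 0" for k l n
  proof (induction k arbitrary: l n)
    case (Suc k)
    have "int (Suc k) = int k + 1" by simp
    then show ?case by (simp only: Xrec Suc.IH) simp
  qed (simp add: X0)
  \<comment> \<open>Downwards in \<open>m\<close>; for fixed \<open>m\<close>, downwards in \<open>l\<close> from \<open>N\<close>.\<close>
  have neg: "X l (- int k) n = 0" for k l n
  proof (induction k arbitrary: l n)
    case (Suc k)
    have "X l (- int (Suc k)) n = 0" if "int N - l \<le> int j" for j l n using that
    proof (induction j arbitrary: l n)
      case 0 then show ?case using Xtop by simp
    next
      case (Suc j)
      have "X l (- int (Suc k) + 1) (n - 1) = X l (- int (Suc k)) (n - 1 + 1) + X (l + 1) (- int (Suc k)) (n - 1)"
        by (rule Xrec)
      moreover have "X (l + 1) (- int (Suc k)) (n - 1) = 0" by (rule Suc.IH) (use Suc.prems in simp)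
      moreover have "- int (Suc k) + 1 = - int k" by simp
      ultimately show ?case using \<open>\<And>n l. X l (- int k) n = 0\<close> by simp
    qed
    then show ?case by (metis nat_le_iff order_refl zle_int)
  qed (simp add: X0)
  have "X l m n = 0" using pos neg by (metis int_cases2)
  then show ?thesis by (simp add: X_def R_def)
qed

subsection \<open>Dong's lemma\<close>

lemma d13_pow_bin:
  assumes "\<And>m n p. ev0 (\<lambda>i. X i m n p)"
  shows "(d13 ^^ N) (\<lambda>m n p. bin e l (\<lambda>i. X i m n p)) = (\<lambda>m n p. bin e l (\<lambda>i. (d13 ^^ N) (X i) m n p)) \<and>
    (\<forall>m n p. ev0 (\<lambda>i. (d13 ^^ N) (X i) m n p))"
proof (induction N)
  case (Suc N)
  then have ev: "ev0 (\<lambda>i. (d13 ^^ N) (X i) m n p)" for m n p by blast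
  have "(d13 ^^ Suc N) (\<lambda>m n p. bin e l (\<lambda>i. X i m n p)) = d13 (\<lambda>m n p. bin e l (\<lambda>i. (d13 ^^ N) (X i) m n p))"
    using Suc by simp
  also have "\<dots> = (\<lambda>m n p. bin e l (\<lambda>i. (d13 ^^ Suc N) (X i) m n p))"
    by (intro ext) (simp add: d13_def bin_diff ev)
  finally have "(d13 ^^ Suc N) (\<lambda>m n p. bin e l (\<lambda>i. X i m n p)) = \<dots>" .
  moreover have "ev0 (\<lambda>i. (d13 ^^ Suc N) (X i) m n p)" for m n p
  proof -
    have "(d13 ^^ Suc N) (X i) m n p = (d13 ^^ N) (X i) (m + 1) n p - (d13 ^^ N) (X i) m n (p + 1)" for i
      by (simp add: d13_def)
    then show ?thesis using ev0_diff[OF ev ev] by (simp only:)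
  qed
  ultimately show ?case by blast
qed (use assms in simp)

lemma d23_pow_bin:
  assumes "\<And>m n p. ev0 (\<lambda>i. X i m n p)"
  shows "(d23 ^^ N) (\<lambda>m n p. bin e l (\<lambda>i. X i m n p)) = (\<lambda>m n p. bin e l (\<lambda>i. (d23 ^^ N) (X i) m n p)) \<and>
    (\<forall>m n p. ev0 (\<lambda>i. (d23 ^^ N) (X i) m n p))"
proof (induction N)
  case (Suc N)
  then have ev: "ev0 (\<lambda>i. (d23 ^^ N) (X i) m n p)" for m n p by blast
  have "(d23 ^^ Suc N) (\<lambda>m n p. bin e l (\<lambda>i. X i m n p)) = d23 (\<lambda>m n p. bin e l (\<lambda>i. (d23 ^^ N) (X i) m n p))"
    using Suc by simp
  also have "\<dots> = (\<lambda>m n p. bin e l (\<lambda>i. (d23 ^^ Suc N) (X i) m n p))"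
    by (intro ext) (simp add: d23_def bin_diff ev)
  finally have "(d23 ^^ Suc N) (\<lambda>m n p. bin e l (\<lambda>i. X i m n p)) = \<dots>" .
  moreover have "ev0 (\<lambda>i. (d23 ^^ Suc N) (X i) m n p)" for m n p
  proof -
    have "(d23 ^^ Suc N) (X i) m n p = (d23 ^^ N) (X i) m (n + 1) p - (d23 ^^ N) (X i) m n (p + 1)" for i
      by (simp add: d23_def)
    then show ?thesis using ev0_diff[OF ev ev] by (simp only:)
  qed
  ultimately show ?case by blast
qed (use assms in simp)

lemma d_pow_bin_zero:
  assumes "\<And>m n p. ev0 (\<lambda>i. X i m n p)" "\<And>i. (d13 ^^ N) ((d23 ^^ N) (X i)) = 0"
  shows "(d13 ^^ N) ((d23 ^^ N) (\<lambda>m n p. bin e l (\<lambda>i. X i m n p))) = 0"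
proof -
  have ev: "ev0 (\<lambda>i. (d23 ^^ N) (X i) m n p)" for m n p
    using d23_pow_bin[of X N, OF assms(1)] by blast
  have "(d13 ^^ N) ((d23 ^^ N) (\<lambda>m n p. bin e l (\<lambda>i. X i m n p))) =
     (\<lambda>m n p. bin e l (\<lambda>i. (d13 ^^ N) ((d23 ^^ N) (X i)) m n p))"
    using d23_pow_bin[of X N, OF assms(1)] d13_pow_bin[of "\<lambda>i. (d23 ^^ N) (X i)" N, OF ev] by simp
  then show ?thesis by (simp add: assms(2) bin_zero fun_eq_iff)
qed

lemma d_pow_left:
  assumes A: "vfield A" and BC: "loc N B C" and "w \<in> S" and "vfield B" "vfield C"
  shows "(d13 ^^ N) ((d23 ^^ N) (\<lambda>m n p. A (f m) (comm B C w (n + i) p))) = 0"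
    and "(d23 ^^ N) ((d13 ^^ N) (\<lambda>m n p. A (f n) (comm B C w (m + i) p))) = 0"
proof -
  have mem: "comm B C w n p \<in> S" for n p unfolding comm_def by (intro S_diff vf_mem' assms)
  have *: "(dl ^^ N) (\<lambda>n p. A k (comm B C w (n + i) p)) n p = 0" for n p k
  proof -
    have "(dl ^^ N) (\<lambda>n p. A k (comm B C w (n + i) p)) n p = A k ((dl ^^ N) (\<lambda>n p. comm B C w (n + i) p) n p)"
      by (rule dl_pow_hom[of S]) (auto intro: vf_diff A S_diff mem)
    also have "(dl ^^ N) (\<lambda>n p. comm B C w (n + i) p) n p = 0"
      using dl_pow_shift[where f = "comm B C w" and j = 0 and N = N and i = i and m = n and n = p] BC \<open>w \<in> S\<close>
      by (simp add: loc_def)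
    finally show ?thesis by (simp add: vf_zero[OF A])
  qed
  have "(d23 ^^ N) (\<lambda>m n p. A (f m) (comm B C w (n + i) p)) = 0"
    by (intro ext) (simp add: d23_pow_dl *)
  then show "(d13 ^^ N) ((d23 ^^ N) (\<lambda>m n p. A (f m) (comm B C w (n + i) p))) = 0"
    by (simp only: d13_pow_0)
  have "(d13 ^^ N) (\<lambda>m n p. A (f n) (comm B C w (m + i) p)) = 0"
    by (intro ext) (simp add: d13_pow_dl *)
  then show "(d23 ^^ N) ((d13 ^^ N) (\<lambda>m n p. A (f n) (comm B C w (m + i) p))) = 0"
    by (simp only: d23_pow_0)
qed

lemma d_pow_right:
  assumes AC: "loc N A C" and "\<And>k. v k \<in> S"
  shows "(d23 ^^ N) ((d13 ^^ N) (\<lambda>m n p. comm A C (v n) (m + i) p)) = 0"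
    and "(d13 ^^ N) ((d23 ^^ N) (\<lambda>m n p. comm A C (v m) (n + i) p)) = 0"
proof -
  have *: "(dl ^^ N) (\<lambda>m p. comm A C (v k) (m + i) p) m p = 0" for m p k
    using dl_pow_shift[where f = "comm A C (v k)" and j = 0 and N = N and i = i and m = m and n = p] AC assms(2)
    by (simp add: loc_def)
  have "(d13 ^^ N) (\<lambda>m n p. comm A C (v n) (m + i) p) = 0"
    by (intro ext) (simp add: d13_pow_dl *)
  then show "(d23 ^^ N) ((d13 ^^ N) (\<lambda>m n p. comm A C (v n) (m + i) p)) = 0"
    by (simp only: d23_pow_0)
  have "(d23 ^^ N) (\<lambda>m n p. comm A C (v m) (n + i) p) = 0"
    by (intro ext) (simp add: d23_pow_dl *)
  then show "(d13 ^^ N) ((d23 ^^ N) (\<lambda>m n p. comm A C (v m) (n + i) p)) = 0"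
    by (simp only: d13_pow_0)
qed

text \<open>Commuting \<open>C\<close> past a product of \<open>A\<close> and \<open>B\<close> leaves \<open>[B, C]\<close> or \<open>[A, C]\<close> next to a third field.  The former
  is killed by \<open>(y - z)^N\<close>, the latter by \<open>(x - z)^N\<close>, and both powers together kill everything, as
  \<open>dong_recursion\<close> requires.\<close>

theorem dong:
  assumes A: "vfield A" and B: "vfield B" and C: "vfield C"
    and "mlocal A B" "mlocal A C" "mlocal B C"
  shows "mlocal (prd A l B) C"
proof -
  from assms obtain N1 N2 N3 where N123: "loc N1 A B" "loc N2 A C" "loc N3 B C" unfolding mlocal_def by blast
  define N where "N = max N1 (max N2 N3)"
  have AB: "loc N A B" and AC: "loc N A C" and BC: "loc N B C"
    using N123 loc_mono unfolding N_def by (meson max.cobounded1 max.cobounded2 order_trans)+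
  have "(dl ^^ (2 * N + nat (int N - l))) (comm (prd A l B) C w) n p = 0" if w: "w \<in> S" for w n p
  proof -
    define H where "H = (\<lambda>l m n p. Lf A B l m n (C p w) - C p (Lf A B l m n w))"
    have LS: "Lf A B l m n v \<in> S" for l m n v
      unfolding Lf_def by (intro S_diff S_scale bin_mem S vf_ev0A A B vf_mem')
    have "(d23 ^^ (2 * N + nat (int N - l))) (H l) = 0"
    proof (rule dong_recursion)
      show "d23 (H l) = d13 (H l) - H (l + 1)" for l
        by (intro ext) (simp add: H_def d23_def d13_def Lf_rec[OF A B] vf_diff[OF C] LS)
      show "H l = 0" if "l \<ge> int N" for l
        using that by (intro ext) (simp add: H_def Lf_top[OF A B AB] vf_zero[OF C])
    next
      fix l
      \<comment> \<open>\<open>X1\<close> and \<open>X2\<close> come from the term with \<open>A\<close> on the left of \<open>B\<close>, \<open>Y1\<close> and \<open>Y2\<close> from the other one.\<close>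
      define X1 where "X1 = (\<lambda>i m n p. A (l + m - int i) (comm B C w (n + int i) p))"
      define X2 where "X2 = (\<lambda>i m n p. comm A C (B (n + int i) w) (m + (l - int i)) p)"
      define Y1 where "Y1 = (\<lambda>i m n p. B (l + n - int i) (comm A C w (m + int i) p))"
      define Y2 where "Y2 = (\<lambda>i m n p. comm B C (A (m + int i) w) (n + (l - int i)) p)"
      define D :: "(int \<Rightarrow> int \<Rightarrow> int \<Rightarrow> 'p) \<Rightarrow> _" where "D = (\<lambda>f. (d13 ^^ N) ((d23 ^^ N) f))"
      have Dadd: "D (f - g) = D f - D g" for f g unfolding D_def by (simp only: d13_pow_diff d23_pow_diff)
      have e1: "ev0 (\<lambda>i. X1 i m n p)" for m n p
        unfolding X1_def comm_def
        unfolding vf_diff[OF A vf_mem'[OF B] vf_mem'[OF C]]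
        by (intro ev0_diff vf_ev0A[OF A B] vf_ev0[OF B, where f = "\<lambda>i x. A (l + m - int i) (C p x)"])
          (simp add: vf_zero[OF A] vf_zero[OF C])
      have e3: "ev0 (\<lambda>i. Y1 i m n p)" for m n p
        unfolding Y1_def comm_def
        unfolding vf_diff[OF B vf_mem'[OF A] vf_mem'[OF C]]
        by (intro ev0_diff vf_ev0A[OF B A] vf_ev0[OF A, where f = "\<lambda>i x. B (l + n - int i) (C p x)"])
          (simp add: vf_zero[OF B] vf_zero[OF C])
      have e2: "ev0 (\<lambda>i. X2 i m n p)" for m n p
        unfolding X2_def comm_def
        by (rule vf_ev0[OF B, where f = "\<lambda>i v. A (m + (l - int i)) (C p v) - C p (A (m + (l - int i)) v)"]) (simp add: vf_zero[OF A] vf_zero[OF C])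
      have e4: "ev0 (\<lambda>i. Y2 i m n p)" for m n p
        unfolding Y2_def comm_def
        by (rule vf_ev0[OF A, where f = "\<lambda>i v. B (n + (l - int i)) (C p v) - C p (B (n + (l - int i)) v)"]) (simp add: vf_zero[OF B] vf_zero[OF C])
      have D1: "D (X1 i) = 0" for i
        unfolding D_def X1_def by (rule d_pow_left) (use A B C BC w in auto)
      have D3: "D (Y1 i) = 0" for i
        unfolding D_def Y1_def by (subst d_pow_commute, rule d_pow_left) (use A B C AC w in auto)
      have D2: "D (X2 i) = 0" for i
        unfolding D_def X2_def by (subst d_pow_commute, rule d_pow_right) (use AC vf_mem' B in auto)
      have D4: "D (Y2 i) = 0" for i
        unfolding D_def Y2_def by (rule d_pow_right) (use BC vf_mem' A in auto)
      have b: "D (\<lambda>m n p. bin e l (\<lambda>i. X i m n p)) = 0"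
        if "\<And>m n p. ev0 (\<lambda>i. X i m n p)" "\<And>i. D (X i) = 0" for X e
        using d_pow_bin_zero[of X N] that unfolding D_def by blast
      define Z1 where "Z1 = (\<lambda>i m n p. X1 i m n p + X2 i m n p)"
      have Dadd': "D (\<lambda>m n p. f m n p + g m n p) = 0" if "D f = 0" "D g = 0" for f g
      proof -
        have "D (\<lambda>m n p. - g m n p) = D 0 - D g" by (subst Dadd[symmetric]) (simp add: fun_diff_def)
        then have "D (\<lambda>m n p. - g m n p) = 0" using that Dadd[of 0 0] by simp
        moreover have "(\<lambda>m n p. f m n p + g m n p) = f - (\<lambda>m n p. - g m n p)" by (simp add: fun_diff_def)
        ultimately show ?thesis using Dadd that by simp
      qed
      have Dsc: "D (\<lambda>m n p. sc c (f m n p)) = (\<lambda>m n p. sc c (D f m n p))" for c f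
      proof -
        have "(d23 ^^ k) (\<lambda>m n p. sc c (f m n p)) = (\<lambda>m n p. sc c ((d23 ^^ k) f m n p))" for k f
          by (induction k) (auto simp: d23_def fun_eq_iff scale_right_diff_distrib)
        moreover have "(d13 ^^ k) (\<lambda>m n p. sc c (f m n p)) = (\<lambda>m n p. sc c ((d13 ^^ k) f m n p))" for k f
          by (induction k) (auto simp: d13_def fun_eq_iff scale_right_diff_distrib)
        ultimately show ?thesis unfolding D_def by simp
      qed
      have Z1: "D (\<lambda>m n p. bin (-1) l (\<lambda>i. Z1 i m n p)) = 0"
        by (rule b) (auto simp: Z1_def intro!: ev0_add e1 e2 Dadd' D1 D2)
      have Z: "D (\<lambda>m n p. bin (-1) l (\<lambda>i. Y1 i m n p + Y2 i m n p)) = 0"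
        by (rule b) (auto intro!: ev0_add e3 e4 Dadd' D3 D4)
      have Z2: "D (\<lambda>m n p. sc ((-1) powi l) (bin (-1) l (\<lambda>i. Y1 i m n p + Y2 i m n p))) = 0"
        unfolding Dsc Z by (simp add: fun_eq_iff)
      have "H l = (\<lambda>m n p. bin (-1) l (\<lambda>i. Z1 i m n p)) - (\<lambda>m n p. sc ((-1) powi l) (bin (-1) l (\<lambda>i. Y1 i m n p + Y2 i m n p)))"
      proof (intro ext)
        fix m n p
        have z1: "Z1 i m n p = A (l + m - int i) (B (n + int i) (C p w)) - C p (A (l + m - int i) (B (n + int i) w))" for i
          by (simp add: Z1_def X1_def X2_def comm_def vf_diff[OF A] vf_mem'[OF B] vf_mem'[OF C] algebra_simps)
        have z2: "Y1 i m n p + Y2 i m n p = B (l + n - int i) (A (m + int i) (C p w)) - C p (B (l + n - int i) (A (m + int i) w))" for i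
          by (simp add: Y1_def Y2_def comm_def vf_diff[OF B] vf_mem'[OF A] vf_mem'[OF C] algebra_simps)
        have c1: "C p (Lf A B l m n w) = bin (-1) l (\<lambda>i. C p (A (l + m - int i) (B (n + int i) w))) -
           sc ((-1) powi l) (bin (-1) l (\<lambda>i. C p (B (l + n - int i) (A (m + int i) w))))"
          unfolding Lf_def
          by (simp add: vf_diff[OF C] vf_scale[OF C] vf_bin[OF C] vf_ev0A[OF A B] vf_ev0A[OF B A]
              vf_mem'[OF A] vf_mem'[OF B] S_scale bin_mem[OF S])
        have ev: "ev0 (\<lambda>i. C p (A (l + m - int i) (B (n + int i) w)))" "ev0 (\<lambda>i. C p (B (l + n - int i) (A (m + int i) w)))"
          using vf_ev0[OF B, of "\<lambda>i x. C p (A (l + m - int i) x)"] vf_ev0[OF A, of "\<lambda>i x. C p (B (l + n - int i) x)"]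
          by (simp_all add: A B vf_zero[OF A] vf_zero[OF B] vf_zero[OF C])
        show "H l m n p = ((\<lambda>m n p. bin (-1) l (\<lambda>i. Z1 i m n p)) - (\<lambda>m n p. sc ((-1) powi l) (bin (-1) l (\<lambda>i. Y1 i m n p + Y2 i m n p)))) m n p"
          unfolding H_def c1 z1 z2 fun_diff_def
          by (subst (1 2) bin_diff) (auto intro!: vf_ev0A A B ev simp: Lf_def scale_right_diff_distrib)
      qed
      then show "(d13 ^^ N) ((d23 ^^ N) (H l)) = 0"
        using Z1 Z2 Dadd unfolding D_def by simp
    qed
    moreover have "comm (prd A l B) C w = H l 0" by (intro ext) (simp add: comm_def H_def prd_Lf)
    ultimately show ?thesis by (simp only: d23_pow_dl[symmetric] zero_fun_apply)
  qed
  then show ?thesis unfolding mlocal_def loc_def by blast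
qed

end

section \<open>Commutators of left multiplications\<close>

context complex_space
begin

definition fsc :: "complex \<Rightarrow> (int \<Rightarrow> 'p \<Rightarrow> 'p) \<Rightarrow> int \<Rightarrow> 'p \<Rightarrow> 'p" where
  "fsc c A = (\<lambda>n w. sc c (A n w))"

lemma cvs_fsc: "complex_space fsc"
  by unfold_locales (simp_all add: fsc_def fun_eq_iff scale_right_distrib scale_left_distrib)

lemma bin_apply:
  assumes "ev0 g" shows "complex_space.bin fsc e l g n w = bin e l (\<lambda>i. g i n w)"
proof -
  interpret F: complex_space fsc by (rule cvs_fsc)
  obtain K where K: "\<And>i. i \<ge> K \<Longrightarrow> g i = 0" using assms unfolding ev0_def by blast
  have s: "(\<Sum>i<(k::nat). h i) n w = (\<Sum>i<k. h i n w)" for h :: "nat \<Rightarrow> int \<Rightarrow> 'p \<Rightarrow> 'p" and k by (induction k) auto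
  show ?thesis using K by (subst F.bin_eq[of K], simp, subst bin_eq[of K]) (auto simp: s fsc_def)
qed

lemma bin_single:
  assumes "\<And>i. i \<noteq> j \<Longrightarrow> g i = 0" shows "bin e l g = sc (e ^ j * (of_int l gchoose j)) (g j)"
proof -
  have "bin e l g = (\<Sum>i<Suc j. sc (e ^ i * (of_int l gchoose i)) (g i))"
    by (rule bin_eq) (use assms in auto)
  also have "\<dots> = sc (e ^ j * (of_int l gchoose j)) (g j)" using assms by simp
  finally show ?thesis .
qed

lemma bin_absorb:
  assumes "ev0 h"
  shows "bin e l (\<lambda>i. sc (of_int (int i)) (h i)) = sc (e * of_int l) (bin e (l - 1) (\<lambda>i. h (Suc i)))"
proof -
  obtain K where K: "\<And>i. i \<ge> K \<Longrightarrow> h i = 0" using assms unfolding ev0_def by blast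
  have 1: "bin e (l - 1) (\<lambda>i. h (Suc i)) = (\<Sum>i<K. sc (e ^ i * (of_int (l - 1) gchoose i)) (h (Suc i)))"
    by (rule bin_eq) (use K in auto)
  have 2: "bin e l (\<lambda>i. sc (of_int (int i)) (h i)) =
     (\<Sum>i<Suc K. sc (e ^ i * (of_int l gchoose i)) (sc (of_int (int i)) (h i)))"
    by (rule bin_eq) (use K in auto)
  have 3: "e ^ Suc i * (of_int l gchoose Suc i) * of_nat (Suc i) = e * of_int l * (e ^ i * (of_int (l - 1) gchoose i))" for i
    using gbinomial_absorption[of i "of_int l :: complex"] by (simp add: algebra_simps)
  show ?thesis unfolding 1 2 sum.lessThan_Suc_shift
    by (simp add: scale_sum_right 3 del: of_int_diff power_Suc of_nat_Suc)
qed

lemma bin_zero_fun: "bin e l (\<lambda>i. 0) = 0" by (rule bin_zero) simp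

end

context field_space
begin

text \<open>The weights of multiplication by \<open>(x - z)^m (y - z)^n\<close>.  As \<open>(x - z) - (y - z) = x - y\<close>, the difference in
  \<open>m\<close> and \<open>n\<close> of these arrays is the array of the difference (\<open>dl_FT\<close>).\<close>

definition FT :: "(int \<Rightarrow> int \<Rightarrow> int \<Rightarrow> 'p) \<Rightarrow> int \<Rightarrow> int \<Rightarrow> int \<Rightarrow> 'p" where
  "FT T k m n = bin (-1) m (\<lambda>i. bin (-1) n (\<lambda>j. T (m - int i) (n - int j) (k + int i + int j)))"

lemma FT_ev:
  assumes T: "\<And>p q r. r \<ge> R \<Longrightarrow> T p q r = 0"
  shows "ev0 (\<lambda>j. T p (f j) (k + int j))" "ev0 (\<lambda>i. bin (-1) n (\<lambda>j. T (f' i) (f j) (k + int i + int j)))"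
proof -
  show "ev0 (\<lambda>j. T p (f j) (k + int j))" by (rule ev0I[of "nat (R - k)"]) (simp add: T)
  show "ev0 (\<lambda>i. bin (-1) n (\<lambda>j. T (f' i) (f j) (k + int i + int j)))"
    by (rule ev0I[of "nat (R - k)"]) (simp add: T bin_zero)
qed

lemma dl_FT:
  assumes T: "\<And>p q r. r \<ge> R \<Longrightarrow> T p q r = 0"
  shows "dl (FT T k) = FT (\<lambda>p q r. dl (\<lambda>p q. T p q r) p q) k"
proof (intro ext)
  fix m n
  have a: "k + int (Suc i) + int j = k + int i + int (Suc j)" "m + 1 - int (Suc i) = m - int i"
    "n + 1 - int (Suc i) = n - int i" for i j by auto
  have 1: "FT T k (m + 1) n = bin (-1) m (\<lambda>i. bin (-1) n (\<lambda>j. T (m + 1 - int i) (n - int j) (k + int i + int j)))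
     - bin (-1) m (\<lambda>i. bin (-1) n (\<lambda>j. T (m - int i) (n - int j) (k + int i + int (Suc j))))"
    unfolding FT_def by (subst bin_Suc[OF FT_ev(2)[of R]]) (simp_all only: T a, simp)
  have b: "bin (-1) (n + 1) (\<lambda>j. T (m - int i) (n + 1 - int j) (k + int i + int j)) =
     bin (-1) n (\<lambda>j. T (m - int i) (n + 1 - int j) (k + int i + int j)) -
     bin (-1) n (\<lambda>j. T (m - int i) (n - int j) (k + int i + int (Suc j)))" for i
    by (subst bin_Suc[OF FT_ev(1)[of R]]) (simp_all only: T a, simp)
  have ev: "ev0 (\<lambda>i. bin (-1) n (\<lambda>j. T (m - int i) (n - int j) (k + int i + int (Suc j))))"
    by (rule ev0I[of "nat (R - k)"]) (simp add: T bin_zero)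
  have ev': "ev0 (\<lambda>j. T p (f j) (k + int i + int j))" for p f i by (rule FT_ev(1)) (rule T)
  have ev'': "ev0 (\<lambda>i. bin (-1) n (\<lambda>j. T (f' i) (f j) (k + int i + int j)))" for f f' by (rule FT_ev(2)) (rule T)
  have 2: "FT T k m (n + 1) = bin (-1) m (\<lambda>i. bin (-1) n (\<lambda>j. T (m - int i) (n + 1 - int j) (k + int i + int j)))
     - bin (-1) m (\<lambda>i. bin (-1) n (\<lambda>j. T (m - int i) (n - int j) (k + int i + int (Suc j))))"
    unfolding FT_def b by (rule bin_diff) (rule ev'' ev)+
  have c: "m + 1 - int i = m - int i + 1" for m i by simp
  show "dl (FT T k) m n = FT (\<lambda>p q r. dl (\<lambda>p q. T p q r) p q) k m n"
    unfolding dl_def 1 2 unfolding FT_def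
    by (simp add: bin_diff[OF ev' ev'] bin_diff[OF ev'' ev''] c del: add_diff_eq diff_add_eq)
qed

lemma dl_pow_FT:
  assumes "\<And>p q r. r \<ge> R \<Longrightarrow> T p q r = 0"
  shows "(dl ^^ N) (FT T k) = FT (\<lambda>p q r. (dl ^^ N) (\<lambda>p q. T p q r) p q) k"
  using assms
proof (induction N arbitrary: T)
  case (Suc N)
  have "(dl ^^ Suc N) (FT T k) = (dl ^^ N) (FT (\<lambda>p q r. dl (\<lambda>p q. T p q r) p q) k)"
    by (simp only: funpow_Suc_right comp_apply dl_FT[of R T, OF Suc.prems])
  also have "\<dots> = FT (\<lambda>p q r. (dl ^^ N) (\<lambda>p q. dl (\<lambda>p q. T p q r) p q) p q) k"
    by (rule Suc.IH) (simp add: dl_def Suc.prems)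
  finally show ?case by (simp only: funpow_Suc_right comp_apply)
qed simp

text \<open>The weights of multiplication by \<open>(-z + x)^m (-z + y)^n\<close>, with \<open>C(z)\<close> acting last; again the difference
  passes to \<open>U\<close> (\<open>dl_GT\<close>).\<close>

definition GT :: "(int \<Rightarrow> 'p \<Rightarrow> 'p) \<Rightarrow> (int \<Rightarrow> int \<Rightarrow> 'p) \<Rightarrow> int \<Rightarrow> int \<Rightarrow> int \<Rightarrow> 'p" where
  "GT C U k m n = sc ((-1) powi m * (-1) powi n)
     (bin (-1) m (\<lambda>i. bin (-1) n (\<lambda>j. C (m + n + k - int i - int j) (U (int i) (int j)))))"

lemma dl_GT:
  assumes C: "vfield C" and US: "\<And>i j. U i j \<in> S"
    and U: "\<And>i j. i \<ge> K \<Longrightarrow> U i j = 0" "\<And>i j. j \<ge> K \<Longrightarrow> U i j = 0"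
  shows "dl (GT C U k) = GT C (dl U) k"
proof (intro ext)
  fix m n
  let ?s = "(-1) powi m * (-1) powi n :: complex"
  have C0: "C n 0 = 0" for n by (rule vf_zero[OF C])
  have ev1: "ev0 (\<lambda>j. C (f j) (U i (int j)))" "ev0 (\<lambda>j. C (f j) (U i (int j + 1)))" for f i
    by (rule ev0I[of "nat K"], simp add: U C0)+
  have ev2: "ev0 (\<lambda>i. bin (-1) n (\<lambda>j. C (f i j) (U (int i) (g j))))" "ev0 (\<lambda>i. bin (-1) n (\<lambda>j. C (f i j) (U (int i + 1) (g j))))" for f n g
    by (rule ev0I[of "nat K"], simp add: U C0 bin_zero)+
  have e: "(m + 1) + n + k - int (Suc i) - int j = m + n + k - int i - int j"
     "m + (n + 1) + k - int i - int (Suc j) = m + n + k - int i - int j"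
     "int (Suc i) = int i + 1"
     "(m + 1) + n + k - int i - int j = m + (n + 1) + k - int i - int j" for i j by auto
  have 1: "GT C U k (m + 1) n = - sc ?s (bin (-1) m (\<lambda>i. bin (-1) n (\<lambda>j. C (m + (n + 1) + k - int i - int j) (U (int i) (int j))))
     - bin (-1) m (\<lambda>i. bin (-1) n (\<lambda>j. C (m + n + k - int i - int j) (U (int i + 1) (int j)))))"
    unfolding GT_def
    by (subst bin_Suc[OF ev2(1)], simp only: e(1), simp only: e(4), simp only: e(3)) (simp add: power_int_add_1 scale_right_diff_distrib)
  have 2: "GT C U k m (n + 1) = - sc ?s (bin (-1) m (\<lambda>i. bin (-1) n (\<lambda>j. C (m + (n + 1) + k - int i - int j) (U (int i) (int j))))
     - bin (-1) m (\<lambda>i. bin (-1) n (\<lambda>j. C (m + n + k - int i - int j) (U (int i) (int j + 1)))))"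
    unfolding GT_def
    by (subst bin_Suc[OF ev1(1)], simp only: e(2), simp only: e(3))
      (simp add: power_int_add_1 bin_diff ev2 scale_right_diff_distrib)
  have 3: "C l (dl U i j) = C l (U (i + 1) j) - C l (U i (j + 1))" for l i j
    by (simp add: dl_def vf_diff[OF C] US)
  show "dl (GT C U k) m n = GT C (dl U) k m n"
    unfolding dl_def[of "GT C U k"] 1 2 unfolding GT_def 3
    by (simp add: bin_diff ev1 ev2 scale_right_diff_distrib)
qed

lemma dl_pow_GT:
  assumes C: "vfield C" and "\<And>i j. U i j \<in> S"
    "\<And>i j. i \<ge> K \<Longrightarrow> U i j = 0" "\<And>i j. j \<ge> K \<Longrightarrow> U i j = 0"
  shows "(dl ^^ N) (GT C U k) = GT C ((dl ^^ N) U) k"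
  using assms(2-)
proof (induction N arbitrary: U)
  case (Suc N)
  have "(dl ^^ Suc N) (GT C U k) = (dl ^^ N) (GT C (dl U) k)"
    by (simp only: funpow_Suc_right comp_apply dl_GT[of C U K, OF C Suc.prems])
  also have "\<dots> = GT C ((dl ^^ N) (dl U)) k"
    by (rule Suc.IH) (auto simp: dl_def Suc.prems intro: S_diff)
  finally show ?case by (simp only: funpow_Suc_right comp_apply)
qed simp

lemma comm_mem: "vfield A \<Longrightarrow> vfield B \<Longrightarrow> comm A B w m n \<in> S"
  unfolding comm_def by (intro S_diff vf_mem')

lemma double_trunc:
  assumes A: "vfield A" and B: "vfield B" and w: "w \<in> S"
  shows "\<exists>K. \<forall>i j. 0 \<le> i \<longrightarrow> 0 \<le> j \<longrightarrow> (i \<ge> K \<or> j \<ge> K) \<longrightarrow> A i (B j w) = 0"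
proof -
  obtain J where J: "\<forall>n\<ge>J. B n w = 0" using vf_trunc[OF B w] by blast
  have "\<exists>K. \<forall>n\<ge>K. A n (B (int i) w) = 0" for i using vf_trunc[OF A vf_mem[OF B w]] by blast
  then obtain K where K: "\<forall>i<nat J. \<forall>n\<ge>K. A n (B (int i) w) = 0"
    using trunc_uniform[of "nat J" "\<lambda>n i. A n (B (int i) w) = 0"] by blast
  have "A i (B j w) = 0" if "0 \<le> i" "0 \<le> j" "i \<ge> max J K \<or> j \<ge> max J K" for i j
  proof (cases "j \<ge> J")
    case True then show ?thesis using J by (simp add: vf_zero[OF A])
  next
    case False
    then have "nat j < nat J" "i \<ge> K" using that by auto
    then show ?thesis using K that by (metis nat_0_le)
  qed
  then show ?thesis by blast
qed

lemma al_al: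
  assumes A: "vfield A" and B: "vfield B" and C: "vfield C" and w: "w \<in> S"
  shows "al A m (al B n C) k w - al B n (al A m C) k w = FT (\<lambda>p q r. comm A B (C r w) p q) k m n"
proof -
  obtain R where R: "\<forall>r\<ge>R. C r w = 0" using vf_trunc[OF C w] by blast
  define X where "X = (\<lambda>i j. A (m - int i) (B (n - int j) (C (k + int i + int j) w)))"
  define Y where "Y = (\<lambda>i j. B (n - int j) (A (m - int i) (C (k + int i + int j) w)))"
  have z: "X i j = 0 \<and> Y i j = 0" if "i \<ge> nat (R - k) \<or> j \<ge> nat (R - k)" for i j
  proof -
    have "k + int i + int j \<ge> R" using that by auto
    then show ?thesis using R by (simp add: X_def Y_def vf_zero[OF A] vf_zero[OF B])
  qed
  have 1: "al A m (al B n C) k w = bin (-1) m (\<lambda>i. bin (-1) n (X i))"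
    unfolding al_def X_def
    by (simp add: vf_bin[OF A] vf_ev0A[OF B C] vf_mem'[OF B])
  have "Y i j = B (n - int j) (A (m - int i) (C (k + int j + int i) w))" for i j
    by (simp add: Y_def algebra_simps)
  then have "al B n (al A m C) k w = bin (-1) n (\<lambda>j. bin (-1) m (\<lambda>i. Y i j))"
    by (simp only: al_def vf_bin[OF B vf_ev0A[OF A C] vf_mem'[OF A]])
  also have "\<dots> = bin (-1) m (\<lambda>i. bin (-1) n (Y i))"
    by (rule bin_swap[of "nat (R - k)"]) (use z in auto)
  finally have 2: "al B n (al A m C) k w = bin (-1) m (\<lambda>i. bin (-1) n (Y i))" .
  have ev: "ev0 (X i)" "ev0 (Y i)" for i by (rule ev0I[of "nat (R - k)"], use z in auto)+
  have ev': "ev0 (\<lambda>i. bin (-1) n (X i))" "ev0 (\<lambda>i. bin (-1) n (Y i))"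
    by (rule ev0I[of "nat (R - k)"], use z in \<open>auto intro: bin_zero\<close>)+
  show ?thesis unfolding 1 2 FT_def comm_def
    by (simp add: bin_diff[OF ev', symmetric] bin_diff[OF ev, symmetric]) (simp add: X_def Y_def)
qed

lemma be_be:
  assumes A: "vfield A" and B: "vfield B" and C: "vfield C" and w: "w \<in> S"
  shows "be A m (be B n C) k w - be B n (be A m C) k w = - GT C (\<lambda>i j. if 0 \<le> i \<and> 0 \<le> j then comm A B w i j else 0) k m n"
proof -
  obtain K1 where K1: "\<And>i j. 0 \<le> i \<Longrightarrow> 0 \<le> j \<Longrightarrow> (i \<ge> K1 \<or> j \<ge> K1) \<Longrightarrow> A i (B j w) = 0"
    using double_trunc[OF A B w] by blast
  obtain K2 where K2: "\<And>i j. 0 \<le> i \<Longrightarrow> 0 \<le> j \<Longrightarrow> (i \<ge> K2 \<or> j \<ge> K2) \<Longrightarrow> B i (A j w) = 0"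
    using double_trunc[OF B A w] by blast
  define K where "K = nat (max K1 K2)"
  let ?s = "(-1) powi m * (-1) powi n :: complex"
  have C0: "C n 0 = 0" for n by (rule vf_zero[OF C])
  define X where "X = (\<lambda>i j. C (m + n + k - int i - int j) (B (int j) (A (int i) w)))"
  define Y where "Y = (\<lambda>i j. C (m + n + k - int i - int j) (A (int i) (B (int j) w)))"
  have z: "X i j = 0" "Y i j = 0" if "i \<ge> K \<or> j \<ge> K" for i j
  proof -
    have "K1 \<le> int i \<or> K1 \<le> int j" "K2 \<le> int j \<or> K2 \<le> int i" using that unfolding K_def by linarith+
    then show "X i j = 0" "Y i j = 0" using K1[of "int i" "int j"] K2[of "int j" "int i"]
      by (simp_all add: X_def Y_def C0)
  qed
  have ev: "ev0 (X i)" "ev0 (Y i)" "ev0 (\<lambda>i. X i j)" "ev0 (\<lambda>i. Y i j)" for i j by (rule ev0I[of K], use z in auto)+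
  have ev': "ev0 (\<lambda>i. bin (-1) n (X i))" "ev0 (\<lambda>i. bin (-1) n (Y i))" "ev0 (\<lambda>j. bin (-1) m (\<lambda>i. Y i j))"
    by (rule ev0I[of K], use z in \<open>auto intro: bin_zero\<close>)+
  have 1: "be A m (be B n C) k w = sc ?s (bin (-1) m (\<lambda>i. bin (-1) n (X i)))"
  proof -
    have "n + (m + k - int i) - int j = m + n + k - int i - int j" for i j by simp
    then have "be A m (be B n C) k w = sc ((-1) powi m) (bin (-1) m (\<lambda>i. sc ((-1) powi n) (bin (-1) n (X i))))"
      by (simp only: be_def X_def)
    then show ?thesis by (simp add: bin_scale[OF ev'(1)])
  qed
  have 2: "be B n (be A m C) k w = sc ?s (bin (-1) m (\<lambda>i. bin (-1) n (Y i)))"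
  proof -
    have "m + (n + k - int j) - int i = m + n + k - int i - int j" for i j by simp
    then have "be B n (be A m C) k w = sc ((-1) powi n) (bin (-1) n (\<lambda>j. sc ((-1) powi m) (bin (-1) m (\<lambda>i. Y i j))))"
      by (simp only: be_def Y_def)
    also have "bin (-1) n (\<lambda>j. sc ((-1) powi m) (bin (-1) m (\<lambda>i. Y i j))) = sc ((-1) powi m) (bin (-1) m (\<lambda>i. bin (-1) n (Y i)))"
      unfolding bin_scale[OF ev'(3)] by (subst bin_swap[of K]) (use z in auto)
    finally show ?thesis by (simp add: mult.commute)
  qed
  have 3: "C (m + n + k - int i - int j) (if 0 \<le> int i \<and> 0 \<le> int j then comm A B w (int i) (int j) else 0) = Y i j - X i j" for i j
    by (simp add: comm_def X_def Y_def vf_diff[OF C] vf_mem'[OF A] vf_mem'[OF B])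
  show ?thesis unfolding 1 2 GT_def 3
    by (simp add: bin_diff ev ev' scale_right_diff_distrib)
qed

text \<open>The two halves commute because \<open>A\<close> is multiplied from the left and \<open>B\<close> from the right.\<close>

lemma al_be:
  assumes A: "vfield A" and B: "vfield B" and C: "vfield C" and w: "w \<in> S"
  shows "al A m (be B n C) k w = be B n (al A m C) k w"
proof -
  obtain J where J: "\<forall>n\<ge>J. B n w = 0" using vf_trunc[OF B w] by blast
  have "\<exists>K. \<forall>n\<ge>K. C n (B (int i) w) = 0" for i using vf_trunc[OF C vf_mem[OF B w]] by blast
  then obtain R where R: "\<forall>i<nat J. \<forall>n\<ge>R. C n (B (int i) w) = 0"
    using trunc_uniform[of "nat J" "\<lambda>n i. C n (B (int i) w) = 0"] by blast
  define X where "X = (\<lambda>i j. A (m - int i) (C (n + k + int i - int j) (B (int j) w)))"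
  define K where "K = nat (max J (R + J - n - k))"
  have C0: "C n 0 = 0" and A0: "A n 0 = 0" for n by (rule vf_zero[OF C] vf_zero[OF A])+
  have z: "X i j = 0" if "i \<ge> K \<or> j \<ge> K" for i j
  proof (cases "int j \<ge> J")
    case True then show ?thesis using J by (simp add: X_def C0 A0)
  next
    case False
    then have "j < nat J" "n + k + int i - int j \<ge> R" using that unfolding K_def by linarith+
    then show ?thesis using R by (simp add: X_def A0)
  qed
  have ev': "ev0 (\<lambda>i. bin (-1) n (X i))"
    by (rule ev0I[of K], use z in \<open>auto intro: bin_zero\<close>)+
  have e: "n + (k + int i) - int j = n + k + int i - int j" "n + k - int j + int i = n + k + int i - int j" for i j by simp_all
  have "al A m (be B n C) k w = bin (-1) m (\<lambda>i. sc ((-1) powi n) (bin (-1) n (X i)))"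
    unfolding al_def be_def X_def
    by (simp only: vf_scale[OF A] vf_bin[OF A] vf_ev00[OF C B] vf_mem'[OF C] bin_mem[OF S] e)
  also have "\<dots> = sc ((-1) powi n) (bin (-1) n (\<lambda>j. bin (-1) m (\<lambda>i. X i j)))"
    unfolding bin_scale[OF ev'] by (subst bin_swap[of K]) (use z in auto)
  also have "\<dots> = be B n (al A m C) k w"
    by (simp only: al_def be_def X_def e)
  finally show ?thesis .
qed

lemma al_diff:
  assumes A: "vfield A" and X: "vfield X" and Y: "vfield Y"
  shows "al A m (\<lambda>n w. X n w - Y n w) k w = al A m X k w - al A m Y k w"
  unfolding al_def bin_diff[OF vf_ev0A[OF A X] vf_ev0A[OF A Y], symmetric]
  by (simp add: vf_diff[OF A] vf_mem'[OF X] vf_mem'[OF Y])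

lemma be_diff:
  assumes A: "vfield A" and X: "vfield X" and Y: "vfield Y"
  shows "be A m (\<lambda>n w. X n w - Y n w) k w = be A m X k w - be A m Y k w"
  unfolding be_def scale_right_diff_distrib[symmetric] bin_diff[OF vf_ev00[OF X A] vf_ev00[OF Y A], symmetric] ..

lemma prd_add_right:
  assumes A: "vfield A" and X: "vfield X" and Y: "vfield Y"
  shows "prd A m (\<lambda>n w. X n w + Y n w) = (\<lambda>k w. prd A m X k w + prd A m Y k w)"
proof (intro ext)
  fix k w
  have "al A m (\<lambda>n w. X n w + Y n w) k w = al A m X k w + al A m Y k w"
    unfolding al_def bin_add[OF vf_ev0A[OF A X] vf_ev0A[OF A Y], symmetric]
    by (simp add: vf_add[OF A] vf_mem'[OF X] vf_mem'[OF Y])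
  moreover have "be A m (\<lambda>n w. X n w + Y n w) k w = be A m X k w + be A m Y k w"
    unfolding be_def scale_right_distrib[symmetric] bin_add[OF vf_ev00[OF X A] vf_ev00[OF Y A], symmetric] ..
  ultimately show "prd A m (\<lambda>n w. X n w + Y n w) k w = prd A m X k w + prd A m Y k w" by (simp add: prd_def)
qed

lemma prd_scale_right:
  assumes A: "vfield A" and X: "vfield X"
  shows "prd A m (\<lambda>n w. sc c (X n w)) = (\<lambda>k w. sc c (prd A m X k w))"
proof (intro ext)
  fix k w
  have "al A m (\<lambda>n w. sc c (X n w)) k w = sc c (al A m X k w)"
    unfolding al_def bin_scale[OF vf_ev0A[OF A X], symmetric]
    by (simp add: vf_scale[OF A] vf_mem'[OF X])
  moreover have "be A m (\<lambda>n w. sc c (X n w)) k w = sc c (be A m X k w)"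
    unfolding be_def bin_scale[OF vf_ev00[OF X A]] by (simp add: mult.commute)
  ultimately show "prd A m (\<lambda>n w. sc c (X n w)) k w = sc c (prd A m X k w)" by (simp add: prd_def scale_right_diff_distrib)
qed

lemma prd_add_left:
  assumes A: "vfield A" and X: "vfield X" and Y: "vfield Y"
  shows "prd (\<lambda>n w. X n w + Y n w) m A = (\<lambda>k w. prd X m A k w + prd Y m A k w)"
proof (intro ext)
  fix k w
  have "al (\<lambda>n w. X n w + Y n w) m A k w = al X m A k w + al Y m A k w"
    unfolding al_def bin_add[OF vf_ev0A[OF X A] vf_ev0A[OF Y A], symmetric] ..
  moreover have "be (\<lambda>n w. X n w + Y n w) m A k w = be X m A k w + be Y m A k w"
    unfolding be_def scale_right_distrib[symmetric] bin_add[OF vf_ev00[OF A X] vf_ev00[OF A Y], symmetric]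
    by (simp add: vf_add[OF A] vf_mem'[OF X] vf_mem'[OF Y])
  ultimately show "prd (\<lambda>n w. X n w + Y n w) m A k w = prd X m A k w + prd Y m A k w" by (simp add: prd_def)
qed

lemma prd_scale_left:
  assumes A: "vfield A" and X: "vfield X"
  shows "prd (\<lambda>n w. sc c (X n w)) m A = (\<lambda>k w. sc c (prd X m A k w))"
proof (intro ext)
  fix k w
  have "al (\<lambda>n w. sc c (X n w)) m A k w = sc c (al X m A k w)"
    unfolding al_def bin_scale[OF vf_ev0A[OF X A], symmetric] ..
  moreover have "be (\<lambda>n w. sc c (X n w)) m A k w = sc c (be X m A k w)"
    unfolding be_def vf_scale[OF A vf_mem'[OF X]] bin_scale[OF vf_ev00[OF A X]] by (simp add: mult.commute)
  ultimately show "prd (\<lambda>n w. sc c (X n w)) m A k w = sc c (prd X m A k w)" by (simp add: prd_def scale_right_diff_distrib)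
qed

text \<open>The mixed terms cancel by \<open>al_be\<close>, and what remains of the commutator of two left multiplications involves
  \<open>A\<close> and \<open>B\<close> only through \<open>[A, B]\<close>, acting before \<open>C\<close> or after it.\<close>

lemma prd_commutator:
  assumes A: "vfield A" and B: "vfield B" and C: "vfield C" and w: "w \<in> S"
  shows "prd A m (prd B n C) k w - prd B n (prd A m C) k w =
    FT (\<lambda>p q r. comm A B (C r w) p q) k m n - GT C (\<lambda>i j. if 0 \<le> i \<and> 0 \<le> j then comm A B w i j else 0) k m n"
proof -
  have P: "prd A m (prd B n C) k w = al A m (al B n C) k w - al A m (be B n C) k w
    - (be A m (al B n C) k w - be A m (be B n C) k w)" if "vfield A" "vfield B" for A B m n
    unfolding prd_def
    by (simp add: al_diff[OF that(1) al_vfield[OF that(2) C] be_vfield[OF that(2) C]]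
         be_diff[OF that(1) al_vfield[OF that(2) C] be_vfield[OF that(2) C]])
  have "prd A m (prd B n C) k w - prd B n (prd A m C) k w =
     (al A m (al B n C) k w - al B n (al A m C) k w) + (be A m (be B n C) k w - be B n (be A m C) k w)"
    unfolding P[OF A B] P[OF B A] al_be[OF A B C w] al_be[OF B A C w] by simp
  then show ?thesis unfolding al_al[OF A B C w] be_be[OF A B C w] by simp
qed

text \<open>In either part of \<open>prd_commutator\<close> the differences in \<open>m\<close> and \<open>n\<close> pass to \<open>[A, B]\<close>, so left
  multiplications inherit locality, of the same order.\<close>

lemma prd_commutator_local:
  assumes A: "vfield A" and B: "vfield B" and C: "vfield C" and loc: "loc N A B" and w: "w \<in> S"
  shows "(dl ^^ N) (\<lambda>m n. prd A m (prd B n C) k w - prd B n (prd A m C) k w) m n = 0"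
proof -
  obtain R where R: "\<forall>r\<ge>R. C r w = 0" using vf_trunc[OF C w] by blast
  obtain K1 where K1: "\<And>i j. 0 \<le> i \<Longrightarrow> 0 \<le> j \<Longrightarrow> (i \<ge> K1 \<or> j \<ge> K1) \<Longrightarrow> A i (B j w) = 0"
    using double_trunc[OF A B w] by blast
  obtain K2 where K2: "\<And>i j. 0 \<le> i \<Longrightarrow> 0 \<le> j \<Longrightarrow> (i \<ge> K2 \<or> j \<ge> K2) \<Longrightarrow> B i (A j w) = 0"
    using double_trunc[OF B A w] by blast
  define U where "U = (\<lambda>i j. if 0 \<le> i \<and> 0 \<le> j then comm A B w i j else 0)"
  have cz: "(dl ^^ N) (comm A B v) p q = 0" if "v \<in> S" for v p q using loc that by (simp add: loc_def)
  have F: "(dl ^^ N) (FT (\<lambda>p q r. comm A B (C r w) p q) k) m n = 0" for m n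
  proof -
    have "(dl ^^ N) (FT (\<lambda>p q r. comm A B (C r w) p q) k) = FT (\<lambda>p q r. (dl ^^ N) (\<lambda>p q. comm A B (C r w) p q) p q) k"
      by (rule dl_pow_FT[of R]) (simp add: R comm_def vf_zero[OF A] vf_zero[OF B])
    also have "\<dots> = (\<lambda>m n. 0)"
      by (intro ext) (simp add: FT_def cz[OF vf_mem'[OF C]] bin_zero)
    finally show ?thesis by simp
  qed
  have G: "(dl ^^ N) (GT C U k) m n = 0" for m n
  proof -
    have "(dl ^^ N) (GT C U k) = GT C ((dl ^^ N) U) k"
      by (rule dl_pow_GT[OF C, of U "max K1 K2"])
        (auto simp: U_def comm_mem[OF A B] S_zero, auto simp: comm_def K1 K2)
    moreover have "(dl ^^ M) U (int i) (int j) = (dl ^^ M) (comm A B w) (int i) (int j)" for i j M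
    proof (induction M arbitrary: i j)
      case (Suc M)
      have "int i + 1 = int (Suc i)" "int j + 1 = int (Suc j)" by simp_all
      then show ?case
        by (simp only: funpow.simps comp_apply dl_def[of "(dl ^^ M) U"] dl_def[of "(dl ^^ M) (comm A B w)"] Suc.IH)
    qed (simp add: U_def)
    ultimately show ?thesis by (simp add: GT_def cz[OF w] bin_zero vf_zero[OF C])
  qed
  have "(dl ^^ N) (\<lambda>m n. - GT C U k m n) m n = - (dl ^^ N) (GT C U k) m n" for m n
    by (rule dl_pow_hom[of UNIV uminus]) auto
  then have G': "(dl ^^ N) (\<lambda>m n. - GT C U k m n) m n = 0" for m n by (simp add: G)
  have "(\<lambda>m n. prd A m (prd B n C) k w - prd B n (prd A m C) k w) =
     (\<lambda>m n. FT (\<lambda>p q r. comm A B (C r w) p q) k m n + - GT C U k m n)"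
    unfolding prd_commutator[OF A B C w] U_def by simp
  then show ?thesis by (simp only: dl_pow_add F G' add_0_left)
qed

text \<open>On \<open>v\<close>, the commutator of \<open>Z(x)\<close> and \<open>C(y)\<close> is \<open>Z(x) C(y) v\<close>.  It is killed by a power of \<open>x - y\<close> and
  truncated in \<open>y\<close>, hence zero.\<close>

lemma kill_propagate:
  assumes Z: "vfield Z" and C: "vfield C" and "mlocal Z C" and v: "v \<in> S" and kill: "\<And>n. Z n v = 0"
  shows "Z m (C n v) = 0"
proof -
  obtain N where N: "loc N Z C" using assms(3) mlocal_def by blast
  obtain K where K: "\<forall>n\<ge>K. C n v = 0" using vf_trunc[OF C v] by blast
  have c: "comm Z C v = (\<lambda>m n. Z m (C n v))" by (intro ext) (simp add: comm_def kill vf_zero[OF C])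
  have "(\<lambda>m n. Z m (C n v)) m n = 0"
    by (rule dl_pow_trunc_zero[of N _ K]) (use N v K in \<open>auto simp: loc_def c[symmetric]\<close>, simp add: comm_def vf_zero[OF Z] kill vf_zero[OF C])
  then show ?thesis .
qed

subsection \<open>The derivative and the identity field\<close>

definition der :: "(int \<Rightarrow> 'p \<Rightarrow> 'p) \<Rightarrow> int \<Rightarrow> 'p \<Rightarrow> 'p" where
  "der A n w = sc (of_int (- n)) (A (n - 1) w)"

lemma der_prd:
  assumes A: "vfield A" and C: "vfield C"
  shows "der (prd A n C) k w = sc (of_int (- n)) (prd A (n - 1) C k w) + prd A n (der C) k w"
proof -
  define h where "h = (\<lambda>i. A (n - int i) (C (k - 1 + int i) w))"
  define h' where "h' = (\<lambda>i. C (n + k - 1 - int i) (A (int i) w))"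
  have ev: "ev0 h" "ev0 h'" unfolding h_def h'_def by (rule vf_ev0A[OF A C] vf_ev00[OF C A])+
  have evi: "ev0 (\<lambda>i. sc (f i) (h i))" "ev0 (\<lambda>i. sc (f i) (h' i))" for f
    by (rule ev0_map[OF ev(1)], simp, rule ev0_map[OF ev(2)], simp)
  have a1: "al A n C (k - 1) w = bin (-1) n h" by (simp add: al_def h_def)
  have a2: "al A (n - 1) C k w = bin (-1) (n - 1) (\<lambda>i. h (Suc i))"
    by (simp add: al_def h_def algebra_simps)
  have a3: "al A n (der C) k w = - bin (-1) n (\<lambda>i. sc (of_int k) (h i)) - bin (-1) n (\<lambda>i. sc (of_int (int i)) (h i))"
  proof -
    have "A (n - int i) (der C (k + int i) w) = - sc (of_int k) (h i) - sc (of_int (int i)) (h i)" for i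
    proof -
      have "k + int i - 1 = k - 1 + int i" by simp
      then have "A (n - int i) (der C (k + int i) w) = sc (of_int (- (k + int i))) (h i)"
        by (simp only: der_def h_def vf_scale[OF A vf_mem'[OF C]])
      then show ?thesis by (simp add: scale_left_diff_distrib)
    qed
    then have "al A n (der C) k w = bin (-1) n (\<lambda>i. sc (-1) (sc (of_int k) (h i)) - sc (of_int (int i)) (h i))"
      by (simp add: al_def)
    also have "\<dots> = bin (-1) n (\<lambda>i. sc (-1) (sc (of_int k) (h i))) - bin (-1) n (\<lambda>i. sc (of_int (int i)) (h i))"
      by (rule bin_diff) (simp_all only: scale_scale evi)
    also have "bin (-1) n (\<lambda>i. sc (-1) (sc (of_int k) (h i))) = sc (-1) (bin (-1) n (\<lambda>i. sc (of_int k) (h i)))"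
      by (rule bin_scale) (rule evi)
    finally show ?thesis by simp
  qed
  have b1: "be A n C (k - 1) w = sc ((-1) powi n) (bin (-1) n h')" by (simp add: be_def h'_def algebra_simps)
  have b2: "be A (n - 1) C k w = - sc ((-1) powi n) (bin (-1) (n - 1) h')"
    by (simp add: be_def h'_def algebra_simps power_int_diff)
  have b3: "be A n (der C) k w = sc ((-1) powi n) (bin (-1) n (\<lambda>i. sc (of_int (int i)) (h' i)) - bin (-1) n (\<lambda>i. sc (of_int (n + k)) (h' i)))"
  proof -
    have "der C (n + k - int i) (A (int i) w) = sc (of_int (int i)) (h' i) - sc (of_int (n + k)) (h' i)" for i
      by (simp add: der_def h'_def scale_left_diff_distrib[symmetric] algebra_simps)
    then show ?thesis by (simp add: be_def bin_diff evi)
  qed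
  have p: "bin (-1) n h' = bin (-1) (n - 1) h' - bin (-1) (n - 1) (\<lambda>i. h' (Suc i))"
    using bin_Suc[OF ev(2), of "-1" "n - 1"] by simp
  show ?thesis
    unfolding der_def[of "prd A n C"] unfolding prd_def a1 a2 a3 b1 b2 b3 bin_absorb[OF ev(1)] bin_absorb[OF ev(2)]
      bin_scale[OF ev(1)] bin_scale[OF ev(2)] p
    by (simp add: scale_right_diff_distrib scale_right_distrib scale_left_distrib scale_left_diff_distrib algebra_simps)
qed

lemma prd_der_left:
  assumes A: "vfield A" and C: "vfield C"
  shows "prd (der A) n C = (\<lambda>k w. sc (of_int (- n)) (prd A (n - 1) C k w))"
proof (intro ext)
  fix k w
  define h where "h = (\<lambda>i. A (n - int i) (C (k - 1 + int i) w))"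
  define h' where "h' = (\<lambda>i. C (n + k - int i) (A (int i - 1) w))"
  have ev: "ev0 h" unfolding h_def by (rule vf_ev0A[OF A C])
  have S: "h' (Suc i) = C (n - 1 + k - int i) (A (int i) w)" for i by (simp add: h'_def algebra_simps)
  have "ev0 (\<lambda>i. h' (Suc i))" unfolding S by (rule vf_ev00[OF C A])
  then have ev': "ev0 h'" by (rule ev0_SucD)
  have a: "al (der A) n C k w = sc (of_int (- n)) (al A (n - 1) C k w)"
  proof -
    have t: "der A (n - int i) (C (k + int i) w) = sc (-1) (sc (of_int (n - int i)) (h (Suc i)))" for i
      by (simp add: der_def h_def algebra_simps)
    have "al (der A) n C k w = sc (-1) (bin (-1) n (\<lambda>i. sc (of_int (n - int i)) (h (Suc i))))"
      unfolding al_def t by (rule bin_scale) (rule ev0_map[OF ev0_Suc[OF ev]], simp)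
    also have "\<dots> = bin (-1) n (\<lambda>i. sc (of_int (int i)) (h i))"
      using bin_weight[OF ev, of "-1" "-1" n] by simp
    also have "\<dots> = sc (of_int (- n)) (bin (-1) (n - 1) (\<lambda>i. h (Suc i)))"
      using bin_absorb[OF ev, of "-1" n] by simp
    also have "(\<lambda>i. h (Suc i)) = (\<lambda>i. A (n - 1 - int i) (C (k + int i) w))" by (simp add: h_def algebra_simps)
    finally show ?thesis by (simp add: al_def)
  qed
  have b: "be (der A) n C k w = sc (of_int (- n)) (be A (n - 1) C k w)"
  proof -
    have d: "der A (int i) w = sc (- of_int (int i)) (A (int i - 1) w)" for i by (simp add: der_def)
    have t: "C (n + k - int i) (der A (int i) w) = sc (-1) (sc (of_int (int i)) (h' i))" for i
      unfolding d vf_scale[OF C vf_mem'[OF A]] h'_def by simp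
    have "be (der A) n C k w = sc ((-1) powi n) (sc (-1) (bin (-1) n (\<lambda>i. sc (of_int (int i)) (h' i))))"
      unfolding be_def t by (subst bin_scale) (rule ev0_map[OF ev'], simp, rule refl)
    also have "bin (-1) n (\<lambda>i. sc (of_int (int i)) (h' i)) = sc (of_int (- n)) (bin (-1) (n - 1) (\<lambda>i. h' (Suc i)))"
      using bin_absorb[OF ev', of "-1" n] by simp
    also have "(-1) powi n = - ((-1) powi (n - 1) :: complex)" by (simp add: power_int_diff)
    finally show ?thesis by (simp add: be_def S mult.commute)
  qed
  show "prd (der A) n C k w = sc (of_int (- n)) (prd A (n - 1) C k w)"
    unfolding prd_def a b by (simp add: scale_right_diff_distrib)
qed

lemma der_idf: "der idf = (\<lambda>n w. 0)"
  by (intro ext) (simp add: der_def idf_def)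

lemma prd_zero_right: "vfield A \<Longrightarrow> prd A m (\<lambda>n w. 0) = (\<lambda>n w. 0)"
  by (intro ext) (simp add: prd_def al_def be_def bin_zero_fun vf_zero)

lemma prd_idf_nonneg: "vfield B \<Longrightarrow> n \<ge> 0 \<Longrightarrow> prd B n idf = (\<lambda>n w. 0)"
  using prd_top[OF _ vfield_idf loc_idf] by simp

lemma neg1_gchoose: "(-1) ^ i * (of_int (-1) gchoose i) = (1 :: complex)"
  using gbinomial_minus[of "1::complex" i] by (simp add: power_mult_distrib[symmetric] flip: binomial_gbinomial)

lemma prd_idf: assumes B: "vfield B" shows "prd B (-1) idf = B"
proof (intro ext)
  fix k w
  show "prd B (-1) idf k w = B k w"
  proof (cases "w \<in> S")
    case False
    then show ?thesis using prd_vfield[OF B vfield_idf] B by (simp add: vf_out)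
  next
    case w: True
    have 1: "al B (-1) idf k w = (if k < 0 then B k w else 0)"
      unfolding al_def
      by (subst bin_single[of "nat (-1 - k)"]) (auto simp: idf_def vf_zero[OF B] w neg1_gchoose[simplified])
    have 2: "be B (-1) idf k w = - (if k \<ge> 0 then B k w else 0)"
      unfolding be_def
      by (subst bin_single[of "nat k"]) (auto simp: idf_def vf_mem'[OF B] neg1_gchoose[simplified])
    show ?thesis unfolding prd_def 1 2 by simp
  qed
qed

lemma der_prd_idf: "vfield B \<Longrightarrow> der (prd B n idf) k w = sc (of_int (- n)) (prd B (n - 1) idf k w)"
  by (simp add: der_prd[OF _ vfield_idf] der_idf prd_zero_right)

end

section \<open>Associativity of the products of fields\<close>

context field_space
begin

text \<open>The fields local to a family are the stage on which left multiplications act.  For a local family it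
  contains the family and the identity field, and left multiplication by a member of the family maps it to
  itself by Dong's lemma.\<close>

definition local_to :: "(int \<Rightarrow> 'p \<Rightarrow> 'p) set \<Rightarrow> (int \<Rightarrow> 'p \<Rightarrow> 'p) set" where
  "local_to F = {C. vfield C \<and> (\<forall>A\<in>F. mlocal A C)}"

lemma fun_plus: "(\<lambda>n w. A n w + B n w) = A + (B :: int \<Rightarrow> 'p \<Rightarrow> 'p)"
  and fun_zero: "(\<lambda>n w. 0) = (0 :: int \<Rightarrow> 'p \<Rightarrow> 'p)"
  by (intro ext, simp)+

lemma field_space_local_to:
  assumes "\<And>A. A \<in> F \<Longrightarrow> vfield A"
  shows "field_space fsc (local_to F)"
proof -
  interpret F: complex_space fsc by (rule cvs_fsc)
  show ?thesis
  proof (unfold_locales, unfold F.subspace_def, intro conjI ballI allI)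
    show "0 \<in> local_to F" using vfield_zero mlocal_zero assms by (simp add: local_to_def fun_zero)
    fix x y assume "x \<in> local_to F" "y \<in> local_to F"
    then show "x + y \<in> local_to F"
      using vfield_add mlocal_add assms unfolding local_to_def fun_plus[symmetric] by blast
  next
    fix c x assume "x \<in> local_to F"
    then show "fsc c x \<in> local_to F"
      using vfield_scale mlocal_scale assms unfolding local_to_def fsc_def by blast
  qed
qed

text \<open>By Pascal's rule a difference of such a sum shifts the family \<open>F\<close> by one.  After \<open>N\<close> differences nothing is
  left, and after \<open>k\<close> of them the value at \<open>m = 0\<close> is \<open>F k\<close>.\<close>

lemma comm_expansion:
  assumes A: "vfield A" and B: "vfield B"
    and c: "\<And>w m n. w \<in> S \<Longrightarrow> comm A B w m n = bin 1 m (\<lambda>i. F i (m + n - int i) w)"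
    and F: "\<And>i. vfield (F i)" and top: "\<And>i n w. i \<ge> N \<Longrightarrow> F i n w = 0"
  shows "loc N A B" and "prd A (int k) B = F k"
proof -
  have *: "(dl ^^ k) (comm A B w) m n = bin 1 m (\<lambda>i. F (i + k) (m + n - int i) w)" if w: "w \<in> S" for w m n k
  proof (induction k arbitrary: m n)
    case 0 then show ?case by (simp add: c w)
  next
    case (Suc k)
    have ev: "ev0 (\<lambda>i. F (i + k) (g i) w)" for g by (rule ev0I[of N]) (simp add: top)
    have e: "m + 1 + n - int i = m + (n + 1) - int i" "m + (n + 1) - int (Suc i) = m + n - int i"
      "Suc i + k = i + Suc k" for i by auto
    have "(dl ^^ Suc k) (comm A B w) m n = bin 1 (m + 1) (\<lambda>i. F (i + k) (m + 1 + n - int i) w)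
       - bin 1 m (\<lambda>i. F (i + k) (m + (n + 1) - int i) w)"
      by (simp only: funpow.simps comp_apply dl_def[of "(dl ^^ k) (comm A B w)"] Suc.IH)
    then show ?case by (simp only: bin_Suc[OF ev] e scale_one) simp
  qed
  show "loc N A B" unfolding loc_def by (simp add: * top bin_zero)
  show "prd A (int k) B = F k"
  proof (intro ext)
    fix n w
    show "prd A (int k) B n w = F k n w"
    proof (cases "w \<in> S")
      case True
      have "ev0 (\<lambda>i. F (i + k) (n - int i) w)" by (rule ev0I[of N]) (simp add: top)
      then show ?thesis using True by (simp add: prd_Lf Lf_nat[OF A B] * bin_0)
    qed (use prd_vfield[OF A B] F in \<open>simp add: vf_out\<close>)
  qed
qed

end

locale local_fields = field_space sc S for sc :: "complex \<Rightarrow> 'p::ab_group_add \<Rightarrow> 'p" and S +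
  fixes F :: "(int \<Rightarrow> 'p \<Rightarrow> 'p) set"
  assumes Fv: "A \<in> F \<Longrightarrow> vfield A" and Floc: "A \<in> F \<Longrightarrow> B \<in> F \<Longrightarrow> mlocal A B"
begin

sublocale E: field_space fsc "local_to F"
  by (rule field_space_local_to) (rule Fv)

text \<open>Cut off outside \<open>local_to F\<close>, as fields vanish outside the space on which they act.\<close>

definition leftmul :: "(int \<Rightarrow> 'p \<Rightarrow> 'p) \<Rightarrow> int \<Rightarrow> (int \<Rightarrow> 'p \<Rightarrow> 'p) \<Rightarrow> int \<Rightarrow> 'p \<Rightarrow> 'p" where
  "leftmul A n C = (if C \<in> local_to F then prd A n C else 0)"

text \<open>Members of \<open>F\<close> and products of two of them have this property (\<open>good_F\<close>, \<open>prd_good\<close>), and left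
  multiplication by such a field is a field on \<open>local_to F\<close>.\<close>

definition good :: "(int \<Rightarrow> 'p \<Rightarrow> 'p) \<Rightarrow> bool" where
  "good A \<longleftrightarrow> A \<in> local_to F \<and> (\<forall>C\<in>local_to F. mlocal A C)"

lemma local_toD: "C \<in> local_to F \<Longrightarrow> vfield C" "C \<in> local_to F \<Longrightarrow> A \<in> F \<Longrightarrow> mlocal A C"
  unfolding local_to_def by blast+

lemma goodD: "good A \<Longrightarrow> vfield A" "good A \<Longrightarrow> A \<in> local_to F" "good A \<Longrightarrow> C \<in> local_to F \<Longrightarrow> mlocal A C"
  unfolding good_def using local_toD by blast+

lemma good_F: "A \<in> F \<Longrightarrow> good A"
  unfolding good_def local_to_def using Fv Floc by blast

lemma idf_local_to: "idf \<in> local_to F"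
  unfolding local_to_def using vfield_idf mlocal_idf Fv by blast

lemma prd_local_to: assumes "good A" "C \<in> local_to F" shows "prd A n C \<in> local_to F"
proof -
  have "mlocal D (prd A n C)" if "D \<in> F" for D
  proof (rule mlocal_sym)
    show "mlocal (prd A n C) D"
      by (rule dong) (use assms that goodD local_toD Fv mlocal_sym in blast)+
  qed (use assms that goodD local_toD Fv prd_vfield in blast)+
  then show ?thesis unfolding local_to_def using prd_vfield goodD local_toD assms by blast
qed

lemma prd_good: assumes "A \<in> F" "B \<in> F" shows "good (prd A n B)"
  unfolding good_def
proof (intro conjI ballI)
  show "prd A n B \<in> local_to F" using prd_local_to good_F goodD(2) assms by blast
  show "mlocal (prd A n B) C" if "C \<in> local_to F" for C
    by (rule dong) (use assms that goodD local_toD Fv Floc in blast)+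
qed

lemma leftmul_mem: "good A \<Longrightarrow> leftmul A n C \<in> local_to F"
  using prd_local_to E.S_zero by (simp add: leftmul_def)

lemma leftmul_vfield: assumes A: "good A" shows "E.vfield (leftmul A)"
proof (rule E.vfieldI)
  note v = goodD(1)[OF A]
  fix n C assume C: "C \<in> local_to F"
  show "leftmul A n C \<in> local_to F" using leftmul_mem A by blast
  show "leftmul A n (fsc c C) = fsc c (leftmul A n C)" for c
    using C E.S_scale[OF C] prd_scale_right[OF v local_toD(1)[OF C]] by (simp add: leftmul_def fsc_def)
next
  note v = goodD(1)[OF A]
  fix n B C assume C: "B \<in> local_to F" "C \<in> local_to F"
  show "leftmul A n (B + C) = leftmul A n B + leftmul A n C"
    using C E.S_add[OF C] prd_add_right[OF v local_toD(1)[OF C(1)] local_toD(1)[OF C(2)]] by (simp add: leftmul_def fun_plus)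
next
  fix C assume C: "C \<in> local_to F"
  then obtain N where "loc N A C" using goodD(3)[OF A] unfolding mlocal_def by blast
  then have "\<forall>n\<ge>int N. leftmul A n C = 0"
    using prd_top[OF goodD(1)[OF A] local_toD(1)[OF C]] C by (simp add: leftmul_def fun_zero)
  then show "\<exists>K. \<forall>n\<ge>K. leftmul A n C = 0" by blast
qed (simp add: leftmul_def)

lemma leftmul_local:
  assumes A: "good A" and B: "good B" shows "E.mlocal (leftmul A) (leftmul B)"
proof -
  obtain N where N: "loc N A B" using goodD(3)[OF A goodD(2)[OF B]] unfolding mlocal_def by blast
  have "(dl ^^ N) (E.comm (leftmul A) (leftmul B) C) m n = 0" if C: "C \<in> local_to F" for C m n
  proof (intro ext)
    fix k w
    have c: "E.comm (leftmul A) (leftmul B) C m n k w = prd A m (prd B n C) k w - prd B n (prd A m C) k w" for m n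
      using C prd_local_to[OF A C] prd_local_to[OF B C] by (simp add: E.comm_def leftmul_def)
    have "(dl ^^ N) (E.comm (leftmul A) (leftmul B) C) m n k w = (dl ^^ N) (\<lambda>m n. prd A m (prd B n C) k w - prd B n (prd A m C) k w) m n"
      by (simp only: dl_pow_apply[where x = k] dl_pow_apply[where x = w] c)
    also have "\<dots> = 0"
    proof (cases "w \<in> S")
      case True
      then show ?thesis using prd_commutator_local goodD(1) A B local_toD(1) C N by blast
    next
      case False
      have "prd A m (prd B n C) k w = 0" "prd B n (prd A m C) k w = 0" for m n
        using vf_out[OF prd_vfield[OF goodD(1)[OF A] prd_vfield[OF goodD(1)[OF B] local_toD(1)[OF C]]] False]
          vf_out[OF prd_vfield[OF goodD(1)[OF B] prd_vfield[OF goodD(1)[OF A] local_toD(1)[OF C]]] False] by auto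
      then show ?thesis by (simp add: dl_pow_zero)
    qed
    finally show "(dl ^^ N) (E.comm (leftmul A) (leftmul B) C) m n k w = 0 k w" by simp
  qed
  then show ?thesis unfolding E.mlocal_def E.loc_def by blast
qed

text \<open>As functions of \<open>n\<close>, both sides are sequences \<open>X\<close> of fields with \<open>(X n)' = -n X (n - 1)\<close>.  Both vanish for
  \<open>n \<ge> 0\<close> and are \<open>A\<^sub>l B\<close> at \<open>n = -1\<close>.  The equation then determines \<open>X (n - 1)\<close> for all negative \<open>n\<close>.\<close>

lemma assoc_idf:
  assumes A: "good A" and B: "good B" and AB: "good (prd A l B)"
  shows "E.prd (leftmul A) l (leftmul B) n idf = leftmul (prd A l B) n idf"
proof -
  define G where "G = (\<lambda>n. E.prd (leftmul A) l (leftmul B) n idf)"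
  define H where "H = (\<lambda>n. leftmul (prd A l B) n idf)"
  define P where "P = (\<lambda>n. prd B n idf)"
  have Pm: "P n \<in> local_to F" for n unfolding P_def by (rule prd_local_to[OF B idf_local_to])
  note Av = goodD(1)[OF A] and Bv = goodD(1)[OF B]
  have lB: "leftmul B n idf = P n" for n by (simp add: leftmul_def idf_local_to P_def)
  have lA: "leftmul A n (P k) = prd A n (P k)" for n k by (simp add: leftmul_def Pm)
  have Pn: "P n = 0" if "n \<ge> 0" for n using prd_idf_nonneg[OF Bv that] by (simp add: P_def fun_zero)
  have A0: "prd A n 0 = 0" for n using prd_zero_right[OF Av] by (simp add: fun_zero)
  have Az: "leftmul A (int i) idf = 0" for i using prd_idf_nonneg[OF Av, of "int i"] by (simp add: leftmul_def idf_local_to fun_zero)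
  have ev: "ev0 (\<lambda>i. prd A (f i) (P (n + int i)))" for f n
    by (rule ev0I[of "nat (- n)"]) (simp add: Pn A0)
  have evk: "ev0 (\<lambda>i. prd A (f i) (P (n + int i)) k w)" for f n k w
    by (rule ev0_map[OF ev[of f n]]) simp
  have G: "G n = E.bin (-1) l (\<lambda>i. prd A (l - int i) (P (n + int i)))" for n
    by (simp add: G_def E.prd_def E.al_def E.be_def lB lA Az E.vf_zero[OF leftmul_vfield[OF B]] E.bin_zero_fun)
  have Gk: "G n k w = bin (-1) l (\<lambda>i. prd A (l - int i) (P (n + int i)) k w)" for n k w
    unfolding G by (rule bin_apply[OF ev])
  have derG: "der (G n) k w = sc (of_int (- n)) (G (n - 1) k w)" for n k w
  proof -
    define h where "h = (\<lambda>i. prd A (l - int i) (P (n - 1 + int i)) k w)"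
    have evh: "ev0 h" unfolding h_def by (rule evk)
    have evi: "ev0 (\<lambda>i. sc (f i) (h i))" "ev0 (\<lambda>i. sc (f i) (h (Suc i)))" for f
      by (rule ev0_map[OF evh], simp, rule ev0_map[OF ev0_Suc[OF evh]], simp)
    have "der (prd A (l - int i) (P (n + int i))) k w =
        sc (-1) (sc (of_int (l - int i)) (h (Suc i))) - (sc (of_int n) (h i) + sc (of_int (int i)) (h i))" for i
    proof -
      have dP: "der (P (n + int i)) = (\<lambda>k w. sc (of_int (- (n + int i))) (P (n - 1 + int i) k w))"
        unfolding P_def by (intro ext) (simp add: der_prd_idf[OF Bv] algebra_simps)
      have "prd A (l - int i) (der (P (n + int i))) k w = sc (of_int (- (n + int i))) (h i)"
        unfolding dP prd_scale_right[OF Av local_toD(1)[OF Pm]] h_def ..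
      moreover have "prd A (l - int i - 1) (P (n + int i)) k w = h (Suc i)" by (simp add: h_def algebra_simps)
      ultimately show ?thesis
        unfolding der_prd[OF Av local_toD(1)[OF Pm]] by (simp add: scale_left_diff_distrib)
    qed
    moreover have "der (G n) k w = bin (-1) l (\<lambda>i. der (prd A (l - int i) (P (n + int i))) k w)"
      unfolding der_def Gk by (rule bin_scale[symmetric]) (rule evk)
    ultimately have "der (G n) k w = bin (-1) l (\<lambda>i. sc (-1) (sc (of_int (l - int i)) (h (Suc i))) - (sc (of_int n) (h i) + sc (of_int (int i)) (h i)))"
      by simp
    also have "\<dots> = sc (-1) (bin (-1) l (\<lambda>i. sc (of_int (l - int i)) (h (Suc i)))) - (sc (of_int n) (bin (-1) l h) + bin (-1) l (\<lambda>i. sc (of_int (int i)) (h i)))"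
      by (subst bin_diff, simp only: scale_scale evi, rule ev0_add[OF evi(1) evi(1)])
        (simp only: bin_scale[OF evi(2)] bin_add[OF evi(1) evi(1)] bin_scale[OF evh])
    also have "\<dots> = sc (of_int (- n)) (G (n - 1) k w)"
    proof -
      have wt: "bin (-1) l (\<lambda>i. sc (of_int (l - int i)) (h (Suc i))) = sc (-1) (bin (-1) l (\<lambda>i. sc (of_int (int i)) (h i)))"
        by (rule bin_weight[OF evh]) simp
      have Gh: "G (n - 1) k w = bin (-1) l h" by (simp add: Gk h_def)
      show ?thesis unfolding wt Gh by simp
    qed
    finally show ?thesis .
  qed
  have derH: "der (H n) k w = sc (of_int (- n)) (H (n - 1) k w)" for n k w
    using der_prd_idf[OF goodD(1)[OF AB]] by (simp add: H_def leftmul_def idf_local_to)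
  have nonneg: "G n = 0" "H n = 0" if "n \<ge> 0" for n
    using that prd_idf_nonneg[OF goodD(1)[OF AB]]
    by (auto simp: G Pn A0 E.bin_zero_fun H_def leftmul_def idf_local_to fun_zero)
  have "G (- int (Suc j)) = H (- int (Suc j))" for j
  proof (induction j)
    case 0
    have "G (-1) = prd A l B"
      unfolding G by (subst E.bin_single[of 0]) (simp_all add: Pn A0, simp add: P_def prd_idf[OF Bv])
    then show ?case using prd_idf[OF goodD(1)[OF AB]] by (simp add: H_def leftmul_def idf_local_to)
  next
    case (Suc j)
    have e: "- int (Suc j) - 1 = - int (Suc (Suc j))" by simp
    have "sc (of_int (- (- int (Suc j)))) (G (- int (Suc (Suc j))) k w) = sc (of_int (- (- int (Suc j)))) (H (- int (Suc (Suc j))) k w)" for k w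
      by (simp only: derG[of "- int (Suc j)", unfolded e, symmetric] derH[of "- int (Suc j)", unfolded e, symmetric] Suc.IH)
    moreover have "(of_int (- (- int (Suc j))) :: complex) \<noteq> 0" by (simp del: of_nat_Suc)
    ultimately show ?case unfolding scale_cancel_left fun_eq_iff by blast
  qed
  then have neg: "G (- int (Suc j)) = H (- int (Suc j))" for j .
  have "G n = H n" by (cases n rule: int_cases) (simp_all only: nonneg of_nat_0_le_iff neg)
  then show ?thesis by (simp add: G_def H_def)
qed

text \<open>Goddard's uniqueness argument: the difference \<open>Z\<close> of the two sides kills the identity field and is local
  with left multiplication by \<open>C\<close>, hence it kills \<open>C\<close>, which is the product \<open>C\<^sub>-\<^sub>1 id\<close>.\<close>

theorem prd_assoc:
  assumes "A \<in> F" "B \<in> F" "C \<in> F"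
  shows "prd (prd A l B) n C = E.prd (leftmul A) l (leftmul B) n C"
proof -
  note A = good_F[OF assms(1)] and B = good_F[OF assms(2)] and C = good_F[OF assms(3)]
  note AB = prd_good[OF assms(1,2)]
  define Z where "Z = (\<lambda>n X. E.prd (leftmul A) l (leftmul B) n X - leftmul (prd A l B) n X)"
  have Zv: "E.vfield Z" unfolding Z_def
    by (intro E.vfield_diff E.prd_vfield leftmul_vfield A B AB)
  have loc: "E.mlocal (leftmul C) Z" unfolding Z_def
    by (intro E.mlocal_diff E.mlocal_sym[OF _ _ E.dong] E.prd_vfield leftmul_vfield leftmul_local A B C AB)
  have "Z n (leftmul C (-1) idf) = 0"
    by (rule E.kill_propagate[OF Zv leftmul_vfield[OF C] E.mlocal_sym[OF leftmul_vfield[OF C] Zv loc] idf_local_to])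
      (simp add: Z_def assoc_idf[OF A B AB])
  moreover have "leftmul C (-1) idf = C" by (simp add: leftmul_def idf_local_to prd_idf[OF goodD(1)[OF C]])
  ultimately show ?thesis by (simp add: Z_def leftmul_def goodD(2)[OF C])
qed

text \<open>The Jacobi identity at \<open>l = 0\<close> for left multiplications, read through \<open>prd_assoc\<close>.\<close>

lemma prd_commutator_formula:
  assumes "A \<in> F" "B \<in> F" "C \<in> F"
  shows "prd A m (prd B n C) - prd B n (prd A m C) = E.bin 1 m (\<lambda>i. prd (prd A (int i) B) (m + n - int i) C)"
proof -
  note A = good_F[OF assms(1)] and B = good_F[OF assms(2)] and C = goodD(2)[OF good_F[OF assms(3)]]
  obtain N where N: "E.loc N (leftmul A) (leftmul B)" using leftmul_local[OF A B] unfolding E.mlocal_def by blast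
  have "E.comm (leftmul A) (leftmul B) C m n = E.bin 1 m (\<lambda>i. E.prd (leftmul A) (int i) (leftmul B) (m + n - int i) C)"
    using E.prd_jacobi[OF leftmul_vfield[OF A] leftmul_vfield[OF B] N, of 0 m n C] E.Lf_0[OF leftmul_vfield[OF A] leftmul_vfield[OF B], of m n C]
    by simp
  then show ?thesis
    by (simp add: E.comm_def leftmul_def C prd_local_to[OF A C] prd_local_to[OF B C] prd_assoc[OF assms])
qed

lemma prd_assoc_formula:
  assumes "A \<in> F" "B \<in> F" "C \<in> F"
  shows "prd (prd A m B) n C = E.bin (-1) m (\<lambda>i. prd A (m - int i) (prd B (n + int i) C)) -
    fsc ((-1) powi m) (E.bin (-1) m (\<lambda>i. prd B (m + n - int i) (prd A (int i) C)))"
proof -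
  note A = good_F[OF assms(1)] and B = good_F[OF assms(2)] and C = goodD(2)[OF good_F[OF assms(3)]]
  show ?thesis
    unfolding prd_assoc[OF assms] by (simp add: E.prd_def E.al_def E.be_def leftmul_def C prd_local_to[OF A C] prd_local_to[OF B C])
qed

end

section \<open>Fields generated from the identity field\<close>

context field_space
begin

lemma idf_prd: assumes C: "vfield C" shows "prd idf n C = (if n = -1 then C else (\<lambda>k w. 0))"
proof (intro ext)
  fix k w
  have "prd idf n C k w = bin (-1) n (\<lambda>i. idf (n - int i) (C (k + int i) w))"
    by (simp add: prd_def al_def be_def idf_def[of "int _"] vf_zero[OF C] bin_zero_fun)
  also have "\<dots> = (if n = -1 then C else (\<lambda>k w. 0)) k w"
  proof -
    consider "n < -1" | "n = -1" | p where "n = int p"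
    proof (cases "n \<ge> 0")
      case True
      then show ?thesis using that(3)[of "nat n"] by simp
    next
      case False
      then have "n < -1 \<or> n = -1" by linarith
      then show ?thesis using that by blast
    qed
    then show ?thesis
    proof cases
      case 1
      then show ?thesis by (auto simp: idf_def intro!: bin_zero)
    next
      case 2
      then show ?thesis by (subst bin_single[of 0]) (auto simp: idf_def vf_mem'[OF C])
    next
      case (3 p)
      have "(of_int n gchoose Suc p :: complex) = 0" using 3 by (simp flip: binomial_gbinomial)
      then show ?thesis using 3 by (subst bin_single[of "Suc p"]) (auto simp: idf_def)
    qed
  qed
  finally show "prd idf n C k w = (if n = -1 then C else (\<lambda>k w. 0)) k w" .
qed

inductive_set fgen :: "(int \<Rightarrow> 'p \<Rightarrow> 'p) set \<Rightarrow> (int \<Rightarrow> 'p \<Rightarrow> 'p) set" for G where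
  fgen_idf: "idf \<in> fgen G"
| fgen_add: "A \<in> fgen G \<Longrightarrow> B \<in> fgen G \<Longrightarrow> A + B \<in> fgen G"
| fgen_scale: "A \<in> fgen G \<Longrightarrow> fsc c A \<in> fgen G"
| fgen_prd: "A \<in> G \<Longrightarrow> B \<in> fgen G \<Longrightarrow> prd A n B \<in> fgen G"

lemma fgen_subspace: "module.subspace fsc (fgen G)"
proof -
  interpret F: complex_space fsc by (rule cvs_fsc)
  have "fsc 0 idf \<in> fgen G" by (intro fgen.intros)
  moreover have "fsc 0 idf = 0" by (intro ext) (simp add: fsc_def)
  ultimately show ?thesis unfolding F.subspace_def using fgen_add fgen_scale by auto
qed

context
  fixes G
  assumes Gv: "\<And>A. A \<in> G \<Longrightarrow> vfield A" and Gloc: "\<And>A B. A \<in> G \<Longrightarrow> B \<in> G \<Longrightarrow> mlocal A B"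
begin

lemma fgen_vfield: "B \<in> fgen G \<Longrightarrow> vfield B"
  by (induction rule: fgen.induct)
   (auto intro: vfield_idf vfield_scale prd_vfield Gv vfield_add simp: fsc_def simp flip: fun_plus)

lemma fgen_local1: "B \<in> fgen G \<Longrightarrow> A \<in> G \<Longrightarrow> mlocal A B"
proof (induction arbitrary: A rule: fgen.induct)
  case fgen_idf then show ?case using mlocal_idf Gv by blast
next
  case (fgen_add B C) then show ?case
    unfolding fun_plus[symmetric] by (intro mlocal_add) (auto intro: Gv fgen_vfield)
next
  case (fgen_scale B c) then show ?case
    unfolding fsc_def by (intro mlocal_scale) (auto intro: Gv fgen_vfield)
next
  case (fgen_prd C B n)
  have "mlocal (prd C n B) A"
    by (rule dong[OF Gv[OF fgen_prd(1)] fgen_vfield[OF fgen_prd(2)] Gv[OF fgen_prd(4)] fgen_prd(3)[OF fgen_prd(1)]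
          Gloc[OF fgen_prd(1,4)] mlocal_sym[OF Gv[OF fgen_prd(4)] fgen_vfield[OF fgen_prd(2)] fgen_prd(3)[OF fgen_prd(4)]]])
  then show ?case
    by (rule mlocal_sym[OF prd_vfield[OF Gv[OF fgen_prd(1)] fgen_vfield[OF fgen_prd(2)]] Gv[OF fgen_prd(4)]])
qed

lemma fgen_local: "A \<in> fgen G \<Longrightarrow> B \<in> fgen G \<Longrightarrow> mlocal A B"
proof (induction rule: fgen.induct)
  case fgen_idf then show ?case using mlocal_sym mlocal_idf vfield_idf fgen_vfield by blast
next
  case (fgen_add A C)
  have "mlocal B (A + C)"
    unfolding fun_plus[symmetric] by (intro mlocal_add) (use fgen_add fgen_vfield mlocal_sym in blast)+
  then show ?case using fgen_add mlocal_sym fgen_vfield fgen.fgen_add by blast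
next
  case (fgen_scale A c)
  have "mlocal B (fsc c A)"
    unfolding fsc_def by (intro mlocal_scale) (use fgen_scale fgen_vfield mlocal_sym in blast)+
  then show ?case using fgen_scale mlocal_sym fgen_vfield fgen.fgen_scale by blast
next
  case (fgen_prd C A n)
  show ?case
    by (rule dong[OF Gv[OF fgen_prd(1)] fgen_vfield[OF fgen_prd(2)] fgen_vfield[OF fgen_prd(4)]
          fgen_local1[OF fgen_prd(2,1)] fgen_local1[OF fgen_prd(4,1)] fgen_prd(3)[OF fgen_prd(4)]])
qed

lemma fgen_G: "A \<in> G \<Longrightarrow> A \<in> fgen G"
  using fgen_prd[OF _ fgen_idf, where n = "-1" and A = A and G = G] prd_idf[OF Gv] by simp

lemma local_fields_fgen: "local_fields sc S (fgen G)"
  by unfold_locales (use fgen_vfield fgen_local in blast)+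

text \<open>A linear map \<open>Phi\<close> into fields that sends the action of the generating fields to left multiplication by
  them is a state-field correspondence.  Induction along the generation of \<open>S\<close> from \<open>e\<close> gives creation, and
  it shows that \<open>Phi\<close> sends products to products, which turns the Jacobi identity of the fields \<open>Phi u\<close> and
  \<open>Phi v\<close> into an identity in \<open>S\<close>.  In the inductive step of the latter, \<open>(A\<^sub>m u)\<^sub>n v\<close> is expanded in the
  space of fields by the associativity formula.\<close>

theorem reconstruction:
  assumes e: "e \<in> S" and Ge: "\<And>A n. A \<in> G \<Longrightarrow> n \<ge> 0 \<Longrightarrow> A n e = 0"
    and gen: "\<And>Q. subspace Q \<Longrightarrow> e \<in> Q \<Longrightarrow> (\<And>A n w. A \<in> G \<Longrightarrow> w \<in> Q \<Longrightarrow> w \<in> S \<Longrightarrow> A n w \<in> Q) \<Longrightarrow> S \<subseteq> Q"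
    and add: "\<And>v w. v \<in> S \<Longrightarrow> w \<in> S \<Longrightarrow> Phi (v + w) = Phi v + Phi w"
    and scale: "\<And>c w. w \<in> S \<Longrightarrow> Phi (sc c w) = fsc c (Phi w)"
    and Phi_e: "Phi e = idf" and Phi_G: "\<And>A n w. A \<in> G \<Longrightarrow> w \<in> S \<Longrightarrow> Phi (A n w) = prd A n (Phi w)"
  shows "w \<in> S \<Longrightarrow> Phi w \<in> fgen G"
    and "w \<in> S \<Longrightarrow> Phi w (-1) e = w"
    and "w \<in> S \<Longrightarrow> n \<ge> 0 \<Longrightarrow> Phi w n e = 0"
    and "u \<in> S \<Longrightarrow> v \<in> S \<Longrightarrow> Lf (Phi u) (Phi v) l m n w = bin 1 m (\<lambda>i. Phi (Phi u (l + int i) v) (m + n - int i) w)"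
proof -
  interpret T: local_fields sc S "fgen G" by (rule local_fields_fgen)
  have ind [consumes 1]: "P w" if "w \<in> S" and "P e" and "\<And>v w. v \<in> S \<Longrightarrow> w \<in> S \<Longrightarrow> P v \<Longrightarrow> P w \<Longrightarrow> P (v + w)"
    "\<And>c w. w \<in> S \<Longrightarrow> P w \<Longrightarrow> P (sc c w)" "\<And>A n w. A \<in> G \<Longrightarrow> w \<in> S \<Longrightarrow> P w \<Longrightarrow> P (A n w)" for P w
  proof -
    have "P 0" using that(4)[OF e that(2), of 0] by simp
    then have "subspace {w \<in> S. P w}" unfolding subspace_def using that S_zero S_add S_scale by auto
    then have "S \<subseteq> {w \<in> S. P w}"
      by (rule gen) (use that e Gv vf_mem in auto)
    then show ?thesis using \<open>w \<in> S\<close> by blast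
  qed
  show T: "Phi w \<in> fgen G" if "w \<in> S" for w
    using that
    by (induction w rule: ind)
      (simp_all only: Phi_e add scale Phi_G fgen.fgen_idf fgen.fgen_add fgen.fgen_scale fgen.fgen_prd)
  then have Pv: "vfield (Phi w)" if "w \<in> S" for w using fgen_vfield that by blast
  have create: "Phi w (-1) e = w \<and> (\<forall>n\<ge>0. Phi w n e = 0)" if "w \<in> S" for w
    using that
  proof (induction w rule: ind)
    case (4 A n w)
    have A: "vfield A" by (rule Gv) (rule 4)
    have A0: "A k 0 = 0" "Phi w k 0 = 0" for k using vf_zero A Pv 4 by auto
    \<comment> \<open>On \<open>e\<close> only the first half of the product contributes, since \<open>A\<close> kills \<open>e\<close> in nonnegative degrees.\<close>
    have z: "bin (-1) n (\<lambda>i. Phi w (n + k - int i) (A (int i) e)) = 0" for k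
      by (rule bin_zero) (simp add: Ge 4 A0)
    have "prd A n (Phi w) k e = bin (-1) n (\<lambda>i. A (n - int i) (Phi w (k + int i) e))" for k
      by (simp add: prd_def al_def be_def z)
    moreover have "bin (-1) n (\<lambda>i. A (n - int i) (Phi w (-1 + int i) e)) = A n w"
      using 4 by (subst bin_single[of 0]) (auto simp: A0)
    moreover have "bin (-1) n (\<lambda>i. A (n - int i) (Phi w (k + int i) e)) = 0" if "k \<ge> 0" for k
      using 4 that by (intro bin_zero) (auto simp: A0)
    ultimately show ?case using 4 by (simp add: Phi_G)
  qed (use e in \<open>auto simp: Phi_e idf_def add scale fsc_def\<close>)
  then show "w \<in> S \<Longrightarrow> Phi w (-1) e = w" "w \<in> S \<Longrightarrow> n \<ge> 0 \<Longrightarrow> Phi w n e = 0" for w n by blast+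
  have PS: "Phi u n v \<in> S" if "u \<in> S" "v \<in> S" for u v n using vf_mem Pv that by blast
  have Phi_bin: "Phi (bin c l g) = T.E.bin c l (\<lambda>i. Phi (g i))" if "ev0 g" "\<And>i. g i \<in> S" for c l g
    by (rule bin_hom[OF complex_space_axioms cvs_fsc S add scale that])
  have Phi_diff: "Phi (x - y) = Phi x - Phi y" if "x \<in> S" "y \<in> S" for x y
  proof -
    have "Phi (- y) = - Phi y" using scale[OF that(2), of "-1"] by (simp add: fun_eq_iff fsc_def)
    then show ?thesis using add[OF that(1) S_neg[OF that(2)]] by simp
  qed
  have assoc: "\<forall>n v. v \<in> S \<longrightarrow> Phi (Phi u n v) = prd (Phi u) n (Phi v)" if "u \<in> S" for u
    using that
  proof (induction u rule: ind)
    case 1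
    have "Phi 0 = 0" using scale[OF e, of 0] by (simp add: fun_eq_iff fsc_def)
    then have "Phi (idf n v) = prd idf n (Phi v)" if "v \<in> S" for n v
      using idf_prd[OF Pv[OF that], of n] that by (simp add: idf_def[of n v] fun_zero)
    then show ?case by (simp only: Phi_e) blast
  next
    case (2 u u')
    then show ?case using prd_add_left[OF Pv Pv Pv] PS by (simp add: add fun_plus)
  next
    case (3 c u)
    then show ?case using prd_scale_left[OF Pv Pv] PS by (simp add: scale fsc_def)
  next
    case (4 A m u)
    note A = Gv[OF 4(1)] and u = 4(2)
    show ?case
    proof (intro allI impI)
      fix n v assume v: "v \<in> S"
      have ev: "ev0 (\<lambda>i. A (m - int i) (Phi u (n + int i) v))" "ev0 (\<lambda>i. Phi u (m + n - int i) (A (int i) v))"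
        using vf_ev0A[OF A Pv[OF u]] vf_ev00[OF Pv[OF u] A] by auto
      have mem: "A k x \<in> S" "Phi u k x \<in> S" for k x using vf_mem' A Pv[OF u] by auto
      have "Phi (prd A m (Phi u) n v) =
        complex_space.bin fsc (-1) m (\<lambda>i. Phi (A (m - int i) (Phi u (n + int i) v))) -
        fsc ((-1) powi m) (complex_space.bin fsc (-1) m (\<lambda>i. Phi (Phi u (m + n - int i) (A (int i) v))))"
        unfolding prd_def al_def be_def
        by (simp add: Phi_diff Phi_bin ev mem bin_mem[OF S] S_scale scale)
      also have "\<dots> = prd (prd A m (Phi u)) n (Phi v)"
        using 4 v by (simp add: T.prd_assoc_formula[OF fgen_G[OF 4(1)] T[OF u] T[OF v]] mem Phi_G vf_mem[OF A])
      finally show "Phi (Phi (A m u) n v) = prd (Phi (A m u)) n (Phi v)" using 4 by (simp add: Phi_G)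
    qed
  qed
  show "Lf (Phi u) (Phi v) l m n w = bin 1 m (\<lambda>i. Phi (Phi u (l + int i) v) (m + n - int i) w)" if "u \<in> S" "v \<in> S" for u v w l m n
  proof -
    have "mlocal (Phi u) (Phi v)" using T fgen_local that by blast
    then obtain N where "loc N (Phi u) (Phi v)" unfolding mlocal_def by blast
    from prd_jacobi[OF Pv Pv this] show ?thesis using that assoc by simp
  qed
qed

end

end

section \<open>Complex vector spaces as modules\<close>

lemma cfield_simps [simp]: "carrier cfield = UNIV" "mult cfield = (*)" "one cfield = 1" "zero cfield = 0" "add cfield = (+)"
  by (simp_all add: cfield_def)

lemma cring_cfield: "cring cfield"
  by (rule cringI)
    (auto intro!: abelian_groupI comm_monoidI simp: algebra_simps, metis add.left_inverse add.right_inverse)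

lemma cfield_neg: "\<ominus>\<^bsub>cfield\<^esub> c = - c"
proof -
  interpret cring cfield by (rule cring_cfield)
  show ?thesis by (rule minus_equality) auto
qed

locale complex_module = module cfield M for M :: "(complex, 'm) module" (structure)
begin

lemma sm_closed [simp]: "x \<in> carrier M \<Longrightarrow> c \<odot> x \<in> carrier M"
  by (rule smult_closed) simp_all

lemma sm_add_left: "x \<in> carrier M \<Longrightarrow> (c + d) \<odot> x = c \<odot> x \<oplus> d \<odot> x"
  using smult_l_distr[of c d x] by simp

lemma sm_add_right: "x \<in> carrier M \<Longrightarrow> y \<in> carrier M \<Longrightarrow> c \<odot> (x \<oplus> y) = c \<odot> x \<oplus> c \<odot> y"
  using smult_r_distr[of c x y] by simp

lemma sm_assoc: "x \<in> carrier M \<Longrightarrow> (c * d) \<odot> x = c \<odot> (d \<odot> x)"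
  using smult_assoc1[of c d x] by simp

lemma sm_zero_left [simp]: "x \<in> carrier M \<Longrightarrow> 0 \<odot> x = \<zero>"
  using smult_l_null[of x] by simp

lemma sm_zero_right [simp]: "c \<odot> \<zero> = \<zero>"
  using smult_r_null[of c] by simp

lemma sm_one [simp]: "x \<in> carrier M \<Longrightarrow> 1 \<odot> x = x"
  using smult_one[of x] by simp

lemma sm_neg1: "x \<in> carrier M \<Longrightarrow> (-1) \<odot> x = \<ominus> x"
  using smult_l_minus[of 1 x] by (simp add: cfield_neg)

lemma submoduleI':
  assumes "H \<subseteq> carrier M" "\<zero> \<in> H" "\<And>x y. x \<in> H \<Longrightarrow> y \<in> H \<Longrightarrow> x \<oplus> y \<in> H" "\<And>c x. x \<in> H \<Longrightarrow> c \<odot> x \<in> H"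
  shows "submodule H cfield M"
proof (rule submoduleI)
  fix x assume "x \<in> H"
  then show "\<ominus> x \<in> H" using assms(4)[of x "-1"] sm_neg1[of x] assms(1) by auto
qed (use assms in auto)

lemma submoduleD:
  assumes "submodule H cfield M"
  shows "H \<subseteq> carrier M" "\<zero> \<in> H" "\<And>x y. x \<in> H \<Longrightarrow> y \<in> H \<Longrightarrow> x \<oplus> y \<in> H" "\<And>c x. x \<in> H \<Longrightarrow> c \<odot> x \<in> H"
proof -
  show 1: "H \<subseteq> carrier M" using submoduleE[OF assms] by blast
  show "\<And>x y. x \<in> H \<Longrightarrow> y \<in> H \<Longrightarrow> x \<oplus> y \<in> H" using submoduleE[OF assms] by blast
  show 2: "\<And>c x. x \<in> H \<Longrightarrow> c \<odot> x \<in> H" using submoduleE[OF assms] by simp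
  obtain x where "x \<in> H" using submoduleE[OF assms] by blast
  then show "\<zero> \<in> H" using 2[of x 0] 1 by auto
qed

lemma sum_neg1_iff: "a \<in> carrier M \<Longrightarrow> b \<in> carrier M \<Longrightarrow> a \<oplus> (-1) \<odot> b = \<zero> \<longleftrightarrow> a = b"
proof
  assume a: "a \<in> carrier M" "b \<in> carrier M"
  show "a = b" if "a \<oplus> (-1) \<odot> b = \<zero>"
    using that M.minus_equality[of a "\<ominus> b"] M.minus_minus[of b] a by (simp add: sm_neg1)
  show "a \<oplus> (-1) \<odot> b = \<zero>" if "a = b" using that a by (simp add: sm_neg1 M.r_neg)
qed

end

lemma complex_moduleI: "module cfield M \<Longrightarrow> complex_module M" by (simp add: complex_module_def)

lemma cmoduleI:
  assumes closed: "\<And>x y. x \<in> carrier M \<Longrightarrow> y \<in> carrier M \<Longrightarrow> x \<oplus>\<^bsub>M\<^esub> y \<in> carrier M" "\<zero>\<^bsub>M\<^esub> \<in> carrier M"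
      "\<And>c x. x \<in> carrier M \<Longrightarrow> c \<odot>\<^bsub>M\<^esub> x \<in> carrier M"
    and add: "\<And>x y z. x \<in> carrier M \<Longrightarrow> y \<in> carrier M \<Longrightarrow> z \<in> carrier M \<Longrightarrow> (x \<oplus>\<^bsub>M\<^esub> y) \<oplus>\<^bsub>M\<^esub> z = x \<oplus>\<^bsub>M\<^esub> (y \<oplus>\<^bsub>M\<^esub> z)"
      "\<And>x y. x \<in> carrier M \<Longrightarrow> y \<in> carrier M \<Longrightarrow> x \<oplus>\<^bsub>M\<^esub> y = y \<oplus>\<^bsub>M\<^esub> x"
      "\<And>x. x \<in> carrier M \<Longrightarrow> \<zero>\<^bsub>M\<^esub> \<oplus>\<^bsub>M\<^esub> x = x"
    and neg: "\<And>x. x \<in> carrier M \<Longrightarrow> (-1) \<odot>\<^bsub>M\<^esub> x \<oplus>\<^bsub>M\<^esub> x = \<zero>\<^bsub>M\<^esub>"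
    and smult: "\<And>a b x. x \<in> carrier M \<Longrightarrow> (a + b) \<odot>\<^bsub>M\<^esub> x = a \<odot>\<^bsub>M\<^esub> x \<oplus>\<^bsub>M\<^esub> b \<odot>\<^bsub>M\<^esub> x"
      "\<And>a x y. x \<in> carrier M \<Longrightarrow> y \<in> carrier M \<Longrightarrow> a \<odot>\<^bsub>M\<^esub> (x \<oplus>\<^bsub>M\<^esub> y) = a \<odot>\<^bsub>M\<^esub> x \<oplus>\<^bsub>M\<^esub> a \<odot>\<^bsub>M\<^esub> y"
      "\<And>a b x. x \<in> carrier M \<Longrightarrow> (a * b) \<odot>\<^bsub>M\<^esub> x = a \<odot>\<^bsub>M\<^esub> (b \<odot>\<^bsub>M\<^esub> x)"
      "\<And>x. x \<in> carrier M \<Longrightarrow> 1 \<odot>\<^bsub>M\<^esub> x = x"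
  shows "module cfield (M :: (complex, 'm) module)"
proof (rule moduleI[OF cring_cfield])
  show "abelian_group M"
    by (rule abelian_groupI) (use assms in blast)+
qed (use assms in auto)

definition psc :: "complex \<Rightarrow> ('x \<Rightarrow>\<^sub>0 complex) \<Rightarrow> ('x \<Rightarrow>\<^sub>0 complex)" where
  "psc c = Poly_Mapping.map ((*) c)"

lemma lookup_psc [simp]: "Poly_Mapping.lookup (psc c p) x = c * Poly_Mapping.lookup p x"
  by (simp add: psc_def Poly_Mapping.map.rep_eq when_def)

lemma cvs_psc: "complex_space psc"
  by unfold_locales (auto intro!: poly_mapping_eqI simp: lookup_add algebra_simps)

lemma keys_psc: "Poly_Mapping.keys (psc c p) \<subseteq> Poly_Mapping.keys p"
  by (auto simp: in_keys_iff)

lemma psc_single: "psc c (Poly_Mapping.single x d) = Poly_Mapping.single x (c * d)"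
  by (simp add: psc_def)

context complex_space
begin

definition lext :: "('x \<Rightarrow> 'p) \<Rightarrow> ('x \<Rightarrow>\<^sub>0 complex) \<Rightarrow> 'p" where
  "lext f p = (\<Sum>x\<in>Poly_Mapping.keys p. sc (Poly_Mapping.lookup p x) (f x))"

lemma lext_superset:
  assumes "finite X" "Poly_Mapping.keys p \<subseteq> X"
  shows "lext f p = (\<Sum>x\<in>X. sc (Poly_Mapping.lookup p x) (f x))"
  unfolding lext_def by (rule sum.mono_neutral_left) (use assms in \<open>auto simp: in_keys_iff\<close>)

lemma lext_add: "lext f (p + q) = lext f p + lext f q"
proof -
  let ?X = "Poly_Mapping.keys p \<union> Poly_Mapping.keys q"
  have "Poly_Mapping.keys (p + q) \<subseteq> ?X" by (rule keys_add)
  then show ?thesis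
    by (simp add: lext_superset[of ?X] lookup_add scale_left_distrib sum.distrib)
qed

lemma lext_scale: "lext f (psc c p) = sc c (lext f p)"
  using keys_psc[of c p] by (simp add: lext_superset[of "Poly_Mapping.keys p"] scale_sum_right)

lemma lext_single: "lext f (Poly_Mapping.single x c) = sc c (f x)"
  by (subst lext_superset[of "{x}"]) auto

lemma lext_0 [simp]: "lext f 0 = 0" by (simp add: lext_def)

lemma lext_diff: "lext f (p - q) = lext f p - lext f q"
  using lext_add[of f "p - q" q] by simp


end

lemma poly_mapping_decomp: "(p :: 'x \<Rightarrow>\<^sub>0 complex) = (\<Sum>x\<in>Poly_Mapping.keys p. Poly_Mapping.single x (Poly_Mapping.lookup p x))"
  by (rule poly_mapping_eqI) (auto simp: lookup_sum lookup_single when_def in_keys_iff sum.delta')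

lemma poly_mapping_lin_induct [consumes 1, case_names zero add single]:
  assumes "Poly_Mapping.keys p \<subseteq> X" and "P 0"
    and "\<And>p q. Poly_Mapping.keys p \<subseteq> X \<Longrightarrow> Poly_Mapping.keys q \<subseteq> X \<Longrightarrow> P p \<Longrightarrow> P q \<Longrightarrow> P (p + q)"
    and "\<And>x c. x \<in> X \<Longrightarrow> P (Poly_Mapping.single x (c :: complex))"
  shows "P p"
proof -
  have "Poly_Mapping.keys (\<Sum>x\<in>A. Poly_Mapping.single x (Poly_Mapping.lookup p x)) \<subseteq> X \<and>
      P (\<Sum>x\<in>A. Poly_Mapping.single x (Poly_Mapping.lookup p x))" if "finite A" "A \<subseteq> X" for A
    using that
  proof (induction A)
    case (insert x A)
    have "Poly_Mapping.keys (Poly_Mapping.single x (Poly_Mapping.lookup p x)) \<subseteq> X" using insert by simp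
    moreover note keys_add[of "Poly_Mapping.single x (Poly_Mapping.lookup p x)" "\<Sum>x\<in>A. Poly_Mapping.single x (Poly_Mapping.lookup p x)"]
    ultimately show ?case using insert assms(3,4) by auto
  qed (use assms in auto)
  from this[of "Poly_Mapping.keys p"] show ?thesis using assms(1) poly_mapping_decomp[of p] by simp
qed

text \<open>An endomorphism with prescribed kernel is a model of the quotient by that kernel in which the values
  remain in the same type.\<close>

lemma (in complex_space) projection_exists:
  assumes N: "subspace N"
  shows "\<exists>\<pi>. (\<forall>x y. \<pi> (x + y) = \<pi> x + \<pi> y) \<and> (\<forall>c x. \<pi> (sc c x) = sc c (\<pi> x)) \<and> (\<forall>x. \<pi> x = 0 \<longleftrightarrow> x \<in> N)"
proof -
  interpret P: vector_space_pair sc sc by unfold_locales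
  obtain B where B: "B \<subseteq> N" "independent B" "N \<subseteq> span B" using maximal_independent_subset by blast
  obtain B' where B': "B \<subseteq> B'" "independent B'" "UNIV \<subseteq> span B'"
    by (rule maximal_independent_subset_extend[OF subset_UNIV B(2)])
  define f where "f = P.construct B' (\<lambda>b. if b \<in> B then 0 else b)"
  have lin: "Vector_Spaces.linear sc sc f" unfolding f_def by (rule P.linear_construct) (rule B')
  then have f: "f (x + y) = f x + f y" "f (sc c x) = sc c (f x)" for x y c
    by (simp_all only: Vector_Spaces.linear_iff)
  have f0: "f 0 = 0" using f(2)[of 0 0] by simp
  have fB: "f b = (if b \<in> B then 0 else b)" if "b \<in> B'" for b
    unfolding f_def using P.construct_basis[OF B'(2) that] by simp
  have span: "span B = N" using B N span_minimal by (metis subset_antisym)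
  have "f x = 0" if "x \<in> N" for x
  proof -
    have "subspace {x. f x = 0}" by (auto simp: subspace_def f f0)
    moreover have "B \<subseteq> {x. f x = 0}" using fB B' by auto
    ultimately have "span B \<subseteq> {x. f x = 0}" using span_minimal by blast
    then show ?thesis using that span by blast
  qed
  moreover have "x \<in> N" if "f x = 0" for x
  proof -
    have "subspace {x. x - f x \<in> N}"
    proof (unfold subspace_def, intro conjI ballI allI)
      show "0 \<in> {x. x - f x \<in> N}" by (simp add: f0 subspace_0[OF N])
    next
      fix x y assume "x \<in> {x. x - f x \<in> N}" "y \<in> {x. x - f x \<in> N}"
      then have "(x - f x) + (y - f y) \<in> N" by (simp add: subspace_add[OF N])
      then show "x + y \<in> {x. x - f x \<in> N}" by (simp add: f algebra_simps)
    next
      fix c x assume "x \<in> {x. x - f x \<in> N}"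
      then have "sc c (x - f x) \<in> N" by (simp add: subspace_scale[OF N])
      then show "sc c x \<in> {x. x - f x \<in> N}" by (simp add: f scale_right_diff_distrib)
    qed
    moreover have "B' \<subseteq> {x. x - f x \<in> N}" using fB B subspace_0[OF N] by auto
    ultimately have "span B' \<subseteq> {x. x - f x \<in> N}" using span_minimal by blast
    then have "x - f x \<in> N" using B' by blast
    then show ?thesis using that by simp
  qed
  ultimately show ?thesis using f by blast
qed

definition lev :: "(complex, 'm) module \<Rightarrow> ('m \<Rightarrow>\<^sub>0 complex) \<Rightarrow> 'm" where
  "lev M p = (\<Oplus>\<^bsub>M\<^esub>x\<in>Poly_Mapping.keys p. Poly_Mapping.lookup p x \<odot>\<^bsub>M\<^esub> x)"

text \<open>A module is the quotient of the free vector space on its carrier by the kernel of the evaluation \<open>lev\<close>, and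
  \<open>projection_exists\<close> realises this quotient inside the type of finitely supported functions.\<close>

lemma module_embedding:
  fixes M :: "(complex, 'm) module"
  assumes "module cfield M"
  shows "\<exists>f :: 'm \<Rightarrow> ('m \<Rightarrow>\<^sub>0 complex). (\<forall>x\<in>carrier M. \<forall>y\<in>carrier M. f (x \<oplus>\<^bsub>M\<^esub> y) = f x + f y) \<and>
    (\<forall>c. \<forall>x\<in>carrier M. f (c \<odot>\<^bsub>M\<^esub> x) = psc c (f x)) \<and> inj_on f (carrier M)"
proof -
  interpret complex_module M using assms by (rule complex_moduleI)
  interpret P: complex_space psc by (rule cvs_psc)
  let ?K = "{p. Poly_Mapping.keys p \<subseteq> carrier M}"
  have lev: "lev M p = (\<Oplus>\<^bsub>M\<^esub>x\<in>X. Poly_Mapping.lookup p x \<odot>\<^bsub>M\<^esub> x)"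
    if "finite X" "Poly_Mapping.keys p \<subseteq> X" "X \<subseteq> carrier M" for p X
    unfolding lev_def
    by (rule M.add.finprod_mono_neutral_cong_left) (use that in \<open>auto simp: in_keys_iff Pi_def\<close>)
  have add: "lev M (p + q) = lev M p \<oplus>\<^bsub>M\<^esub> lev M q" if "p \<in> ?K" "q \<in> ?K" for p q
  proof -
    let ?X = "Poly_Mapping.keys p \<union> Poly_Mapping.keys q"
    have "Poly_Mapping.keys (p + q) \<subseteq> ?X" by (rule keys_add)
    then show ?thesis using that
      by (subst (1 2 3) lev[of ?X]) (auto simp: lookup_add sm_add_left subset_iff Pi_def intro!: M.finsum_addf[symmetric] M.finsum_cong'
          trans[OF M.finsum_cong' M.finsum_addf])
  qed
  have scale: "lev M (psc c p) = c \<odot>\<^bsub>M\<^esub> lev M p" if "p \<in> ?K" for c p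
    using that keys_psc[of c p]
    by (subst (1 2) lev[of "Poly_Mapping.keys p"])
      (auto simp: finsum_smult_ldistr[simplified] Pi_def subset_iff sm_assoc intro!: M.finsum_cong')
  have single: "lev M (Poly_Mapping.single x 1) = x" if "x \<in> carrier M" for x
    using that by (subst lev[of "{x}"]) auto
  define N where "N = {p \<in> ?K. lev M p = \<zero>\<^bsub>M\<^esub>}"
  have zero: "lev M 0 = \<zero>\<^bsub>M\<^esub>" by (simp add: lev_def)
  have K: "p + q \<in> ?K" "psc c p \<in> ?K" if "p \<in> ?K" "q \<in> ?K" for p q c
    using that keys_add[of p q] keys_psc[of c p] by auto
  have sub: "P.subspace N"
    unfolding P.subspace_def N_def using K add scale zero by (auto dest!: subsetD[OF keys_psc])
  from P.projection_exists[OF sub] obtain f :: "('m \<Rightarrow>\<^sub>0 complex) \<Rightarrow> ('m \<Rightarrow>\<^sub>0 complex)"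
    where "(\<forall>x y. f (x + y) = f x + f y) \<and> (\<forall>c x. f (psc c x) = psc c (f x)) \<and> (\<forall>x. f x = 0 \<longleftrightarrow> x \<in> N)" ..
  then have f: "\<And>x y. f (x + y) = f x + f y" "\<And>c x. f (psc c x) = psc c (f x)" "\<And>x. f x = 0 \<longleftrightarrow> x \<in> N" by blast+
  have neg: "f (- x) = - f x" for x using f(1)[of x "- x"] f(1)[of 0 0]
    by (simp add: eq_neg_iff_add_eq_0 add.commute)
  have diff: "f (x - y) = f x - f y" for x y using f(1)[of x "- y"] neg by simp
  have closed: "lev M p \<in> carrier M" if "p \<in> ?K" for p
    unfolding lev_def using that by (intro M.finsum_closed) auto
  have feq: "f p = f q \<longleftrightarrow> lev M p = lev M q" if "p \<in> ?K" "q \<in> ?K" for p q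
  proof -
    have "psc (-1) q = - q" by (rule poly_mapping_eqI) simp
    then have pq: "p + psc (-1) q = p - q" by simp
    have "f p = f q \<longleftrightarrow> p + psc (-1) q \<in> N" using f(3)[of "p - q"] diff pq by simp
    also have "\<dots> \<longleftrightarrow> lev M (p + psc (-1) q) = \<zero>\<^bsub>M\<^esub>"
      using K(1)[OF that(1) K(2)[OF that(2,2)], of "-1"] unfolding N_def by blast
    also have "lev M (p + psc (-1) q) = lev M p \<oplus>\<^bsub>M\<^esub> (-1) \<odot>\<^bsub>M\<^esub> lev M q"
      by (simp only: add[OF that(1) K(2)[OF that(2,2)]] scale[OF that(2)])
    also have "lev M p \<oplus>\<^bsub>M\<^esub> (-1) \<odot>\<^bsub>M\<^esub> lev M q = \<zero>\<^bsub>M\<^esub> \<longleftrightarrow> lev M p = lev M q"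
      using closed that by (intro sum_neg1_iff) auto
    finally show ?thesis .
  qed
  have s: "Poly_Mapping.single x c \<in> ?K" if "x \<in> carrier M" for x and c :: complex using that by simp
  show ?thesis
  proof (intro exI[of _ "\<lambda>x. f (Poly_Mapping.single x 1)"] conjI ballI allI inj_onI)
    fix x y assume xy: "x \<in> carrier M" "y \<in> carrier M"
    have "f (Poly_Mapping.single (x \<oplus>\<^bsub>M\<^esub> y) 1) = f (Poly_Mapping.single x 1 + Poly_Mapping.single y 1)"
      using xy by (subst feq) (auto simp: add[OF s s] single dest!: subsetD[OF keys_add])
    then show "f (Poly_Mapping.single (x \<oplus>\<^bsub>M\<^esub> y) 1) = f (Poly_Mapping.single x 1) + f (Poly_Mapping.single y 1)"
      using f by simp
    show "x = y" if "f (Poly_Mapping.single x 1) = f (Poly_Mapping.single y 1)"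
      using that feq[OF s[OF xy(1)] s[OF xy(2)]] single xy by simp
  next
    fix x c assume x: "x \<in> carrier M"
    have "f (Poly_Mapping.single (c \<odot>\<^bsub>M\<^esub> x) 1) = f (psc c (Poly_Mapping.single x 1))"
      using x K(2)[OF s[OF x] s[OF x]] scale[OF s[OF x]] single[OF x]
      by (subst feq[OF s[of "c \<odot>\<^bsub>M\<^esub> x" 1]]) (auto simp: single)
    then show "f (Poly_Mapping.single (c \<odot>\<^bsub>M\<^esub> x) 1) = psc c (f (Poly_Mapping.single x 1))"
      using f by simp
  qed
qed

locale module_map = complex_module M + complex_space sc for M :: "(complex, 'm) module" (structure) and sc :: "complex \<Rightarrow> 'p::ab_group_add \<Rightarrow> 'p" +
  fixes f :: "'m \<Rightarrow> 'p"
  assumes f_add: "x \<in> carrier M \<Longrightarrow> y \<in> carrier M \<Longrightarrow> f (x \<oplus> y) = f x + f y"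
    and f_scale: "x \<in> carrier M \<Longrightarrow> f (c \<odot> x) = sc c (f x)"
begin

lemma f_zero [simp]: "f \<zero> = 0"
  using f_scale[of \<zero> 0] by simp

lemma f_neg: "x \<in> carrier M \<Longrightarrow> f (\<ominus> x) = - f x"
  using f_scale[of x "-1"] by (simp add: sm_neg1)

lemma f_minus: "x \<in> carrier M \<Longrightarrow> y \<in> carrier M \<Longrightarrow> f (x \<ominus> y) = f x - f y"
  by (simp add: M.minus_eq f_add f_neg)

lemma f_finsum: "(\<And>i. i \<in> A \<Longrightarrow> g i \<in> carrier M) \<Longrightarrow> f (\<Oplus>i\<in>A. g i) = (\<Sum>i\<in>A. f (g i))"
proof (induction A rule: infinite_finite_induct)
  case (insert a A)
  then have "(\<Oplus>i\<in>insert a A. g i) = g a \<oplus> (\<Oplus>i\<in>A. g i)" by (intro M.finsum_insert) auto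
  moreover have "(\<Oplus>i\<in>A. g i) \<in> carrier M" using insert by (intro M.finsum_closed) auto
  ultimately show ?case using insert by (simp add: f_add)
qed simp_all

end

locale module_embedded = module_map +
  assumes inj: "inj_on f (carrier M)"
begin

lemma f_eq_iff: "x \<in> carrier M \<Longrightarrow> y \<in> carrier M \<Longrightarrow> f x = f y \<longleftrightarrow> x = y"
  using inj by (auto simp: inj_on_def)

lemma f_eq_0: "x \<in> carrier M \<Longrightarrow> f x = 0 \<longleftrightarrow> x = \<zero>"
  using f_eq_iff[of x \<zero>] by simp

lemma f_supp_sum: assumes "\<And>i. g i \<in> carrier M" shows "f (supp_sum M g) = Sum_any (\<lambda>i. f (g i))"
  unfolding supp_sum_def Sum_any.expand_set using assms by (simp add: f_finsum f_eq_0)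

lemma supp_sum_closed: assumes "\<And>i. g i \<in> carrier M" shows "supp_sum M g \<in> carrier M"
  unfolding supp_sum_def using assms by (intro M.finsum_closed) auto

end

lemma obtain_module_embedded:
  fixes M :: "(complex, 'm) module"
  assumes "module cfield M"
  obtains f :: "'m \<Rightarrow> ('m \<Rightarrow>\<^sub>0 complex)" where "module_embedded M psc f"
proof -
  from module_embedding[OF assms] obtain f :: "'m \<Rightarrow> ('m \<Rightarrow>\<^sub>0 complex)"
    where "\<forall>x\<in>carrier M. \<forall>y\<in>carrier M. f (x \<oplus>\<^bsub>M\<^esub> y) = f x + f y"
      "\<forall>c. \<forall>x\<in>carrier M. f (c \<odot>\<^bsub>M\<^esub> x) = psc c (f x)" "inj_on f (carrier M)" by blast
  then have "module_embedded M psc f"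
    by (intro module_embedded.intro module_map.intro module_map_axioms.intro module_embedded_axioms.intro complex_moduleI assms cvs_psc) auto
  then show ?thesis by (rule that)
qed

section \<open>Quotient spaces\<close>

locale subspace_quotient = complex_module M for M :: "(complex, 'm) module" (structure) +
  fixes N assumes N: "submodule N cfield M"
begin

lemmas N_closed = submoduleD(1)[OF N, THEN subsetD] and N_zero = submoduleD(2)[OF N]
  and N_add = submoduleD(3)[OF N] and N_scale = submoduleD(4)[OF N]

sublocale Q: abelian_subgroup N M
proof (rule abelian_subgroupI3)
  show "additive_subgroup N M" using N by (simp add: additive_subgroup_def submodule_def)
qed (rule M.abelian_group_axioms)

lemma mem_coset: "y \<in> N +> x \<longleftrightarrow> (\<exists>n\<in>N. y = n \<oplus> x)"
  by (auto simp: a_r_coset_def')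

lemma coset_absorb: "n \<in> N \<Longrightarrow> x \<in> carrier M \<Longrightarrow> N +> (n \<oplus> x) = N +> x"
  using Q.a_repr_independence'[of "n \<oplus> x" x] mem_coset by blast

lemma coset_eqD: "x \<in> carrier M \<Longrightarrow> N +> x = N +> y \<Longrightarrow> \<exists>n\<in>N. x = n \<oplus> y"
  using Q.a_rcos_self[of x] mem_coset by blast

lemma coset_N: "N +> \<zero> = N"
  by (auto simp: a_r_coset_def' N_closed)

lemma coset_mem: "n \<in> N \<Longrightarrow> N +> n = N"
  using coset_absorb[of n \<zero>] coset_N N_closed by simp

lemma coset_add: "x \<in> carrier M \<Longrightarrow> y \<in> carrier M \<Longrightarrow> (N +> x) \<oplus>\<^bsub>quot M N\<^esub> (N +> y) = N +> (x \<oplus> y)"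
  using Q.a_rcos_sum by (simp add: quot_def)

lemma quot_carrier: "carrier (quot M N) = (\<lambda>x. N +> x) ` carrier M"
  by (auto simp: quot_def A_RCOSETS_def RCOSETS_def a_r_coset_def)

lemma coset_closed: "x \<in> carrier M \<Longrightarrow> N +> x \<in> carrier (quot M N)"
  by (simp add: quot_carrier)

lemma quot_zero: "\<zero>\<^bsub>quot M N\<^esub> = N" by (simp add: quot_def)

lemma induced_coset:
  assumes "module cfield M'" "submodule N' cfield M'" "x \<in> carrier M"
    and phi: "\<And>x. x \<in> carrier M \<Longrightarrow> phi x \<in> carrier M'" "\<And>n. n \<in> N \<Longrightarrow> phi n \<in> N'"
     "\<And>x y. x \<in> carrier M \<Longrightarrow> y \<in> carrier M \<Longrightarrow> phi (x \<oplus> y) = phi x \<oplus>\<^bsub>M'\<^esub> phi y"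
  shows "induced M' N' phi (N +> x) = N' +>\<^bsub>M'\<^esub> phi x"
proof -
  interpret B: subspace_quotient M' N' using assms(1,2) by (intro subspace_quotient.intro complex_moduleI subspace_quotient_axioms.intro)
  have "N' +>\<^bsub>M'\<^esub> phi y = N' +>\<^bsub>M'\<^esub> phi x" if "y \<in> N +> x" for y
    using that B.coset_absorb phi assms(3) N_closed by (auto simp: mem_coset)
  moreover have "x \<in> N +> x" using Q.a_rcos_self assms(3) by blast
  ultimately show ?thesis unfolding induced_def by blast
qed

lemma coset_smult: assumes "x \<in> carrier M" shows "c \<odot>\<^bsub>quot M N\<^esub> (N +> x) = N +> (c \<odot> x)"
  unfolding quot_def module.simps
  by (rule induced_coset) (use N N_scale assms sm_add_right in \<open>auto intro: module_axioms\<close>)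

lemma quot_zero': "\<zero>\<^bsub>quot M N\<^esub> = N +> \<zero>" by (simp add: quot_zero coset_N)

lemma quot_module: "module cfield (quot M N)"
proof (rule cmoduleI)
  show "\<zero>\<^bsub>quot M N\<^esub> \<in> carrier (quot M N)" by (simp add: quot_zero' coset_closed)
qed (auto simp: quot_carrier coset_add coset_smult quot_zero' sm_add_left sm_add_right sm_assoc M.a_ac
      sm_neg1 M.l_neg M.r_neg)

lemma quot_lift:
  assumes "module_map M sc f" and kill: "\<And>n. n \<in> N \<Longrightarrow> f n = 0"
  obtains g where "module_map (quot M N) sc g" "\<And>x. x \<in> carrier M \<Longrightarrow> g (N +> x) = f x"
proof -
  interpret f: module_map M sc f by fact
  define g where "g = (\<lambda>X. f (SOME x. x \<in> carrier M \<and> X = N +> x))"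
  have g: "g (N +> x) = f x" if x: "x \<in> carrier M" for x
  proof -
    have "(SOME y. y \<in> carrier M \<and> N +> x = N +> y) \<in> carrier M \<and> N +> x = N +> (SOME y. y \<in> carrier M \<and> N +> x = N +> y)"
      by (rule someI[of _ x]) (use x in auto)
    then obtain y where y: "y \<in> carrier M" "N +> x = N +> y" "g (N +> x) = f y" unfolding g_def by blast
    from coset_eqD[OF x y(2)] obtain n where "n \<in> N" "x = n \<oplus> y" by blast
    then show ?thesis using y kill N_closed by (simp add: f.f_add)
  qed
  have "module_map (quot M N) sc g"
  proof (intro module_map.intro complex_moduleI quot_module f.complex_space_axioms module_map_axioms.intro)
    fix x y assume "x \<in> carrier (quot M N)" "y \<in> carrier (quot M N)"
    then show "g (x \<oplus>\<^bsub>quot M N\<^esub> y) = g x + g y" by (auto simp: quot_carrier coset_add g f.f_add)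
  next
    fix x c assume "x \<in> carrier (quot M N)"
    then show "g (c \<odot>\<^bsub>quot M N\<^esub> x) = sc c (g x)" by (auto simp: quot_carrier coset_smult g f.f_scale)
  qed
  then show ?thesis using that g by blast
qed

end

lemma subspace_quotientI: "module cfield M \<Longrightarrow> submodule N cfield M \<Longrightarrow> subspace_quotient M N"
  by (intro subspace_quotient.intro complex_moduleI subspace_quotient_axioms.intro)

section \<open>Spans and free spaces\<close>

lemma (in complex_module) lin_span_submodule: assumes "X \<subseteq> carrier M" shows "submodule (lin_span M X) cfield M"
proof (rule submoduleI')
  have c: "submodule (carrier M) cfield M" by (rule carrier_is_submodule)
  show "lin_span M X \<subseteq> carrier M" unfolding lin_span_def by (rule hull_minimal) (use assms c in auto)
  show "\<zero> \<in> lin_span M X"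
    unfolding lin_span_def hull_def by (auto intro: submoduleD(2))
  show "x \<oplus> y \<in> lin_span M X" if "x \<in> lin_span M X" "y \<in> lin_span M X" for x y
    using that unfolding lin_span_def hull_def by (auto intro!: submoduleD(3))
  show "c \<odot> x \<in> lin_span M X" if "x \<in> lin_span M X" for c x
    using that unfolding lin_span_def hull_def by (auto intro!: submoduleD(4))
qed

lemma lin_span_superset: "X \<subseteq> lin_span M X"
  unfolding lin_span_def by (rule hull_subset)

lemma lin_span_minimal: "X \<subseteq> H \<Longrightarrow> submodule H cfield M \<Longrightarrow> lin_span M X \<subseteq> H"
  unfolding lin_span_def by (rule hull_minimal)

lemma free_space_simps [simp]: "carrier (free_space X) = {f. Poly_Mapping.keys f \<subseteq> X}"
  "add (free_space X) = (+)" "zero (free_space X) = 0" "smult (free_space X) = psc"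
  by (simp_all add: free_space_def psc_def fun_eq_iff)

lemma free_space_module: "module cfield (free_space X)"
proof -
  interpret P: complex_space psc by (rule cvs_psc)
  show ?thesis
    by (rule cmoduleI)
      (auto simp: P.scale_left_distrib P.scale_right_distrib add_ac dest!: subsetD[OF keys_add] subsetD[OF keys_psc])
qed

lemma (in complex_space) lext_mlin: "module_map (free_space X) sc (lext f)"
  by (intro module_map.intro complex_moduleI free_space_module complex_space_axioms module_map_axioms.intro) (simp_all add: lext_add lext_scale)

lemma lin_ext_conv: "lin_ext phi = complex_space.lext psc (\<lambda>x. Poly_Mapping.single (phi x) 1)"
proof -
  interpret P: complex_space psc by (rule cvs_psc)
  show ?thesis by (intro ext) (simp add: lin_ext_def P.lext_def psc_single)
qed

lemma (in module_map) kernel_submodule: "submodule {x \<in> carrier M. f x = 0} cfield M"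
  by (rule submoduleI') (auto simp: f_add f_scale)

section \<open>Enveloping algebras and induced modules\<close>

subsection \<open>Free algebras\<close>

text \<open>Written as a bilinear extension, to make linear induction available for both factors.\<close>

definition fmul :: "('x list \<Rightarrow>\<^sub>0 complex) \<Rightarrow> ('x list \<Rightarrow>\<^sub>0 complex) \<Rightarrow> ('x list \<Rightarrow>\<^sub>0 complex)" where
  "fmul f g = complex_space.lext psc (\<lambda>u. complex_space.lext psc (\<lambda>v. Poly_Mapping.single (u @ v) 1) g) f"

lemma cfield_smult: "smult cfield = (*)"
  by (simp add: cfield_def)

context complex_space
begin

lemma lext_fun_add: "lext (\<lambda>x. f x + g x) p = lext f p + lext g p"
  by (simp add: lext_def scale_right_distrib sum.distrib)

lemma lext_fun_scale: "lext (\<lambda>x. sc c (f x)) p = sc c (lext f p)"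
  by (simp add: lext_def scale_sum_right mult.commute)

end

lemma keys_add_subset: "Poly_Mapping.keys f \<subseteq> X \<Longrightarrow> Poly_Mapping.keys g \<subseteq> X \<Longrightarrow> Poly_Mapping.keys (f + g) \<subseteq> X"
  using keys_add[of f g] by blast

lemma keys_psc_subset: "Poly_Mapping.keys f \<subseteq> X \<Longrightarrow> Poly_Mapping.keys (psc c f) \<subseteq> X"
  using keys_psc[of c f] by blast

interpretation PM: complex_space psc by (rule cvs_psc)

lemma fmul_add_left: "fmul (f + f') g = fmul f g + fmul f' g"
  by (simp add: fmul_def PM.lext_add)

lemma fmul_diff_left: "fmul (f - f') g = fmul f g - fmul f' g"
  by (simp add: fmul_def PM.lext_diff)

lemma fmul_add_right: "fmul f (g + g') = fmul f g + fmul f g'"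
  by (simp add: fmul_def PM.lext_add PM.lext_fun_add)

lemma fmul_scale_left: "fmul (psc c f) g = psc c (fmul f g)"
  by (simp add: fmul_def PM.lext_scale)

lemma fmul_scale_right: "fmul f (psc c g) = psc c (fmul f g)"
  by (simp add: fmul_def PM.lext_scale PM.lext_fun_scale)

lemma fmul_0 [simp]: "fmul 0 g = 0" "fmul f 0 = 0"
  by (simp_all add: fmul_def PM.lext_def)

lemma fmul_diff_right: "fmul f (g - g') = fmul f g - fmul f g'"
  using fmul_add_right[of f "g - g'" g'] by (simp add: eq_diff_eq)

lemma fmul_single: "fmul (Poly_Mapping.single u a) (Poly_Mapping.single v b) = Poly_Mapping.single (u @ v) (a * b)"
  by (simp add: fmul_def PM.lext_single psc_single)

lemma fmul_keys:
  assumes "Poly_Mapping.keys f \<subseteq> lists X" "Poly_Mapping.keys g \<subseteq> lists X"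
  shows "Poly_Mapping.keys (fmul f g) \<subseteq> lists X"
  using assms(1)
proof (induction f rule: poly_mapping_lin_induct)
  case (add p q)
  then show ?case by (auto simp: fmul_add_left dest!: subsetD[OF keys_add])
next
  case (single u c)
  show ?case using assms(2)
  proof (induction g rule: poly_mapping_lin_induct)
    case (add p q)
    then show ?case by (auto simp: fmul_add_right dest!: subsetD[OF keys_add])
  next
    case (single v d)
    then show ?case using \<open>u \<in> lists X\<close> by (auto simp: fmul_single split: if_splits)
  qed simp
qed simp

lemma fmul_assoc: "fmul (fmul f g) h = fmul f (fmul g h)"
proof -
  have "Poly_Mapping.keys f \<subseteq> UNIV" by simp
  then show ?thesis
  proof (induction f rule: poly_mapping_lin_induct)
    case (single u c)
    have "Poly_Mapping.keys g \<subseteq> UNIV" by simp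
    then show ?case
    proof (induction g rule: poly_mapping_lin_induct)
      case (single v d)
      have "Poly_Mapping.keys h \<subseteq> UNIV" by simp
      then show ?case
        by (induction h rule: poly_mapping_lin_induct) (simp_all add: fmul_single fmul_add_right mult.assoc)
    qed (simp_all add: fmul_add_left fmul_add_right)
  qed (simp_all add: fmul_add_left)
qed

lemma fmul_one: "fmul (word []) f = f" "fmul f (word []) = f"
proof -
  have f: "Poly_Mapping.keys f \<subseteq> UNIV" by simp
  show "fmul (word []) f = f"
    using f by (induction f rule: poly_mapping_lin_induct) (simp_all add: word_def fmul_add_right fmul_single)
  show "fmul f (word []) = f"
    using f by (induction f rule: poly_mapping_lin_induct) (simp_all add: word_def fmul_add_left fmul_single)
qed

lemma fmul_word: "fmul (word u) (word v) = word (u @ v)"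
  by (simp add: word_def fmul_single)

lemma free_algebra_simps [simp]:
  "carrier (free_algebra X) = {f. Poly_Mapping.keys f \<subseteq> lists X}"
  "add (free_algebra X) = (+)" "zero (free_algebra X) = 0" "smult (free_algebra X) = psc"
  "one (free_algebra X) = word []" "mult (free_algebra X) = fmul"
proof -
  show "mult (free_algebra X) = fmul"
    by (intro ext)
     (simp add: free_algebra_def fmul_def PM.lext_def PM.scale_sum_right psc_single)
qed (simp_all add: free_algebra_def free_space_def psc_def word_def fun_eq_iff)

lemma word_keys [simp]: "Poly_Mapping.keys (word w) = {w}"
  by (simp add: word_def)

lemma free_algebra_module: "module cfield (free_algebra X)"
proof -

  show ?thesis
    by (rule cmoduleI)
      (auto simp: PM.scale_left_distrib PM.scale_right_distrib add_ac dest!: subsetD[OF keys_add] subsetD[OF keys_psc])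
qed

lemma free_algebra_ring: "ring (free_algebra X)"
proof (rule ringI)
  interpret module cfield "free_algebra X" by (rule free_algebra_module)
  show "abelian_group (free_algebra X)" by (rule M.abelian_group_axioms)
  show "monoid (free_algebra X)"
    by (rule monoidI) (simp_all add: fmul_assoc fmul_one fmul_keys)
qed (auto simp: fmul_add_left fmul_add_right)

lemma ideal_submodule:
  assumes "ideal I (free_algebra X)" shows "submodule I cfield (free_algebra X)"
proof -
  interpret I: ideal I "free_algebra X" by fact
  interpret complex_module "free_algebra X" by (rule complex_moduleI) (rule free_algebra_module)
  show ?thesis
  proof (rule submoduleI')
    fix c f assume f: "f \<in> I"
    have "psc c f = fmul (Poly_Mapping.single [] c) f"
      using fmul_scale_left[of c "word []" f] by (simp add: word_def psc_single fmul_one[unfolded word_def])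
    then show "c \<odot>\<^bsub>free_algebra X\<^esub> f \<in> I"
      using I.I_l_closed[OF f, of "Poly_Mapping.single [] c"] by (auto split: if_splits)
  qed (use I.a_subset additive_subgroup.zero_closed[OF I.is_additive_subgroup]
      additive_subgroup.a_closed[OF I.is_additive_subgroup] in simp_all)
qed

lemma free_ideal_induct:
  assumes rel: "R \<subseteq> carrier (free_algebra X)" and f: "f \<in> Idl\<^bsub>free_algebra X\<^esub> R"
    and "R \<subseteq> J" "J \<subseteq> carrier (free_algebra X)" "0 \<in> J" "\<And>f g. f \<in> J \<Longrightarrow> g \<in> J \<Longrightarrow> f + g \<in> J" "\<And>c f. f \<in> J \<Longrightarrow> psc c f \<in> J"
    "\<And>f g. f \<in> J \<Longrightarrow> Poly_Mapping.keys g \<subseteq> lists X \<Longrightarrow> fmul f g \<in> J"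
    "\<And>f g. f \<in> J \<Longrightarrow> Poly_Mapping.keys g \<subseteq> lists X \<Longrightarrow> fmul g f \<in> J"
  shows "f \<in> J"
proof -
  interpret complex_module "free_algebra X" by (rule complex_moduleI) (rule free_algebra_module)
  have "submodule J cfield (free_algebra X)"
    by (rule submoduleI') (use assms in auto)
  then have "ideal J (free_algebra X)"
    by (intro idealI free_algebra_ring) (use assms in \<open>simp_all add: submodule_def\<close>)
  then show ?thesis using ring.genideal_minimal[OF free_algebra_ring _ assms(3)] f by blast
qed

subsection \<open>The enveloping algebra of a pair\<close>

text \<open>Enveloping algebras and induced modules are defined from an arbitrary bracket, and a pair is a space with
  a bracket together with a subspace that is closed under it.\<close>

locale lie_pair = complex_module L for L :: "(complex, 'x) module" (structure) +
  fixes H :: "'x set"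
  assumes br: "x \<in> carrier L \<Longrightarrow> y \<in> carrier L \<Longrightarrow> x \<otimes> y \<in> carrier L"
    and H: "submodule H cfield L"
    and Hbr: "x \<in> H \<Longrightarrow> y \<in> H \<Longrightarrow> x \<otimes> y \<in> H"
begin

abbreviation "K \<equiv> L\<lparr>carrier := H\<rparr>"

definition "FL = {f :: 'x list \<Rightarrow>\<^sub>0 complex. Poly_Mapping.keys f \<subseteq> lists (carrier L)}"
definition "FK = {f :: 'x list \<Rightarrow>\<^sub>0 complex. Poly_Mapping.keys f \<subseteq> lists H}"
abbreviation "A \<equiv> free_algebra (carrier L)"

lemma HL: "H \<subseteq> carrier L" using submoduleD[OF H] by blast

lemma FK_FL: "FK \<subseteq> FL" unfolding FK_def FL_def using HL lists_mono by fastforce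

lemma FL_intros [simp, intro]:
  "f \<in> FL \<Longrightarrow> g \<in> FL \<Longrightarrow> f + g \<in> FL" "f \<in> FL \<Longrightarrow> g \<in> FL \<Longrightarrow> f - g \<in> FL" "f \<in> FL \<Longrightarrow> psc c f \<in> FL"
  "f \<in> FL \<Longrightarrow> g \<in> FL \<Longrightarrow> fmul f g \<in> FL" "0 \<in> FL" "x \<in> carrier L \<Longrightarrow> word [x] \<in> FL" "word [] \<in> FL"
  "x \<in> carrier L \<Longrightarrow> y \<in> carrier L \<Longrightarrow> word [x, y] \<in> FL"
proof -
  have d: "f - g = f + psc (-1) g" for f g :: "'x list \<Rightarrow>\<^sub>0 complex" by simp
  have 1: "f + g \<in> FL" if "f \<in> FL" "g \<in> FL" for f g using that by (auto simp: FL_def dest!: subsetD[OF keys_add])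
  have 2: "psc c f \<in> FL" if "f \<in> FL" for f c using that by (auto simp: FL_def dest!: subsetD[OF keys_psc])
  show "f \<in> FL \<Longrightarrow> g \<in> FL \<Longrightarrow> f - g \<in> FL" unfolding d using 1 2 by blast
  show "f \<in> FL \<Longrightarrow> g \<in> FL \<Longrightarrow> f + g \<in> FL" "f \<in> FL \<Longrightarrow> psc c f \<in> FL" using 1 2 by auto
  show "f \<in> FL \<Longrightarrow> g \<in> FL \<Longrightarrow> fmul f g \<in> FL" using fmul_keys unfolding FL_def by blast
qed (auto simp: FL_def)

lemma FK_intros: "x \<in> H \<Longrightarrow> word [x] \<in> FK" by (simp add: FK_def)

lemma relations_FL: "env_relations L \<subseteq> carrier A"
proof -
  have "env_relations L \<subseteq> FL"
    unfolding env_relations_def psc_def[symmetric] using br by (auto intro!: FL_intros)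
  then show ?thesis by (simp add: FL_def)
qed

lemma relations_FK: "env_relations K \<subseteq> carrier (free_algebra H)"
proof -
  have K: "module cfield K" using H by (rule submodule.submodule_is_module) (rule module_axioms)
  interpret K: lie_pair K H
  proof (intro lie_pair.intro complex_moduleI K lie_pair_axioms.intro)
    interpret Km: complex_module K by (rule complex_moduleI) (rule K)
    show "submodule H cfield K" using Km.carrier_is_submodule by simp
  qed (use Hbr in auto)
  show ?thesis using K.relations_FL by simp
qed

definition "I = env_ideal L"

lemma ideal_I: "ideal I A"
  unfolding I_def env_ideal_def by (rule ring.genideal_ideal[OF free_algebra_ring relations_FL])

lemma ideal_IK: "ideal (env_ideal K) (free_algebra H)"
  unfolding env_ideal_def using ring.genideal_ideal[OF free_algebra_ring relations_FK] by simp

lemma relations_I: "env_relations L \<subseteq> I"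
  unfolding I_def env_ideal_def by (rule ring.genideal_self[OF free_algebra_ring relations_FL])

lemma relations_K_L: "env_relations K \<subseteq> env_relations L"
  unfolding env_relations_def by (intro Un_mono; simp; use HL in blast)

sublocale AI: subspace_quotient A I
  by (intro subspace_quotientI free_algebra_module ideal_submodule ideal_I)

lemma carrier_A: "carrier A = FL" by (simp add: FL_def)

lemma I_zero: "0 \<in> I" using AI.N_zero by simp
lemma I_add: "f \<in> I \<Longrightarrow> g \<in> I \<Longrightarrow> f + g \<in> I" using AI.N_add[of f g] by simp
lemma I_scale: "f \<in> I \<Longrightarrow> psc c f \<in> I" using AI.N_scale[of f c] by simp
lemma I_left: "f \<in> I \<Longrightarrow> g \<in> FL \<Longrightarrow> fmul g f \<in> I"
  using ideal.I_l_closed[OF ideal_I, of f g] by (simp add: carrier_A[symmetric])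
lemma I_right: "f \<in> I \<Longrightarrow> g \<in> FL \<Longrightarrow> fmul f g \<in> I"
  using ideal.I_r_closed[OF ideal_I, of f g] by (simp add: carrier_A[symmetric])
lemma I_lin: "x \<in> carrier L \<Longrightarrow> y \<in> carrier L \<Longrightarrow> word [x \<oplus> y] - word [x] - word [y] \<in> I"
  "x \<in> carrier L \<Longrightarrow> word [c \<odot> x] - psc c (word [x]) \<in> I"
  "x \<in> carrier L \<Longrightarrow> y \<in> carrier L \<Longrightarrow> word [x, y] - word [y, x] - word [x \<otimes> y] \<in> I"
proof -
  note r = relations_I[unfolded env_relations_def psc_def[symmetric] Un_subset_iff]
  show "x \<in> carrier L \<Longrightarrow> y \<in> carrier L \<Longrightarrow> word [x \<oplus> y] - word [x] - word [y] \<in> I"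
    by (rule subsetD[OF r[THEN conjunct1, THEN conjunct1]]) (intro CollectI, blast)
  show "x \<in> carrier L \<Longrightarrow> word [c \<odot> x] - psc c (word [x]) \<in> I"
    by (rule subsetD[OF r[THEN conjunct1, THEN conjunct2]]) (intro CollectI, blast)
  show "x \<in> carrier L \<Longrightarrow> y \<in> carrier L \<Longrightarrow> word [x, y] - word [y, x] - word [x \<otimes> y] \<in> I"
    by (rule subsetD[OF r[THEN conjunct2]]) (intro CollectI, blast)
qed

lemma I_zero_word: "word [\<zero>] \<in> I"
proof -
  have "psc 0 (word [\<zero>]) = (0 :: 'x list \<Rightarrow>\<^sub>0 complex)" by (rule poly_mapping_eqI) simp
  then show ?thesis using I_lin(2)[of \<zero> 0] by simp
qed

definition "e f = I +>\<^bsub>A\<^esub> f"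

lemma env_carrier: "carrier (env L) = e ` FL"
  using AI.quot_carrier by (simp add: env_def I_def e_def FL_def)

lemma env_gen_e: "env_gen L x = e (word [x])" by (simp add: env_gen_def e_def I_def)

lemma e_closed: "f \<in> FL \<Longrightarrow> e f \<in> carrier (env L)" by (simp add: env_carrier)

lemma e_add: "f \<in> FL \<Longrightarrow> g \<in> FL \<Longrightarrow> e f \<oplus>\<^bsub>env L\<^esub> e g = e (f + g)"
  using AI.coset_add[of f g] by (simp add: env_def I_def e_def FL_def)

lemma e_scale: "f \<in> FL \<Longrightarrow> c \<odot>\<^bsub>env L\<^esub> e f = e (psc c f)"
  using AI.coset_smult[of f c] by (simp add: env_def I_def e_def FL_def)

lemma e_one: "\<one>\<^bsub>env L\<^esub> = e (word [])"
  by (simp add: env_def quot_def I_def e_def)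

lemma e_mult: "f \<in> FL \<Longrightarrow> g \<in> FL \<Longrightarrow> e f \<otimes>\<^bsub>env L\<^esub> e g = e (fmul f g)"
  using ideal.rcoset_mult_add[OF ideal_I, of f g] by (simp add: env_def quot_def I_def e_def FL_def)

lemma e_eqI: "f \<in> FL \<Longrightarrow> g \<in> FL \<Longrightarrow> f - g \<in> I \<Longrightarrow> e f = e g"
  using AI.coset_absorb[of "f - g" g] by (simp add: e_def FL_def)

subsection \<open>The enveloping algebra of the subalgebra\<close>

definition "eK f = env_ideal K +>\<^bsub>free_algebra H\<^esub> f"

lemma envK_carrier: "carrier (env K) = eK ` FK"
proof -
  interpret KI: subspace_quotient "free_algebra H" "env_ideal K"
    by (intro subspace_quotientI free_algebra_module ideal_submodule ideal_IK)
  show ?thesis using KI.quot_carrier by (simp add: env_def eK_def FK_def)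
qed

lemma IK_I: "env_ideal K \<subseteq> I"
proof
  fix f assume f: "f \<in> env_ideal K"
  have "f \<in> I \<inter> FK"
  proof (rule free_ideal_induct[OF relations_FK, of f])
    show "f \<in> Idl\<^bsub>free_algebra H\<^esub> env_relations K" using f by (simp add: env_ideal_def)
    show "env_relations K \<subseteq> I \<inter> FK" using relations_K_L relations_I relations_FK by (auto simp: FK_def)
    show "fmul f g \<in> I \<inter> FK" "fmul g f \<in> I \<inter> FK" if "f \<in> I \<inter> FK" "Poly_Mapping.keys g \<subseteq> lists H" for f g
    proof -
      have "g \<in> FK" using that by (simp add: FK_def)
      moreover from this have "g \<in> FL" using FK_FL by blast
      ultimately show "fmul f g \<in> I \<inter> FK" "fmul g f \<in> I \<inter> FK" using that I_left I_right
        by (simp_all add: FK_def fmul_keys)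
    qed
  qed (simp_all add: I_zero I_add I_scale FK_def keys_add_subset keys_psc_subset)
  then show "f \<in> I" by blast
qed

text \<open>The relations have no constant term, and taking constant terms is multiplicative.  So the augmentation is
  well defined on the quotient.\<close>

lemma IK_aug: "f \<in> env_ideal K \<Longrightarrow> Poly_Mapping.lookup f [] = 0"
proof -
  assume f: "f \<in> env_ideal K"
  let ?J = "{f \<in> FK. Poly_Mapping.lookup f [] = 0}"
  have mul: "Poly_Mapping.lookup (fmul f g) [] = Poly_Mapping.lookup f [] * Poly_Mapping.lookup g []" for f g :: "'x list \<Rightarrow>\<^sub>0 complex"
  proof -
    have "Poly_Mapping.keys f \<subseteq> UNIV" by simp
    then show ?thesis
    proof (induction f rule: poly_mapping_lin_induct)
      case (single u c)
      have "Poly_Mapping.keys g \<subseteq> UNIV" by simp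
      then show ?case
        by (induction g rule: poly_mapping_lin_induct)
          (simp_all add: fmul_single fmul_add_right lookup_add lookup_single when_def algebra_simps)
    qed (simp_all add: fmul_add_left lookup_add algebra_simps)
  qed
  have "f \<in> ?J"
  proof (rule free_ideal_induct[OF relations_FK, of f])
    show "f \<in> Idl\<^bsub>free_algebra H\<^esub> env_relations K" using f by (simp add: env_ideal_def)
    have "\<forall>f\<in>env_relations K. Poly_Mapping.lookup f [] = 0"
      by (auto simp: env_relations_def psc_def[symmetric] word_def lookup_minus lookup_single)
    then show "env_relations K \<subseteq> ?J" using relations_FK unfolding FK_def free_algebra_simps by blast
    show "?J \<subseteq> carrier (free_algebra H)" by (auto simp only: FK_def free_algebra_simps)
  qed (simp_all add: FK_def lookup_add mul keys_add_subset keys_psc_subset fmul_keys)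
  then show ?thesis by blast
qed

lemma env_incl_eK: assumes "f \<in> FK" shows "env_incl L (eK f) = e f"
proof -
  interpret KI: subspace_quotient "free_algebra H" "env_ideal K"
    by (intro subspace_quotientI free_algebra_module ideal_submodule ideal_IK)
  have "f \<in> FL" using assms FK_FL by blast
  have "induced A I (\<lambda>f. f) (env_ideal K +>\<^bsub>free_algebra H\<^esub> f) = I +>\<^bsub>A\<^esub> f"
  proof (rule KI.induced_coset)
    show "submodule I cfield A" using ideal_submodule ideal_I by blast
    show "f \<in> carrier (free_algebra H)" using assms by (simp add: FK_def)
    show "x \<in> carrier A" if "x \<in> carrier (free_algebra H)" for x
      using that FK_FL carrier_A by (auto simp only: free_algebra_simps FK_def)
    show "n \<in> I" if "n \<in> env_ideal K" for n using that IK_I by blast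
  qed (simp_all add: free_algebra_module)
  then show ?thesis by (simp add: env_incl_def eK_def e_def I_def)
qed

lemma env_aug_eK: assumes "f \<in> FK" shows "env_aug (eK f) = Poly_Mapping.lookup f []"
proof -
  interpret KI: subspace_quotient "free_algebra H" "env_ideal K"
    by (intro subspace_quotientI free_algebra_module ideal_submodule ideal_IK)
  have "(\<lambda>f. Poly_Mapping.lookup f []) ` eK f = {Poly_Mapping.lookup f []}"
  proof -
    have "f \<in> eK f" using KI.Q.a_rcos_self[of f] assms by (simp add: eK_def FK_def)
    moreover have "Poly_Mapping.lookup g [] = Poly_Mapping.lookup f []" if "g \<in> eK f" for g
      using that IK_aug unfolding eK_def by (auto simp: KI.mem_coset lookup_add)
    ultimately show ?thesis by blast
  qed
  then show ?thesis by (simp add: env_aug_def)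
qed

subsection \<open>The induced module\<close>

definition "T = free_space (carrier (env L) \<times> (UNIV :: complex set))"
definition "NT = ind_null L K"
definition "IM = ind_module L K"

abbreviation sing :: "'x env_elem \<Rightarrow> complex \<Rightarrow> ('x env_elem \<times> complex) \<Rightarrow>\<^sub>0 complex" where
  "sing u z \<equiv> Poly_Mapping.single (u, z) 1"

lemma T_simps: "carrier T = {p. Poly_Mapping.keys p \<subseteq> carrier (env L) \<times> UNIV}" "add T = (+)" "zero T = 0" "smult T = psc"
  by (simp_all add: T_def)

definition "RT = tensor_relations (carrier (env K)) (env L) (\<lambda>u r. u \<otimes>\<^bsub>env L\<^esub> env_incl L r)
     cfield (\<lambda>r z. env_aug r * z)"

lemma NT_def': "NT = lin_span T RT"
  by (simp add: NT_def ind_null_def tensor_null_def RT_def T_def)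

lemma IM_def': "IM = quot T NT"
  by (simp add: IM_def ind_module_def tensor_def NT_def ind_null_def T_def)

text \<open>The tensor relations in terms of representatives.\<close>

lemma RT_cases:
  "RT = {sing (e (f + g)) z - sing (e f) z - sing (e g) z | f g z. f \<in> FL \<and> g \<in> FL} \<union>
    {sing (e f) (z + z') - sing (e f) z - sing (e f) z' | f z z'. f \<in> FL} \<union>
    {sing (e (psc c f)) z - psc c (sing (e f) z) | c f z. f \<in> FL} \<union>
    {sing (e f) (c * z) - psc c (sing (e f) z) | c f z. f \<in> FL} \<union>
    {sing (e (fmul f g)) z - sing (e f) (Poly_Mapping.lookup g [] * z) | f g z. f \<in> FL \<and> g \<in> FK}" (is "_ = ?R")
proof -
  have 1: "{sing (m \<oplus>\<^bsub>env L\<^esub> m') n - sing m n - sing m' n |m m' n. m \<in> carrier (env L) \<and> m' \<in> carrier (env L) \<and> n \<in> carrier cfield}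
    = {sing (e (f + g)) z - sing (e f) z - sing (e g) z | f g z. f \<in> FL \<and> g \<in> FL}"
  proof -
    have "{F m m' n |m m' n. m \<in> e ` FL \<and> m' \<in> e ` FL \<and> n \<in> carrier cfield} = {F (e f) (e g) n |f g n. f \<in> FL \<and> g \<in> FL}" for F :: "_ \<Rightarrow> _ \<Rightarrow> complex \<Rightarrow> (('x env_elem \<times> complex) \<Rightarrow>\<^sub>0 complex)"
      unfolding cfield_simps by blast
    note this[of "\<lambda>m m' n. sing (m \<oplus>\<^bsub>env L\<^esub> m') n - sing m n - sing m' n"]
    also have "{sing (e f \<oplus>\<^bsub>env L\<^esub> e g) n - sing (e f) n - sing (e g) n |f g n. f \<in> FL \<and> g \<in> FL} =
       {sing (e (f + g)) z - sing (e f) z - sing (e g) z | f g z. f \<in> FL \<and> g \<in> FL}"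
      by (intro Collect_cong ex_cong1) (auto simp: e_add)
    finally show ?thesis unfolding env_carrier .
  qed
  have 3: "{sing (c \<odot>\<^bsub>env L\<^esub> m) n - psc c (sing m n) |c m n. m \<in> carrier (env L) \<and> n \<in> carrier cfield}
    = {sing (e (psc c f)) z - psc c (sing (e f) z) | c f z. f \<in> FL}"
  proof -
    have "{F c m n |c m n. m \<in> e ` FL \<and> n \<in> carrier cfield} = {F c (e f) n |c f n. f \<in> FL}" for F :: "complex \<Rightarrow> _ \<Rightarrow> complex \<Rightarrow> (('x env_elem \<times> complex) \<Rightarrow>\<^sub>0 complex)"
      unfolding cfield_simps by blast
    note this[of "\<lambda>c m n. sing (c \<odot>\<^bsub>env L\<^esub> m) n - psc c (sing m n)"]
    also have "{sing (c \<odot>\<^bsub>env L\<^esub> e f) n - psc c (sing (e f) n) |c f n. f \<in> FL} =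
       {sing (e (psc c f)) z - psc c (sing (e f) z) | c f z. f \<in> FL}"
      by (intro Collect_cong ex_cong1) (auto simp: e_scale)
    finally show ?thesis unfolding env_carrier .
  qed
  have 5: "{sing (m \<otimes>\<^bsub>env L\<^esub> env_incl L r) n - sing m (env_aug r * n) |m r n. m \<in> carrier (env L) \<and> r \<in> carrier (env K) \<and> n \<in> carrier cfield}
    = {sing (e (fmul f g)) z - sing (e f) (Poly_Mapping.lookup g [] * z) | f g z. f \<in> FL \<and> g \<in> FK}"
  proof -
    have "e f \<otimes>\<^bsub>env L\<^esub> env_incl L (eK g) = e (fmul f g) \<and> env_aug (eK g) = Poly_Mapping.lookup g []" if "f \<in> FL" "g \<in> FK" for f g
      using that FK_FL by (auto simp: env_incl_eK env_aug_eK e_mult)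
    note eq = this
    have "{F m r n |m r n. m \<in> e ` FL \<and> r \<in> eK ` FK \<and> n \<in> carrier cfield} = {F (e f) (eK g) n |f g n. f \<in> FL \<and> g \<in> FK}" for F :: "_ \<Rightarrow> _ \<Rightarrow> complex \<Rightarrow> (('x env_elem \<times> complex) \<Rightarrow>\<^sub>0 complex)"
      unfolding cfield_simps by blast
    note this[of "\<lambda>m r n. sing (m \<otimes>\<^bsub>env L\<^esub> env_incl L r) n - sing m (env_aug r * n)"]
    also have "{sing (e f \<otimes>\<^bsub>env L\<^esub> env_incl L (eK g)) n - sing (e f) (env_aug (eK g) * n) |f g n. f \<in> FL \<and> g \<in> FK} =
       {sing (e (fmul f g)) z - sing (e f) (Poly_Mapping.lookup g [] * z) | f g z. f \<in> FL \<and> g \<in> FK}"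
      by (intro Collect_cong ex_cong1) (auto simp: eq)
    finally show ?thesis unfolding env_carrier envK_carrier .
  qed
  have 2: "{sing m (n \<oplus>\<^bsub>cfield\<^esub> n') - sing m n - sing m n' |m n n'. m \<in> carrier (env L) \<and> n \<in> carrier cfield \<and> n' \<in> carrier cfield}
    = {sing (e f) (z + z') - sing (e f) z - sing (e f) z' | f z z'. f \<in> FL}"
    unfolding env_carrier cfield_simps by blast
  have 4: "{sing m (c \<odot>\<^bsub>cfield\<^esub> n) - psc c (sing m n) |c m n. m \<in> carrier (env L) \<and> n \<in> carrier cfield}
    = {sing (e f) (c * z) - psc c (sing (e f) z) | c f z. f \<in> FL}"
    unfolding env_carrier cfield_simps cfield_smult by blast
  show ?thesis unfolding RT_def tensor_relations_def Let_def psc_def[symmetric] 1 2 3 4 5 ..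
qed

lemma RT_FT: "RT \<subseteq> carrier T"
proof -
  have k: "Poly_Mapping.keys (sing (e f) z) \<subseteq> carrier (env L) \<times> UNIV" if "f \<in> FL" for f z
    using that by (simp add: e_closed)
  have kd: "Poly_Mapping.keys (p - q) \<subseteq> carrier (env L) \<times> UNIV"
    if "Poly_Mapping.keys p \<subseteq> carrier (env L) \<times> UNIV" "Poly_Mapping.keys q \<subseteq> carrier (env L) \<times> UNIV" for p q :: "('x env_elem \<times> complex) \<Rightarrow>\<^sub>0 complex"
    using keys_diff[of p q] that by blast
  have FK: "g \<in> FL" if "g \<in> FK" for g using that FK_FL by blast
  show ?thesis
    unfolding RT_cases T_simps
    by (intro Un_least subsetI; elim CollectE exE conjE; simp only: mem_Collect_eq; hypsubst; intro kd keys_psc_subset k;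
        simp add: FK)
qed

lemma T_module: "module cfield T" unfolding T_def by (rule free_space_module)

sublocale TM: complex_module T by (rule complex_moduleI) (rule T_module)

lemma NT_submodule: "submodule NT cfield T"
  unfolding NT_def' by (rule TM.lin_span_submodule) (rule RT_FT)

sublocale TQ: subspace_quotient T NT
  by (intro subspace_quotientI T_module NT_submodule)

lemma RT_NT: "RT \<subseteq> NT" unfolding NT_def' by (rule lin_span_superset)

lemma NT_rel:
  "f \<in> FL \<Longrightarrow> g \<in> FL \<Longrightarrow> sing (e (f + g)) z - sing (e f) z - sing (e g) z \<in> NT"
  "f \<in> FL \<Longrightarrow> sing (e f) (z + z') - sing (e f) z - sing (e f) z' \<in> NT"
  "f \<in> FL \<Longrightarrow> sing (e (psc c f)) z - psc c (sing (e f) z) \<in> NT"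
  "f \<in> FL \<Longrightarrow> sing (e f) (c * z) - psc c (sing (e f) z) \<in> NT"
  "f \<in> FL \<Longrightarrow> g \<in> FK \<Longrightarrow> sing (e (fmul f g)) z - sing (e f) (Poly_Mapping.lookup g [] * z) \<in> NT"
proof -
  note r = RT_NT[unfolded RT_cases Un_subset_iff]
  show "f \<in> FL \<Longrightarrow> g \<in> FL \<Longrightarrow> sing (e (f + g)) z - sing (e f) z - sing (e g) z \<in> NT"
    by (rule subsetD[OF r[THEN conjunct1, THEN conjunct1, THEN conjunct1, THEN conjunct1]]) (intro CollectI, blast)
  show "f \<in> FL \<Longrightarrow> sing (e f) (z + z') - sing (e f) z - sing (e f) z' \<in> NT"
    by (rule subsetD[OF r[THEN conjunct1, THEN conjunct1, THEN conjunct1, THEN conjunct2]]) (intro CollectI, blast)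
  show "f \<in> FL \<Longrightarrow> sing (e (psc c f)) z - psc c (sing (e f) z) \<in> NT"
    by (rule subsetD[OF r[THEN conjunct1, THEN conjunct1, THEN conjunct2]]) (intro CollectI, blast)
  show "f \<in> FL \<Longrightarrow> sing (e f) (c * z) - psc c (sing (e f) z) \<in> NT"
    by (rule subsetD[OF r[THEN conjunct1, THEN conjunct2]]) (intro CollectI, blast)
  show "f \<in> FL \<Longrightarrow> g \<in> FK \<Longrightarrow> sing (e (fmul f g)) z - sing (e f) (Poly_Mapping.lookup g [] * z) \<in> NT"
    by (rule subsetD[OF r[THEN conjunct2]]) (intro CollectI, blast)
qed

lemma NT_induct:
  assumes "submodule J cfield T"
    and "\<And>f g z. f \<in> FL \<Longrightarrow> g \<in> FL \<Longrightarrow> sing (e (f + g)) z - sing (e f) z - sing (e g) z \<in> J"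
    "\<And>f z z'. f \<in> FL \<Longrightarrow> sing (e f) (z + z') - sing (e f) z - sing (e f) z' \<in> J"
    "\<And>c f z. f \<in> FL \<Longrightarrow> sing (e (psc c f)) z - psc c (sing (e f) z) \<in> J"
    "\<And>c f z. f \<in> FL \<Longrightarrow> sing (e f) (c * z) - psc c (sing (e f) z) \<in> J"
    "\<And>f g z. f \<in> FL \<Longrightarrow> g \<in> FK \<Longrightarrow> sing (e (fmul f g)) z - sing (e f) (Poly_Mapping.lookup g [] * z) \<in> J"
  shows "NT \<subseteq> J"
  unfolding NT_def'
proof (rule lin_span_minimal)
  show "RT \<subseteq> J" unfolding RT_cases
    by (intro Un_least subsetI; elim CollectE exE conjE; hypsubst; intro assms; assumption)
qed (rule assms)

end

context lie_pair
begin

text \<open>The class of \<open>f \<otimes> 1\<close>.  Scalars move to the left factor, so every element of the induced module is such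
  a class (\<open>t_surj\<close>), and calculations can be made in the free algebra.\<close>

definition "t f = NT +>\<^bsub>T\<^esub> sing (e f) 1"

lemma sing_T: "f \<in> FL \<Longrightarrow> sing (e f) z \<in> carrier T"
  by (simp add: T_simps e_closed)

lemma TQ_eq: "p \<in> carrier T \<Longrightarrow> q \<in> carrier T \<Longrightarrow> p - q \<in> NT \<Longrightarrow> NT +>\<^bsub>T\<^esub> p = NT +>\<^bsub>T\<^esub> q"
  using TQ.coset_absorb[of "p - q" q] by (simp add: T_simps(2))

lemma IM_module: "module cfield IM"
  unfolding IM_def' by (rule TQ.quot_module)

sublocale IMM: complex_module IM by (rule complex_moduleI) (rule IM_module)

lemma t_closed [simp]: "f \<in> FL \<Longrightarrow> t f \<in> carrier IM"
  unfolding IM_def' t_def by (rule TQ.coset_closed) (rule sing_T)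

lemma t_add: "f \<in> FL \<Longrightarrow> g \<in> FL \<Longrightarrow> t (f + g) = t f \<oplus>\<^bsub>IM\<^esub> t g"
  unfolding IM_def' t_def
  using TQ.coset_add[OF sing_T sing_T, of f g 1 1] TM.M.a_closed[OF sing_T sing_T, of f g 1 1]
  by (subst TQ_eq[of _ "sing (e f) 1 + sing (e g) 1"]) (auto simp: sing_T T_simps(2) NT_rel(1)[simplified diff_diff_eq])

lemma t_scale: "f \<in> FL \<Longrightarrow> t (psc c f) = c \<odot>\<^bsub>IM\<^esub> t f"
  unfolding IM_def' t_def
  using TQ.coset_smult[OF sing_T, of f c 1] TM.sm_closed[OF sing_T, of f c 1]
  by (subst TQ_eq[of _ "psc c (sing (e f) 1)"]) (auto simp: sing_T T_simps(4) NT_rel(3))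

lemma t_diff: "f \<in> FL \<Longrightarrow> g \<in> FL \<Longrightarrow> t (f - g) = t f \<ominus>\<^bsub>IM\<^esub> t g"
proof -
  assume fg: "f \<in> FL" "g \<in> FL"
  have "f - g = f + psc (-1) g" by simp
  then have "t (f - g) = t f \<oplus>\<^bsub>IM\<^esub> t (psc (-1) g)" using t_add[of f "psc (-1) g"] fg FL_intros(3)[of g "-1"] by (simp only:)
  then show ?thesis using fg by (simp only: t_scale IMM.sm_neg1 t_closed IMM.M.minus_eq)
qed

lemma sing_e0: "sing (e 0) z \<in> NT"
  using NT_rel(3)[of 0 0 z] by simp

lemma t_0: "t 0 = \<zero>\<^bsub>IM\<^esub>"
  using TQ.coset_mem[OF sing_e0[of 1]] by (simp add: t_def IM_def' TQ.quot_zero)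

lemma t_eqI: "f \<in> FL \<Longrightarrow> g \<in> FL \<Longrightarrow> f - g \<in> I \<Longrightarrow> t f = t g"
  by (simp add: t_def e_eqI[of f g])

lemma coset_sing: assumes "f \<in> FL" shows "NT +>\<^bsub>T\<^esub> sing (e f) z = t (psc z f)"
proof -
  have "NT +>\<^bsub>T\<^esub> sing (e f) (z * 1) = NT +>\<^bsub>T\<^esub> psc z (sing (e f) 1)"
    by (rule TQ_eq) (use NT_rel(4)[OF assms, of z 1] sing_T[OF assms] TM.sm_closed[OF sing_T[OF assms], of z 1] in \<open>simp_all add: T_simps(4)\<close>)
  also have "\<dots> = z \<odot>\<^bsub>IM\<^esub> t f"
    using TQ.coset_smult[OF sing_T[OF assms], of z 1] by (simp add: IM_def' t_def T_simps(4))
  finally show ?thesis using assms by (simp add: t_scale)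
qed

lemma t_surj: "carrier IM = t ` FL"
proof
  show "t ` FL \<subseteq> carrier IM" using t_closed by blast
  have "NT +>\<^bsub>T\<^esub> p \<in> t ` FL" if "Poly_Mapping.keys p \<subseteq> carrier (env L) \<times> UNIV" for p
    using that
  proof (induction p rule: poly_mapping_lin_induct)
    case zero
    have "NT +>\<^bsub>T\<^esub> 0 = t 0" using t_0 TQ.coset_N by (simp add: T_simps(3) IM_def' TQ.quot_zero)
    then show ?case by blast
  next
    case (add p q)
    then obtain f g where fg: "f \<in> FL" "NT +>\<^bsub>T\<^esub> p = t f" "g \<in> FL" "NT +>\<^bsub>T\<^esub> q = t g" by blast
    have "NT +>\<^bsub>T\<^esub> (p + q) = t (f + g)"
      using TQ.coset_add[of p q] add fg by (simp add: T_simps t_add) (simp add: IM_def')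
    then show ?case using fg by blast
  next
    case (single x c)
    then obtain f z where x: "x = (e f, z)" "f \<in> FL" by (auto simp: env_carrier)
    have "NT +>\<^bsub>T\<^esub> Poly_Mapping.single x c = NT +>\<^bsub>T\<^esub> psc c (sing (e f) z)" by (simp add: x psc_single)
    also have "\<dots> = c \<odot>\<^bsub>IM\<^esub> t (psc z f)"
      using TQ.coset_smult[OF sing_T[OF x(2)], of c z] coset_sing[OF x(2), of z] by (simp add: T_simps(4) IM_def')
    also have "\<dots> = t (psc c (psc z f))" using x by (simp only: t_scale FL_intros)
    finally show ?case using x by blast
  qed
  then show "carrier IM \<subseteq> t ` FL" unfolding IM_def' TQ.quot_carrier by (auto simp: T_simps(1))
qed

text \<open>The relation that moves \<open>U(K)\<close> across the tensor sign, where it acts by its augmentation.\<close>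

lemma t_right: assumes "f \<in> FL" "g \<in> FK" shows "t (fmul f g) = t (psc (Poly_Mapping.lookup g []) f)"
proof -
  have "g \<in> FL" using assms FK_FL by blast
  then have "t (fmul f g) = NT +>\<^bsub>T\<^esub> sing (e f) (Poly_Mapping.lookup g [] * 1)"
    unfolding t_def by (intro TQ_eq NT_rel(5) sing_T assms FL_intros)
  then show ?thesis using coset_sing[OF assms(1)] by simp
qed

subsection \<open>The action on the induced module\<close>

definition "phi x = PM.lext (\<lambda>p. sing (env_gen L x \<otimes>\<^bsub>env L\<^esub> fst p) (snd p))"

lemma ind_act_phi: "ind_act L K x = induced T NT (phi x)"
  by (simp add: ind_act_def T_def NT_def phi_def lin_ext_conv case_prod_unfold)

lemma phi_sing: "x \<in> carrier L \<Longrightarrow> f \<in> FL \<Longrightarrow> phi x (sing (e f) z) = sing (e (fmul (word [x]) f)) z"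
  by (simp add: phi_def PM.lext_single env_gen_e e_mult)

lemma phi_lin: "phi x (p + q) = phi x p + phi x q" "phi x (psc c p) = psc c (phi x p)" "phi x (p - q) = phi x p - phi x q"
  "phi x 0 = 0"
  by (simp_all add: phi_def PM.lext_add PM.lext_scale PM.lext_diff)

lemma phi_T: assumes "x \<in> carrier L" "p \<in> carrier T" shows "phi x p \<in> carrier T"
proof -
  have "Poly_Mapping.keys p \<subseteq> carrier (env L) \<times> UNIV" using assms by (simp add: T_simps)
  then have "Poly_Mapping.keys (phi x p) \<subseteq> carrier (env L) \<times> UNIV"
  proof (induction p rule: poly_mapping_lin_induct)
    case (add p q) then show ?case by (simp add: phi_lin keys_add_subset)
  next
    case (single y c)
    then obtain f z where x: "y = (e f, z)" "f \<in> FL" by (auto simp: env_carrier)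
    have "phi x (Poly_Mapping.single y c) = psc c (sing (e (fmul (word [x]) f)) z)"
      using phi_lin(2)[of x c "sing (e f) z"] phi_sing[OF assms(1) x(2)] by (simp add: x psc_single)
    moreover have "sing (e (fmul (word [x]) f)) z \<in> carrier T" using assms x by (intro sing_T FL_intros)
    ultimately show ?case using keys_psc_subset[of "sing (e (fmul (word [x]) f)) z"] by (simp only: T_simps(1) mem_Collect_eq)
  qed (simp add: phi_lin)
  then show ?thesis by (simp add: T_simps)
qed

lemma phi_NT: assumes x: "x \<in> carrier L" shows "NT \<subseteq> {p \<in> carrier T. phi x p \<in> NT}"
proof (rule NT_induct)
  have NT: "p \<in> carrier T" "0 \<in> NT" "p + q \<in> NT" "psc c p \<in> NT" if "p \<in> NT" "q \<in> NT" for p q c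
    using that TQ.N_closed TQ.N_zero TQ.N_add[of p q] TQ.N_scale[of p c] by (simp_all add: T_simps(2,3,4))
  have z: "0 \<in> NT" using TQ.N_zero by (simp add: T_simps)
  have c: "0 \<in> carrier T" "p \<in> carrier T \<Longrightarrow> q \<in> carrier T \<Longrightarrow> p + q \<in> carrier T" "p \<in> carrier T \<Longrightarrow> psc c p \<in> carrier T" for p q c
    using TM.M.zero_closed TM.M.a_closed[of p q] TM.sm_closed[of p c] by (simp_all add: T_simps(2,3,4))
  show "submodule {p \<in> carrier T. phi x p \<in> NT} cfield T"
    by (rule TM.submoduleI') (auto simp: T_simps(2,3,4) phi_lin z c NT)
  have r: "p \<in> carrier T" if "p \<in> NT" for p using that TQ.N_closed by blast
  have w: "word [x] \<in> FL" by (simp add: x)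
  fix f g z z' c
  show "sing (e (f + g)) z - sing (e f) z - sing (e g) z \<in> {p \<in> carrier T. phi x p \<in> NT}" if "f \<in> FL" "g \<in> FL"
    using that r[OF NT_rel(1)[OF that]] NT_rel(1)[of "fmul (word [x]) f" "fmul (word [x]) g" z] w
    by (simp add: phi_lin phi_sing[OF x] fmul_add_right)
  show "sing (e f) (z + z') - sing (e f) z - sing (e f) z' \<in> {p \<in> carrier T. phi x p \<in> NT}" if "f \<in> FL"
    using that r[OF NT_rel(2)[OF that]] NT_rel(2)[of "fmul (word [x]) f" z z'] w
    by (simp add: phi_lin phi_sing[OF x])
  show "sing (e (psc c f)) z - psc c (sing (e f) z) \<in> {p \<in> carrier T. phi x p \<in> NT}" if "f \<in> FL"
    using that r[OF NT_rel(3)[OF that]] NT_rel(3)[of "fmul (word [x]) f" c z] w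
    by (simp add: phi_lin phi_sing[OF x] fmul_scale_right)
  show "sing (e f) (c * z) - psc c (sing (e f) z) \<in> {p \<in> carrier T. phi x p \<in> NT}" if "f \<in> FL"
    using that r[OF NT_rel(4)[OF that]] NT_rel(4)[of "fmul (word [x]) f" c z] w
    by (simp add: phi_lin phi_sing[OF x])
  show "sing (e (fmul f g)) z - sing (e f) (Poly_Mapping.lookup g [] * z) \<in> {p \<in> carrier T. phi x p \<in> NT}" if "f \<in> FL" "g \<in> FK"
  proof -
    have "g \<in> FL" using that FK_FL by blast
    then show ?thesis
      using that r[OF NT_rel(5)[OF that]] NT_rel(5)[of "fmul (word [x]) f" g z] w
      by (simp add: phi_lin phi_sing[OF x] fmul_assoc)
  qed
qed

lemma act_t: assumes "x \<in> carrier L" "f \<in> FL" shows "ind_act L K x (t f) = t (fmul (word [x]) f)"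
proof -
  have "induced T NT (phi x) (NT +>\<^bsub>T\<^esub> sing (e f) 1) = NT +>\<^bsub>T\<^esub> phi x (sing (e f) 1)"
    by (rule TQ.induced_coset[OF T_module NT_submodule sing_T[OF assms(2)] phi_T[OF assms(1)]])
     (use phi_NT[OF assms(1)] in \<open>auto simp: phi_lin T_simps(2)\<close>)
  then show ?thesis by (simp only: ind_act_phi t_def phi_sing[OF assms])
qed

lemma ind_one_t: "ind_one L K = t (word [])"
  by (simp add: ind_one_def t_def e_one NT_def T_def)

subsection \<open>The quotient of a given level\<close>

context
  fixes c :: 'x and ell :: complex
  assumes c: "c \<in> carrier L" and central: "\<And>x. x \<in> carrier L \<Longrightarrow> x \<otimes> c = \<zero>"
begin

definition "LN = {ind_act L K c w \<ominus>\<^bsub>IM\<^esub> ell \<odot>\<^bsub>IM\<^esub> w | w. w \<in> carrier IM}"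
definition "W = quot IM LN"
definition "lact x = induced IM LN (ind_act L K x)"
definition "lone = LN +>\<^bsub>IM\<^esub> ind_one L K"

definition "cf f = fmul (word [c]) f - psc ell f"

lemma cf_FL [simp]: "f \<in> FL \<Longrightarrow> cf f \<in> FL"
  unfolding cf_def using c by blast

lemma cf_lin: "cf (f + g) = cf f + cf g" "cf (psc b f) = psc b (cf f)" "cf 0 = 0"
  by (simp_all add: cf_def fmul_add_right fmul_scale_right PM.scale_right_distrib PM.scale_right_diff_distrib mult.commute)

lemma LN_t: "LN = t ` cf ` FL"
proof -
  have "ind_act L K c (t f) \<ominus>\<^bsub>IM\<^esub> ell \<odot>\<^bsub>IM\<^esub> t f = t (cf f)" if "f \<in> FL" for f
    using that c by (simp add: act_t cf_def t_diff t_scale)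
  then show ?thesis unfolding LN_def t_surj by (auto simp: image_iff)
qed

lemma LN_submodule: "submodule LN cfield IM"
proof (rule IMM.submoduleI')
  show "LN \<subseteq> carrier IM" unfolding LN_t by auto
  show "\<zero>\<^bsub>IM\<^esub> \<in> LN" unfolding LN_t using t_0 cf_lin(3) FL_intros(5) by (metis imageI)
  show "x \<oplus>\<^bsub>IM\<^esub> y \<in> LN" if "x \<in> LN" "y \<in> LN" for x y
  proof -
    from that obtain f g where "f \<in> FL" "g \<in> FL" "x = t (cf f)" "y = t (cf g)" unfolding LN_t by blast
    then have "x \<oplus>\<^bsub>IM\<^esub> y = t (cf (f + g))" "f + g \<in> FL" by (simp_all add: t_add cf_lin)
    then show ?thesis unfolding LN_t by blast
  qed
  show "b \<odot>\<^bsub>IM\<^esub> x \<in> LN" if "x \<in> LN" for x b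
  proof -
    from that obtain f where "f \<in> FL" "x = t (cf f)" unfolding LN_t by blast
    then have "b \<odot>\<^bsub>IM\<^esub> x = t (cf (psc b f))" "psc b f \<in> FL" by (simp_all add: t_scale cf_lin)
    then show ?thesis unfolding LN_t by blast
  qed
qed

interpretation LQ: subspace_quotient IM LN
  by (intro subspace_quotientI IM_module LN_submodule)

text \<open>The quotient of level \<open>ell\<close> is again covered by the free algebra; all structure on it is computed on
  representatives through this map.\<close>

definition "s f = LN +>\<^bsub>IM\<^esub> t f"

lemma W_module: "module cfield W" unfolding W_def by (rule LQ.quot_module)

interpretation WM: complex_module W by (rule complex_moduleI) (rule W_module)

lemma s_closed [simp]: "f \<in> FL \<Longrightarrow> s f \<in> carrier W"
  unfolding s_def W_def by (simp add: LQ.coset_closed)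

lemma s_add: "f \<in> FL \<Longrightarrow> g \<in> FL \<Longrightarrow> s (f + g) = s f \<oplus>\<^bsub>W\<^esub> s g"
  by (simp add: s_def W_def LQ.coset_add t_add)

lemma s_scale: "f \<in> FL \<Longrightarrow> s (psc b f) = b \<odot>\<^bsub>W\<^esub> s f"
  by (simp add: s_def W_def LQ.coset_smult t_scale)

lemma s_surj: "carrier W = s ` FL"
  by (simp add: W_def LQ.quot_carrier t_surj s_def image_image)

lemma s_diff: "f \<in> FL \<Longrightarrow> g \<in> FL \<Longrightarrow> s (f - g) = s f \<ominus>\<^bsub>W\<^esub> s g"
proof -
  assume fg: "f \<in> FL" "g \<in> FL"
  have "f - g = f + psc (-1) g" by simp
  then have "s (f - g) = s f \<oplus>\<^bsub>W\<^esub> s (psc (-1) g)" using s_add[of f "psc (-1) g"] fg FL_intros(3)[of g "-1"] by (simp only:)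
  then show ?thesis using fg by (simp only: s_scale WM.sm_neg1 s_closed WM.M.minus_eq)
qed

lemma s_0: "s 0 = \<zero>\<^bsub>W\<^esub>"
  by (simp add: s_def t_0 W_def LQ.quot_zero')

lemma s_eqI: "f \<in> FL \<Longrightarrow> g \<in> FL \<Longrightarrow> f - g \<in> I \<Longrightarrow> s f = s g"
  by (simp add: s_def t_eqI[of f g])

lemma s_central: assumes "f \<in> FL" shows "s (fmul (word [c]) f) = ell \<odot>\<^bsub>W\<^esub> s f"
proof -
  have "fmul (word [c]) f = cf f + psc ell f" by (simp add: cf_def)
  then have "t (fmul (word [c]) f) = t (cf f) \<oplus>\<^bsub>IM\<^esub> t (psc ell f)" using assms by (simp add: t_add)
  moreover have "t (cf f) \<in> LN" unfolding LN_t using assms by blast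
  ultimately have "s (fmul (word [c]) f) = s (psc ell f)" using assms by (simp add: s_def LQ.coset_absorb)
  then show ?thesis using assms by (simp add: s_scale)
qed

lemma lact_s: assumes x: "x \<in> carrier L" and f: "f \<in> FL" shows "lact x (s f) = s (fmul (word [x]) f)"
proof -
  have w: "word [x] \<in> FL" "word [c] \<in> FL" using x c by auto
  have "induced IM LN (ind_act L K x) (LN +>\<^bsub>IM\<^esub> t f) = LN +>\<^bsub>IM\<^esub> ind_act L K x (t f)"
  proof (rule LQ.induced_coset[OF IM_module LN_submodule])
    show "t f \<in> carrier IM" using f by simp
    show "ind_act L K x v \<in> carrier IM" if "v \<in> carrier IM" for v
      using that x w by (auto simp: t_surj act_t)
    show "ind_act L K x (u \<oplus>\<^bsub>IM\<^esub> v) = ind_act L K x u \<oplus>\<^bsub>IM\<^esub> ind_act L K x v" if "u \<in> carrier IM" "v \<in> carrier IM" for u v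
    proof -
      from that obtain g h where gh: "g \<in> FL" "u = t g" "h \<in> FL" "v = t h" unfolding t_surj by blast
      then show ?thesis using w act_t[OF x, of "g + h"] by (simp add: act_t[OF x] t_add[symmetric] fmul_add_right)
    qed
    show "ind_act L K x n \<in> LN" if "n \<in> LN" for n
    proof -
      from that obtain g where g: "g \<in> FL" "n = t (cf g)" unfolding LN_t by blast
      \<comment> \<open>The null space is stable because \<open>x\<close> and \<open>c\<close> commute in the enveloping algebra.\<close>
      have "fmul (word [x]) (cf g) - cf (fmul (word [x]) g) = fmul (word [x, c] - word [c, x] - word [x \<otimes> c]) g + fmul (word [\<zero>]) g"
        by (simp add: cf_def fmul_diff_right fmul_diff_left fmul_scale_right fmul_assoc[symmetric] fmul_word central[OF x])
      moreover have "fmul (word [x, c] - word [c, x] - word [x \<otimes> c]) g + fmul (word [\<zero>]) g \<in> I"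
        using I_lin(3)[OF x c] I_zero_word g by (intro I_add I_right)
      ultimately have "t (fmul (word [x]) (cf g)) = t (cf (fmul (word [x]) g))"
        using g w by (intro t_eqI) auto
      then have "ind_act L K x n = t (cf (fmul (word [x]) g))" using g x by (simp add: act_t)
      then show ?thesis unfolding LN_t using g w by blast
    qed
  qed
  then show ?thesis using x f by (simp add: lact_def s_def act_t)
qed

lemma lone_s: "lone = s (word [])"
  by (simp add: lone_def s_def ind_one_t)

lemma lone_closed: "lone \<in> carrier W" by (simp add: lone_s)

lemma lact_closed: "x \<in> carrier L \<Longrightarrow> w \<in> carrier W \<Longrightarrow> lact x w \<in> carrier W"
  by (auto simp: s_surj lact_s)

lemma lact_add_right: "x \<in> carrier L \<Longrightarrow> v \<in> carrier W \<Longrightarrow> w \<in> carrier W \<Longrightarrow> lact x (v \<oplus>\<^bsub>W\<^esub> w) = lact x v \<oplus>\<^bsub>W\<^esub> lact x w"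
  unfolding s_surj by (auto simp: lact_s s_add[symmetric] fmul_add_right)

lemma lact_scale_right: "x \<in> carrier L \<Longrightarrow> w \<in> carrier W \<Longrightarrow> lact x (b \<odot>\<^bsub>W\<^esub> w) = b \<odot>\<^bsub>W\<^esub> lact x w"
  unfolding s_surj by (auto simp: lact_s s_scale[symmetric] fmul_scale_right)

lemma lact_add_left:
  assumes "x \<in> carrier L" "y \<in> carrier L" "w \<in> carrier W"
  shows "lact (x \<oplus> y) w = lact x w \<oplus>\<^bsub>W\<^esub> lact y w"
proof -
  obtain f where f: "f \<in> FL" "w = s f" using assms unfolding s_surj by blast
  have "s (fmul (word [x \<oplus> y]) f) = s (fmul (word [x]) f + fmul (word [y]) f)"
  proof (rule s_eqI)
    have "fmul (word [x \<oplus> y] - word [x] - word [y]) f \<in> I" using I_lin(1) assms f by (intro I_right)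
    then show "fmul (word [x \<oplus> y]) f - (fmul (word [x]) f + fmul (word [y]) f) \<in> I" by (simp add: fmul_diff_left fmul_add_left diff_diff_eq)
  qed (use assms f in auto)
  then show ?thesis using assms f by (simp add: lact_s s_add)
qed

lemma lact_scale_left:
  assumes "x \<in> carrier L" "w \<in> carrier W"
  shows "lact (b \<odot> x) w = b \<odot>\<^bsub>W\<^esub> lact x w"
proof -
  obtain f where f: "f \<in> FL" "w = s f" using assms unfolding s_surj by blast
  have "s (fmul (word [b \<odot> x]) f) = s (psc b (fmul (word [x]) f))"
  proof (rule s_eqI)
    have "fmul (word [b \<odot> x] - psc b (word [x])) f \<in> I" using I_lin(2) assms f by (intro I_right)
    then show "fmul (word [b \<odot> x]) f - psc b (fmul (word [x]) f) \<in> I" by (simp add: fmul_diff_left fmul_scale_left)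
  qed (use assms f in auto)
  then show ?thesis using assms f by (simp add: lact_s s_scale)
qed

lemma lact_bracket:
  assumes "x \<in> carrier L" "y \<in> carrier L" "w \<in> carrier W"
  shows "lact x (lact y w) \<ominus>\<^bsub>W\<^esub> lact y (lact x w) = lact (x \<otimes> y) w"
proof -
  obtain f where f: "f \<in> FL" "w = s f" using assms unfolding s_surj by blast
  have "s (fmul (word [x]) (fmul (word [y]) f) - fmul (word [y]) (fmul (word [x]) f)) = s (fmul (word [x \<otimes> y]) f)"
  proof (rule s_eqI)
    have "fmul (word [x, y] - word [y, x] - word [x \<otimes> y]) f \<in> I" using I_lin(3) assms f by (intro I_right)
    then show "fmul (word [x]) (fmul (word [y]) f) - fmul (word [y]) (fmul (word [x]) f) - fmul (word [x \<otimes> y]) f \<in> I"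
      by (simp add: fmul_diff_left fmul_assoc[symmetric] fmul_word)
  qed (use assms f br in auto)
  then show ?thesis using assms f br by (simp add: lact_s s_diff)
qed

lemma lact_one: assumes "k \<in> H" shows "lact k lone = \<zero>\<^bsub>W\<^esub>"
proof -
  have k: "k \<in> carrier L" using assms HL by blast
  have "t (fmul (word []) (word [k])) = t (psc 0 (word []))"
  proof -
    have "Poly_Mapping.lookup (word [k]) [] = 0" by (simp add: word_def lookup_single)
    then show ?thesis using t_right[of "word []" "word [k]"] assms by (simp add: FK_intros)
  qed
  moreover have "psc 0 (word []) = (0 :: 'x list \<Rightarrow>\<^sub>0 complex)" by (rule poly_mapping_eqI) simp
  ultimately have "t (word [k]) = t 0" by (simp add: fmul_one)
  then have "s (word [k]) = \<zero>\<^bsub>W\<^esub>" using s_0 by (simp add: s_def)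
  then show ?thesis using k by (simp add: lone_s lact_s fmul_word)
qed

lemma lact_central: "w \<in> carrier W \<Longrightarrow> lact c w = ell \<odot>\<^bsub>W\<^esub> w"
  unfolding s_surj using c by (auto simp: lact_s s_central)

lemma W_generated:
  assumes Q: "submodule Q cfield W" "lone \<in> Q" and act: "\<And>x w. x \<in> carrier L \<Longrightarrow> w \<in> Q \<Longrightarrow> lact x w \<in> Q"
  shows "carrier W \<subseteq> Q"
proof -
  note Q' = WM.submoduleD[OF Q(1)]
  have w: "word w \<in> FL \<and> s (word w) \<in> Q" if "w \<in> lists (carrier L)" for w
    using that
  proof (induction w)
    case Nil then show ?case using Q(2) by (simp add: lone_s)
  next
    case (Cons x w)
    then have "s (word (x # w)) = lact x (s (word w))" by (simp add: lact_s fmul_word)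
    then show ?case using Cons act by (auto simp: FL_def)
  qed
  have "f \<in> FL \<and> s f \<in> Q" if "Poly_Mapping.keys f \<subseteq> lists (carrier L)" for f
    using that
  proof (induction f rule: poly_mapping_lin_induct)
    case zero then show ?case using Q' s_0 by simp
  next
    case (add p q) then show ?case using Q' by (simp add: s_add)
  next
    case (single w b)
    have "Poly_Mapping.single w b = psc b (word w)" by (simp add: word_def psc_single)
    then show ?case using w[OF single] Q' by (simp add: s_scale)
  qed
  then show ?thesis unfolding s_surj FL_def by blast
qed

text \<open>The free algebra acts on \<open>S\<close> by composing operators \<open>rho x\<close>.  The relations of \<open>U(L)\<close> act as zero, as \<open>rho\<close> is
  a representation.  The map \<open>f \<mapsto> f v0\<close> then factors through the tensor product, as \<open>U(K)\<close> acts on \<open>v0\<close> by its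
  augmentation, and through the quotient of level \<open>ell\<close>, as \<open>c\<close> acts by this scalar.\<close>

theorem W_universal:
  fixes sc :: "complex \<Rightarrow> 'p::ab_group_add \<Rightarrow> 'p" and rho :: "'x \<Rightarrow> 'p \<Rightarrow> 'p"
  assumes sc: "complex_space sc" and S: "module.subspace sc S"
    and mem: "\<And>x v. x \<in> carrier L \<Longrightarrow> v \<in> S \<Longrightarrow> rho x v \<in> S"
    and add: "\<And>x v w. x \<in> carrier L \<Longrightarrow> v \<in> S \<Longrightarrow> w \<in> S \<Longrightarrow> rho x (v + w) = rho x v + rho x w"
    and scale: "\<And>x b v. x \<in> carrier L \<Longrightarrow> v \<in> S \<Longrightarrow> rho x (sc b v) = sc b (rho x v)"
    and addL: "\<And>x y v. x \<in> carrier L \<Longrightarrow> y \<in> carrier L \<Longrightarrow> v \<in> S \<Longrightarrow> rho (x \<oplus> y) v = rho x v + rho y v"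
    and scaleL: "\<And>x b v. x \<in> carrier L \<Longrightarrow> v \<in> S \<Longrightarrow> rho (b \<odot> x) v = sc b (rho x v)"
    and bracket: "\<And>x y v. x \<in> carrier L \<Longrightarrow> y \<in> carrier L \<Longrightarrow> v \<in> S \<Longrightarrow> rho (x \<otimes> y) v = rho x (rho y v) - rho y (rho x v)"
    and v0: "v0 \<in> S" "\<And>k. k \<in> H \<Longrightarrow> rho k v0 = 0"
    and level: "\<And>v. v \<in> S \<Longrightarrow> rho c v = sc ell v"
  shows "\<exists>Om. module_map W sc Om \<and> Om lone = v0 \<and> (\<forall>x\<in>carrier L. \<forall>w\<in>carrier W. Om (lact x w) = rho x (Om w)) \<and>
    (\<forall>w\<in>carrier W. Om w \<in> S)"
proof -
  interpret P: complex_space sc by fact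
  note S0 = P.subspace_0[OF S]
  have rho0: "rho x 0 = 0" if "x \<in> carrier L" for x using scale[OF that S0, of 0] by simp
  define th where "th = (\<lambda>f v. P.lext (\<lambda>w. foldr rho w v) f)"
  have fm: "foldr rho w v \<in> S" if "w \<in> lists (carrier L)" "v \<in> S" for w v
    using that by (induction w) (auto intro: mem)
  have fa: "foldr rho w (v + v') = foldr rho w v + foldr rho w v'" if "w \<in> lists (carrier L)" "v \<in> S" "v' \<in> S" for w v v'
    using that by (induction w) (auto simp: add fm)
  have fs: "foldr rho w (sc b v) = sc b (foldr rho w v)" if "w \<in> lists (carrier L)" "v \<in> S" for w b v
    using that by (induction w) (auto simp: scale fm)
  have f0: "foldr rho w 0 = 0" if "w \<in> lists (carrier L)" for w using fs[OF that S0, of 0] by simp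
  have th_lin: "th (f + g) v = th f v + th g v" "th (f - g) v = th f v - th g v" "th (psc b f) v = sc b (th f v)" "th 0 v = 0" for f g b v
    by (simp_all add: th_def P.lext_add P.lext_diff P.lext_scale)
  have th_single: "th (Poly_Mapping.single w b) v = sc b (foldr rho w v)" for w b v by (simp add: th_def P.lext_single)
  have th_word: "th (word w) v = foldr rho w v" for w v by (simp add: word_def th_single)
  have th_mem: "th f v \<in> S" if "f \<in> FL" "v \<in> S" for f v
    unfolding th_def P.lext_def using that by (auto simp: FL_def intro!: P.subspace_sum[OF S] P.subspace_scale[OF S] fm)
  have th_0: "th f 0 = 0" if "f \<in> FL" for f
    unfolding th_def P.lext_def
  proof (intro sum.neutral ballI)
    fix w assume "w \<in> Poly_Mapping.keys f"
    then have "w \<in> lists (carrier L)" using that unfolding FL_def by blast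
    then show "sc (Poly_Mapping.lookup f w) (foldr rho w 0) = 0" by (simp add: f0 del: in_lists_conv_set)
  qed
  have th_add: "th f (v + v') = th f v + th f v'" if "f \<in> FL" "v \<in> S" "v' \<in> S" for f v v'
  proof -
    have "Poly_Mapping.keys f \<subseteq> lists (carrier L)" using that by (simp add: FL_def)
    then show ?thesis
      by (induction f rule: poly_mapping_lin_induct) (simp_all only: th_lin th_single fa that P.scale_right_distrib add_0 ac_simps)
  qed
  have th_scale: "th f (sc b v) = sc b (th f v)" if "f \<in> FL" "v \<in> S" for f b v
  proof -
    have "Poly_Mapping.keys f \<subseteq> lists (carrier L)" using that by (simp add: FL_def)
    then show ?thesis
      by (induction f rule: poly_mapping_lin_induct) (simp_all add: th_lin th_single fs that P.scale_right_distrib mult.commute del: in_lists_conv_set)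
  qed
  have th_mul: "th (fmul f g) v = th f (th g v)" if "f \<in> FL" "g \<in> FL" "v \<in> S" for f g v
  proof -
    have "Poly_Mapping.keys f \<subseteq> lists (carrier L)" using that by (simp add: FL_def)
    then show ?thesis
    proof (induction f rule: poly_mapping_lin_induct)
      case (single u a)
      then have uF: "Poly_Mapping.single u a \<in> FL" by (simp add: FL_def)
      have "Poly_Mapping.keys g \<subseteq> lists (carrier L)" using that by (simp add: FL_def)
      then show ?case
      proof (induction g rule: poly_mapping_lin_induct)
        case (add p q)
        then have "p \<in> FL" "q \<in> FL" by (simp_all add: FL_def)
        then show ?case using add by (simp only: fmul_add_right th_lin th_add[OF uF] th_mem that(3))
      next
        case (single w b)
        then show ?case using \<open>u \<in> lists (carrier L)\<close> that(3)
          by (simp add: fmul_single th_single fs fm del: in_lists_conv_set)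
      qed (simp add: th_lin th_0[OF uF])
    qed (simp_all add: fmul_add_left th_lin)
  qed
  \<comment> \<open>Factorisation through the enveloping algebra.\<close>
  have kill: "th f v = 0" if "f \<in> I" "v \<in> S" for f v
  proof -
    have "f \<in> {f \<in> FL. \<forall>v\<in>S. th f v = 0}" (is "_ \<in> ?J")
    proof (rule free_ideal_induct[OF relations_FL, of f])
      show "f \<in> Idl\<^bsub>A\<^esub> env_relations L" using that by (simp add: I_def env_ideal_def)
      have "\<forall>r\<in>env_relations L. \<forall>v\<in>S. th r v = 0"
        unfolding env_relations_def psc_def[symmetric] by (auto simp: th_lin th_word addL scaleL bracket)
      then show "env_relations L \<subseteq> ?J" using relations_FL carrier_A by blast
      show "?J \<subseteq> carrier A" using carrier_A by blast
      show "fmul f g \<in> ?J" "fmul g f \<in> ?J" if "f \<in> ?J" "Poly_Mapping.keys g \<subseteq> lists (carrier L)" for f g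
      proof -
        have g: "g \<in> FL" using that by (simp add: FL_def)
        show "fmul f g \<in> ?J" "fmul g f \<in> ?J" using that g by (auto simp: th_mul th_mem th_0[OF g])
      qed
    qed (auto simp: th_lin)
    then show ?thesis using that by blast
  qed
  \<comment> \<open>Factorisation through the tensor product: \<open>U(K)\<close> acts on \<open>v0\<close> by its augmentation.\<close>
  have thK: "th f v0 = sc (Poly_Mapping.lookup f []) v0" if "f \<in> FK" for f
  proof -
    have fK: "foldr rho w v0 = (if w = [] then v0 else 0)" if "w \<in> lists H" for w
      using that
    proof (induction w)
      case (Cons k w)
      then show ?case using HL v0(2) rho0 by (cases w) auto
    qed simp
    have "Poly_Mapping.keys f \<subseteq> lists H" using that by (simp add: FK_def)
    then show ?thesis
      by (induction f rule: poly_mapping_lin_induct)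
        (auto simp: th_lin lookup_add P.scale_left_distrib th_single fK lookup_single when_def simp del: in_lists_conv_set)
  qed
  have "module_map A sc (\<lambda>f. th f v0)"
    by (intro module_map.intro complex_moduleI free_algebra_module sc module_map_axioms.intro) (simp_all add: th_lin)
  then obtain g where g: "module_map (quot A I) sc g" "\<And>f. f \<in> carrier A \<Longrightarrow> g (I +>\<^bsub>A\<^esub> f) = th f v0"
    by (rule AI.quot_lift) (use kill v0 in blast)+
  have ge: "g (e f) = th f v0" if "f \<in> FL" for f using g(2) that by (simp add: e_def FL_def)
  define Ps where "Ps = P.lext (\<lambda>p. sc (snd p) (g (fst p)))"
  have Ps_lin: "Ps (p + q) = Ps p + Ps q" "Ps (p - q) = Ps p - Ps q" "Ps (psc b p) = sc b (Ps p)" for p q b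
    by (simp_all add: Ps_def P.lext_add P.lext_diff P.lext_scale)
  have Ps_sing: "Ps (sing (e f) z) = sc z (th f v0)" if "f \<in> FL" for f z
    using that by (simp add: Ps_def P.lext_single ge)
  have PsT: "module_map T sc Ps" unfolding Ps_def T_def by (rule P.lext_mlin)
  have NTk: "NT \<subseteq> {p \<in> carrier T. Ps p = 0}"
  proof (rule NT_induct)
    show "submodule {p \<in> carrier T. Ps p = 0} cfield T" using module_map.kernel_submodule[OF PsT] .
  next
    fix f g z assume fg: "f \<in> FL" "g \<in> FK"
    then have "g \<in> FL" using FK_FL by blast
    then show "sing (e (fmul f g)) z - sing (e f) (Poly_Mapping.lookup g [] * z) \<in> {p \<in> carrier T. Ps p = 0}"
      using fg v0 TQ.N_closed[OF NT_rel(5)[OF fg]]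
      by (simp add: Ps_lin Ps_sing th_mul thK th_scale mult.commute)
  qed (use TQ.N_closed[OF NT_rel(1)] TQ.N_closed[OF NT_rel(2)] TQ.N_closed[OF NT_rel(3)] TQ.N_closed[OF NT_rel(4)] in
     \<open>simp_all add: Ps_lin Ps_sing th_lin P.scale_right_distrib P.scale_left_distrib mult.commute\<close>)
  obtain O1 where O1: "module_map (quot T NT) sc O1" "\<And>p. p \<in> carrier T \<Longrightarrow> O1 (NT +>\<^bsub>T\<^esub> p) = Ps p"
    by (rule TQ.quot_lift[OF PsT]) (use NTk in blast)+
  have O1t: "O1 (t f) = th f v0" if "f \<in> FL" for f
    using O1(2)[OF sing_T[OF that, of 1]] that by (simp add: t_def Ps_sing)
  have O1m: "module_map IM sc O1" using O1 by (simp add: IM_def')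
  \<comment> \<open>Factorisation through the quotient of level \<open>ell\<close>.\<close>
  have O1k: "O1 n = 0" if "n \<in> LN" for n
  proof -
    from that obtain f where f: "f \<in> FL" "n = t (cf f)" unfolding LN_t by blast
    have "th (fmul (word [c]) f) v0 = sc ell (th f v0)"
      using f c v0 level[OF th_mem] by (simp add: th_mul th_word)
    then show ?thesis using f by (simp add: O1t) (simp add: cf_def th_lin)
  qed
  obtain Om where Om: "module_map (quot IM LN) sc Om" "\<And>x. x \<in> carrier IM \<Longrightarrow> Om (LN +>\<^bsub>IM\<^esub> x) = O1 x"
    by (rule LQ.quot_lift[OF O1m]) (use O1k in blast)+
  have Oms: "Om (s f) = th f v0" if "f \<in> FL" for f using that Om(2) by (simp add: s_def O1t)
  show ?thesis
  proof (intro exI[of _ Om] conjI ballI)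
    show "module_map W sc Om" using Om by (simp add: W_def)
    show "Om lone = v0" by (simp add: lone_s Oms th_word)
    show "Om (lact x w) = rho x (Om w)" if "x \<in> carrier L" "w \<in> carrier W" for x w
      using that v0 unfolding s_surj by (auto simp: lact_s Oms th_mul th_word)
    show "Om w \<in> S" if "w \<in> carrier W" for w
      using that v0 unfolding s_surj by (auto simp: Oms th_mem)
  qed
qed

end

end

section \<open>The Lie algebra of modes of a vertex algebra\<close>

lemma (in complex_module) neg_zero [simp]: "\<ominus> \<zero> = \<zero>"
  using sm_neg1[of \<zero>] by simp

lemma (in complex_module) finsum_two:
  "(\<And>i. f i \<in> carrier M) \<Longrightarrow> (\<Oplus>i\<in>{0, 1::nat}. f i) = f 0 \<oplus> f 1"
  by (simp add: Pi_def)

lemma (in complex_module) submodule_finsum: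
  assumes "submodule J cfield M" "\<And>i. i \<in> A \<Longrightarrow> g i \<in> J"
  shows "(\<Oplus>i\<in>A. g i) \<in> J"
proof -
  note J = submoduleD[OF assms(1)]
  show ?thesis using assms(2)
  proof (induction A rule: infinite_finite_induct)
    case (insert a A)
    then have "(\<Oplus>i\<in>insert a A. g i) = g a \<oplus> (\<Oplus>i\<in>A. g i)" using J(1) by (intro M.finsum_insert) auto
    then show ?case using insert J(3) by simp
  qed (simp_all add: J(2))
qed

locale vertex_algebra_modes = vertex_algebra V Y vac for V :: "(complex, 'a) module" and Y vac
begin

sublocale VM: complex_module V by (simp add: complex_module_def module_axioms)

abbreviation "Lau \<equiv> laurent_space V"
abbreviation "D \<equiv> transl Y vac"

lemma Lau_simps: "carrier Lau = {f. (\<forall>n. f n \<in> carrier V) \<and> finite {n. f n \<noteq> \<zero>\<^bsub>V\<^esub>}}"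
  "\<zero>\<^bsub>Lau\<^esub> = (\<lambda>_. \<zero>\<^bsub>V\<^esub>)" "add Lau = (\<lambda>f g n. f n \<oplus>\<^bsub>V\<^esub> g n)" "smult Lau = (\<lambda>c f n. c \<odot>\<^bsub>V\<^esub> f n)"
  by (simp_all add: laurent_space_def)

lemma hat_simps: "carrier (hat_space V Y) = carrier Lau" "\<zero>\<^bsub>hat_space V Y\<^esub> = \<zero>\<^bsub>Lau\<^esub>" "add (hat_space V Y) = add Lau"
   "smult (hat_space V Y) = smult Lau" "mult (hat_space V Y) = hat_bracket V Y"
  by (simp_all add: hat_space_def)

lemma Lau_closed:
  "f \<in> carrier Lau \<Longrightarrow> f n \<in> carrier V" "f \<in> carrier Lau \<Longrightarrow> finite {n. f n \<noteq> \<zero>\<^bsub>V\<^esub>}"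
  by (auto simp: Lau_simps)

lemma Lau_module: "module cfield Lau"
proof (rule cmoduleI)
  fix x y assume x: "x \<in> carrier Lau" and y: "y \<in> carrier Lau"
  have "{n. x n \<oplus>\<^bsub>V\<^esub> y n \<noteq> \<zero>\<^bsub>V\<^esub>} \<subseteq> {n. x n \<noteq> \<zero>\<^bsub>V\<^esub>} \<union> {n. y n \<noteq> \<zero>\<^bsub>V\<^esub>}" by auto
  then show "x \<oplus>\<^bsub>Lau\<^esub> y \<in> carrier Lau" using x y by (auto simp: Lau_simps intro: finite_subset)
next
  fix x c assume x: "x \<in> carrier Lau"
  have "{n. c \<odot>\<^bsub>V\<^esub> x n \<noteq> \<zero>\<^bsub>V\<^esub>} \<subseteq> {n. x n \<noteq> \<zero>\<^bsub>V\<^esub>}" by auto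
  then show "c \<odot>\<^bsub>Lau\<^esub> x \<in> carrier Lau" using x by (auto simp: Lau_simps intro: finite_subset)
qed (auto simp: Lau_simps fun_eq_iff VM.sm_add_left VM.sm_add_right VM.sm_assoc M.a_ac VM.sm_neg1 M.l_neg M.r_neg)

sublocale LM: complex_module Lau by (rule complex_moduleI) (rule Lau_module)

lemma hat_module: "module cfield (hat_space V Y)"
  using Lau_module
  by (intro cmoduleI) (simp_all add: hat_simps LM.M.a_ac LM.sm_add_left LM.sm_add_right LM.sm_assoc LM.sm_neg1 LM.M.l_neg LM.M.r_neg)

lemma tmono_closed [simp]: "a \<in> carrier V \<Longrightarrow> tmono V a m \<in> carrier Lau"
  by (auto simp: Lau_simps tmono_def)

lemma tmono_add: "a \<in> carrier V \<Longrightarrow> b \<in> carrier V \<Longrightarrow> tmono V (a \<oplus>\<^bsub>V\<^esub> b) m = tmono V a m \<oplus>\<^bsub>Lau\<^esub> tmono V b m"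
  by (auto simp: Lau_simps tmono_def)

lemma tmono_smult: "a \<in> carrier V \<Longrightarrow> tmono V (c \<odot>\<^bsub>V\<^esub> a) m = c \<odot>\<^bsub>Lau\<^esub> tmono V a m"
  by (auto simp: Lau_simps tmono_def)

lemma tmono_zero: "tmono V \<zero>\<^bsub>V\<^esub> m = \<zero>\<^bsub>Lau\<^esub>"
  by (auto simp: Lau_simps tmono_def)

lemma laurent_induct [consumes 1, case_names mono add]:
  assumes f: "f \<in> carrier Lau"
    and mono: "\<And>a m. a \<in> carrier V \<Longrightarrow> P (tmono V a m)"
    and add: "\<And>f g. f \<in> carrier Lau \<Longrightarrow> g \<in> carrier Lau \<Longrightarrow> P f \<Longrightarrow> P g \<Longrightarrow> P (f \<oplus>\<^bsub>Lau\<^esub> g)"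
  shows "P f"
proof -
  have "finite A \<Longrightarrow> f \<in> carrier Lau \<Longrightarrow> {n. f n \<noteq> \<zero>\<^bsub>V\<^esub>} \<subseteq> A \<Longrightarrow> P f" for A
  proof (induction A arbitrary: f rule: finite_induct)
    case empty
    then have "f = tmono V \<zero>\<^bsub>V\<^esub> 0" by (auto simp: tmono_def)
    then show ?case using mono[of "\<zero>\<^bsub>V\<^esub>" 0] by simp
  next
    case (insert m A)
    define g where "g = f(m := \<zero>\<^bsub>V\<^esub>)"
    have fm: "f m \<in> carrier V" using insert Lau_closed by blast
    have gs: "{n. g n \<noteq> \<zero>\<^bsub>V\<^esub>} \<subseteq> A" using insert by (auto simp: g_def)
    then have g: "g \<in> carrier Lau" using insert finite_subset[OF gs] by (auto simp: Lau_simps g_def)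
    have "tmono V (f m) m \<oplus>\<^bsub>Lau\<^esub> g = f"
      using insert.prems(1) by (auto simp: Lau_simps tmono_def g_def fun_eq_iff)
    then show ?case using add[OF tmono_closed[OF fm, of m] g mono[OF fm, of m] insert.IH[OF g gs]] by simp
  qed
  then show ?thesis using f Lau_closed by blast
qed

text \<open>The bracket of \<open>a \<otimes> t^m\<close> and \<open>b \<otimes> t^n\<close>.\<close>

definition "hb a m b n = supp_sum Lau (\<lambda>i::nat. tmono V ((of_int m gchoose i) \<odot>\<^bsub>V\<^esub> Y a (int i) b) (m + n - int i))"

lemma Y_nonneg_ev: assumes "a \<in> carrier V" "b \<in> carrier V" shows "\<exists>K::nat. \<forall>i\<ge>K. Y a (int i) b = \<zero>\<^bsub>V\<^esub>"
proof -
  obtain N where "\<forall>n\<ge>N. Y a n b = \<zero>\<^bsub>V\<^esub>" using truncation assms by blast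
  then show ?thesis by (intro exI[of _ "nat N"]) auto
qed

lemma mlin_hb:
  assumes G: "module_map Lau sc G" and ab: "a \<in> carrier V" "b \<in> carrier V"
  shows "G (hb a m b n) = complex_space.bin sc 1 m (\<lambda>i. G (tmono V (Y a (int i) b) (m + n - int i)))"
    and "ev0 (\<lambda>i. G (tmono V (Y a (int i) b) (h i)))"
proof -
  interpret G: module_map Lau sc G by fact
  obtain K where K: "\<And>i. i \<ge> K \<Longrightarrow> Y a (int i) b = \<zero>\<^bsub>V\<^esub>" using Y_nonneg_ev ab by blast
  note Yc = Y_closed[OF ab]
  let ?t = "\<lambda>i::nat. tmono V ((of_int m gchoose i) \<odot>\<^bsub>V\<^esub> Y a (int i) b) (m + n - int i)"
  have z: "?t i = \<zero>\<^bsub>Lau\<^esub>" if "i \<ge> K" for i using K[OF that] by (simp add: tmono_zero)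
  have "G (hb a m b n) = (\<Sum>i\<in>{i. ?t i \<noteq> \<zero>\<^bsub>Lau\<^esub>}. G (?t i))"
    unfolding hb_def supp_sum_def by (rule G.f_finsum) (simp add: Yc)
  also have "\<dots> = (\<Sum>i<K. G (?t i))"
  proof (rule sum.mono_neutral_left)
    show "{i. ?t i \<noteq> \<zero>\<^bsub>Lau\<^esub>} \<subseteq> {..<K}" using z not_le by auto
    show "\<forall>i\<in>{..<K} - {i. ?t i \<noteq> \<zero>\<^bsub>Lau\<^esub>}. G (?t i) = 0"
    proof
      fix i assume "i \<in> {..<K} - {i. ?t i \<noteq> \<zero>\<^bsub>Lau\<^esub>}"
      then have "?t i = \<zero>\<^bsub>Lau\<^esub>" by blast
      then show "G (?t i) = 0" by (simp only: G.f_zero)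
    qed
  qed simp
  also have "\<dots> = complex_space.bin sc 1 m (\<lambda>i. G (tmono V (Y a (int i) b) (m + n - int i)))"
    by (subst G.bin_eq[of K]) (simp_all add: K tmono_zero tmono_smult Yc G.f_scale)
  finally show "G (hb a m b n) = complex_space.bin sc 1 m (\<lambda>i. G (tmono V (Y a (int i) b) (m + n - int i)))" .
  show "ev0 (\<lambda>i. G (tmono V (Y a (int i) b) (h i)))"
    by (rule ev0I[of K]) (simp add: K tmono_zero)
qed

lemma hb_closed [simp]: "a \<in> carrier V \<Longrightarrow> b \<in> carrier V \<Longrightarrow> hb a m b n \<in> carrier Lau"
  unfolding hb_def supp_sum_def by (intro LM.M.finsum_closed) (auto simp: Y_closed)

subsection \<open>The translation operator\<close>

lemma ssum_single:
  assumes f: "\<And>i. f i \<in> carrier V" and "\<And>i. i \<noteq> j \<Longrightarrow> f i = \<zero>\<^bsub>V\<^esub>"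
  shows "supp_sum V f = f j"
proof (cases "f j = \<zero>\<^bsub>V\<^esub>")
  case True
  then have "f i = \<zero>\<^bsub>V\<^esub>" for i using assms(2)[of i] by (cases "i = j") auto
  then have "{i. f i \<noteq> \<zero>\<^bsub>V\<^esub>} = {}" by auto
  then show ?thesis using True by (simp add: supp_sum_def)
next
  case False
  then have "{i. f i \<noteq> \<zero>\<^bsub>V\<^esub>} = {j}" using assms by auto
  then show ?thesis using f by (simp add: supp_sum_def)
qed

lemma ssum_two:
  assumes f: "\<And>i. f i \<in> carrier V" and z: "\<And>i. i \<noteq> 0 \<Longrightarrow> i \<noteq> (1::nat) \<Longrightarrow> f i = \<zero>\<^bsub>V\<^esub>"
  shows "supp_sum V f = f 0 \<oplus>\<^bsub>V\<^esub> f 1"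
proof -
  have "supp_sum V f = (\<Oplus>\<^bsub>V\<^esub>i\<in>{0, 1}. f i)"
    unfolding supp_sum_def by (rule M.add.finprod_mono_neutral_cong_left) (use z f in auto)
  then show ?thesis using VM.finsum_two[OF f] by simp
qed

lemma ssum_zero: "(\<And>i. f i = \<zero>\<^bsub>V\<^esub>) \<Longrightarrow> supp_sum V f = \<zero>\<^bsub>V\<^esub>"
  by (simp add: supp_sum_def)

lemma D_closed [simp]: "a \<in> carrier V \<Longrightarrow> D a \<in> carrier V"
  by (simp add: transl_def Y_closed vac_closed)

lemma D_add: "a \<in> carrier V \<Longrightarrow> b \<in> carrier V \<Longrightarrow> D (a \<oplus>\<^bsub>V\<^esub> b) = D a \<oplus>\<^bsub>V\<^esub> D b"
  by (simp add: transl_def Y_add_left vac_closed)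

lemma D_smult: "a \<in> carrier V \<Longrightarrow> D (c \<odot>\<^bsub>V\<^esub> a) = c \<odot>\<^bsub>V\<^esub> D a"
  by (simp add: transl_def Y_smult_left vac_closed)

lemma D_zero [simp]: "D \<zero>\<^bsub>V\<^esub> = \<zero>\<^bsub>V\<^esub>"
  using D_smult[of "\<zero>\<^bsub>V\<^esub>" 0] by simp

lemma Y_zero [simp]: "a \<in> carrier V \<Longrightarrow> Y a n \<zero>\<^bsub>V\<^esub> = \<zero>\<^bsub>V\<^esub>" "b \<in> carrier V \<Longrightarrow> Y \<zero>\<^bsub>V\<^esub> n b = \<zero>\<^bsub>V\<^esub>"
  using Y_smult_right[of a "\<zero>\<^bsub>V\<^esub>" n 0] Y_smult_left[of "\<zero>\<^bsub>V\<^esub>" b 0 n] by (simp_all add: Y_closed)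

lemma D_vac: "D vac = \<zero>\<^bsub>V\<^esub>"
  by (simp add: transl_def vacuum vac_closed)

lemma zero_gchoose [simp]: "i \<noteq> 0 \<Longrightarrow> (0 :: complex) gchoose i = 0"
  by (cases i) auto

lemma minus2_gchoose: "(-1) ^ i * (of_int (-2) gchoose i) = (of_nat i + 1 :: complex)"
proof (induction i)
  case (Suc i)
  have "(of_nat (Suc i) :: complex) * (of_int (-2) gchoose Suc i) = (of_int (-2) - of_nat i) * (of_int (-2) gchoose i)"
    using gbinomial_absorb_comp[of "of_int (-2) :: complex" i] gbinomial_absorption[of i "of_int (-2) :: complex"] by simp
  note A = this
  have "of_nat (Suc i) * ((-1) ^ Suc i * (of_int (-2) gchoose Suc i)) = (-1) ^ Suc i * (of_nat (Suc i) * (of_int (-2) gchoose Suc i :: complex))"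
    by (simp only: mult.left_commute)
  also have "\<dots> = - (of_int (-2) - of_nat i) * ((-1) ^ i * (of_int (-2) gchoose i :: complex))"
    unfolding A by (simp add: algebra_simps)
  also have "\<dots> = of_nat (Suc i) * (of_nat (Suc i) + 1)" unfolding Suc by (simp add: algebra_simps)
  finally show ?case by (simp only: mult_cancel_left) (simp del: of_nat_Suc)
qed simp

text \<open>The Jacobi identity for \<open>a\<close>, the vacuum and \<open>b\<close>: each sum has at most one nonzero term.\<close>

lemma Y_D: assumes "a \<in> carrier V" "b \<in> carrier V"
  shows "Y (D a) n b = of_int (- n) \<odot>\<^bsub>V\<^esub> Y a (n - 1) b"
proof -
  note v = vac_closed
  have vb: "Y vac k b = (if k = -1 then b else \<zero>\<^bsub>V\<^esub>)" for k using vacuum assms by simp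
  have vab: "Y vac k (Y a j b) = (if k = -1 then Y a j b else \<zero>\<^bsub>V\<^esub>)" for k j using vacuum Y_closed assms by simp
  let ?f = "\<lambda>i::nat. ((-1) ^ i * (of_int (-2) gchoose i)) \<odot>\<^bsub>V\<^esub> Y a (-2 + 0 - int i) (Y vac (n + int i) b)"
  let ?g = "\<lambda>i::nat. ((-1) powi (-2) * (-1) ^ i * (of_int (-2) gchoose i)) \<odot>\<^bsub>V\<^esub> Y vac (-2 + n - int i) (Y a (0 + int i) b)"
  let ?h = "\<lambda>i::nat. (of_int 0 gchoose i) \<odot>\<^bsub>V\<^esub> Y (Y a (-2 + int i) vac) (0 + n - int i) b"
  have "supp_sum V ?f \<ominus>\<^bsub>V\<^esub> supp_sum V ?g = supp_sum V ?h"
    by (rule jacobi) (use assms v in auto)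
  moreover have "supp_sum V ?h = Y (D a) n b"
  proof -
    have "supp_sum V ?h = ?h 0"
      by (rule ssum_single) (simp_all add: Y_closed v assms)
    then show ?thesis using assms v by (simp add: transl_def Y_closed)
  qed
  moreover have "supp_sum V ?f = (if n \<le> -1 then of_int (- n) \<odot>\<^bsub>V\<^esub> Y a (n - 1) b else \<zero>\<^bsub>V\<^esub>)"
  proof (cases "n \<le> -1")
    case True
    have "supp_sum V ?f = ?f (nat (- 1 - n))"
      using True by (intro ssum_single) (auto simp: Y_closed v assms vb)
    then show ?thesis using True assms unfolding minus2_gchoose by (simp add: vb)
  next
    case False
    then show ?thesis by (subst ssum_zero) (use assms in \<open>auto simp: vb\<close>)
  qed
  moreover have "supp_sum V ?g = (if n \<ge> 1 then of_int n \<odot>\<^bsub>V\<^esub> Y a (n - 1) b else \<zero>\<^bsub>V\<^esub>)"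
  proof (cases "n \<ge> 1")
    case True
    have "supp_sum V ?g = ?g (nat (n - 1))"
      using True by (intro ssum_single) (auto simp: Y_closed v assms vab)
    then show ?thesis using True assms minus2_gchoose[of "nat (n - 1)"] by (simp add: vab)
  next
    case False
    then show ?thesis by (subst ssum_zero) (use assms in \<open>auto simp: vab\<close>)
  qed
  moreover have "of_int (- n) \<odot>\<^bsub>V\<^esub> Y a (n - 1) b = \<ominus>\<^bsub>V\<^esub> (of_int n \<odot>\<^bsub>V\<^esub> Y a (n - 1) b)"
    using VM.sm_neg1[of "of_int n \<odot>\<^bsub>V\<^esub> Y a (n - 1) b"] VM.sm_assoc[of "Y a (n - 1) b" "-1" "of_int n"] assms by (simp add: Y_closed)
  moreover have "n = 0 \<or> n \<le> -1 \<or> n \<ge> 1" by linarith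
  ultimately show ?thesis using assms by (auto simp: Y_closed M.minus_eq)
qed

text \<open>The Jacobi identity for \<open>a\<close>, \<open>b\<close> and the vacuum: creation leaves only two terms of the first sum.\<close>

lemma D_Y: assumes "a \<in> carrier V" "b \<in> carrier V"
  shows "D (Y a n b) = Y a n (D b) \<oplus>\<^bsub>V\<^esub> of_int (- n) \<odot>\<^bsub>V\<^esub> Y a (n - 1) b"
proof -
  note v = vac_closed
  have av: "Y a k vac = \<zero>\<^bsub>V\<^esub>" "Y b k vac = \<zero>\<^bsub>V\<^esub>" if "k \<ge> 0" for k using creation assms that by auto
  let ?f = "\<lambda>i::nat. ((-1) ^ i * (of_int n gchoose i)) \<odot>\<^bsub>V\<^esub> Y a (n + 0 - int i) (Y b (-2 + int i) vac)"
  let ?g = "\<lambda>i::nat. ((-1) powi n * (-1) ^ i * (of_int n gchoose i)) \<odot>\<^bsub>V\<^esub> Y b (n + -2 - int i) (Y a (0 + int i) vac)"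
  let ?h = "\<lambda>i::nat. (of_int 0 gchoose i) \<odot>\<^bsub>V\<^esub> Y (Y a (n + int i) b) (0 + -2 - int i) vac"
  have "supp_sum V ?f \<ominus>\<^bsub>V\<^esub> supp_sum V ?g = supp_sum V ?h"
    by (rule jacobi) (use assms v in auto)
  moreover have "supp_sum V ?h = D (Y a n b)"
  proof -
    have "supp_sum V ?h = ?h 0"
      by (rule ssum_single) (simp_all add: Y_closed v assms)
    then show ?thesis using assms v by (simp add: transl_def Y_closed)
  qed
  moreover have "supp_sum V ?g = \<zero>\<^bsub>V\<^esub>" by (rule ssum_zero) (simp add: av assms)
  moreover have "supp_sum V ?f = Y a n (D b) \<oplus>\<^bsub>V\<^esub> of_int (- n) \<odot>\<^bsub>V\<^esub> Y a (n - 1) b"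
  proof -
    have z: "?f i = \<zero>\<^bsub>V\<^esub>" if "i \<noteq> 0" "i \<noteq> 1" for i using that assms by (simp add: av)
    have fc: "?f i \<in> carrier V" for i using assms v by (simp add: Y_closed)
    have "supp_sum V ?f = ?f 0 \<oplus>\<^bsub>V\<^esub> ?f 1" by (rule ssum_two) (rule fc, rule z)
    then show ?thesis using assms by (simp add: transl_def creation Y_closed vac_closed)
  qed
  ultimately show ?thesis using assms by (simp add: Y_closed M.minus_eq)
qed

lemma DD_eq: "hat_transl V Y vac f = (\<lambda>n. D (f n) \<oplus>\<^bsub>V\<^esub> of_int (n + 1) \<odot>\<^bsub>V\<^esub> f (n + 1))"
  by (simp add: hat_transl_def)

abbreviation "DD \<equiv> hat_transl V Y vac"

lemma DD_closed: assumes "f \<in> carrier Lau" shows "DD f \<in> carrier Lau"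
proof -
  have "{n. DD f n \<noteq> \<zero>\<^bsub>V\<^esub>} \<subseteq> {n. f n \<noteq> \<zero>\<^bsub>V\<^esub>} \<union> (\<lambda>n. n - 1) ` {n. f n \<noteq> \<zero>\<^bsub>V\<^esub>}"
  proof
    fix n assume "n \<in> {n. DD f n \<noteq> \<zero>\<^bsub>V\<^esub>}"
    then have "f n \<noteq> \<zero>\<^bsub>V\<^esub> \<or> f (n + 1) \<noteq> \<zero>\<^bsub>V\<^esub>" by (auto simp: DD_eq)
    moreover have "n = (n + 1) - 1" by simp
    ultimately show "n \<in> {n. f n \<noteq> \<zero>\<^bsub>V\<^esub>} \<union> (\<lambda>n. n - 1) ` {n. f n \<noteq> \<zero>\<^bsub>V\<^esub>}" by blast
  qed
  then have "finite {n. DD f n \<noteq> \<zero>\<^bsub>V\<^esub>}" by (rule finite_subset) (use assms in \<open>simp add: Lau_simps\<close>)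
  moreover have "DD f n \<in> carrier V" for n using Lau_closed(1)[OF assms] by (simp add: DD_eq)
  ultimately show ?thesis unfolding Lau_simps by blast
qed

lemma DD_add: "f \<in> carrier Lau \<Longrightarrow> g \<in> carrier Lau \<Longrightarrow> DD (f \<oplus>\<^bsub>Lau\<^esub> g) = DD f \<oplus>\<^bsub>Lau\<^esub> DD g"
  by (rule ext) (simp add: DD_eq Lau_simps(3) D_add Lau_closed(1) VM.sm_add_right M.a_ac)

lemma DD_smult: "f \<in> carrier Lau \<Longrightarrow> DD (c \<odot>\<^bsub>Lau\<^esub> f) = c \<odot>\<^bsub>Lau\<^esub> DD f"
  by (rule ext) (simp add: DD_eq Lau_simps(4) D_smult Lau_closed(1) VM.sm_add_right VM.sm_assoc[symmetric] mult.commute)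

lemma DD_mono: assumes a: "a \<in> carrier V"
  shows "DD (tmono V a m) = tmono V (D a) m \<oplus>\<^bsub>Lau\<^esub> tmono V (of_int m \<odot>\<^bsub>V\<^esub> a) (m - 1)"
  by (rule ext) (use a in \<open>auto simp: DD_eq tmono_def Lau_simps\<close>)


abbreviation "N \<equiv> hat_transl_image V Y vac"

lemma N_eq: "N = DD ` carrier Lau" by (simp add: hat_transl_image_def hat_simps)

lemma N_submodule: "submodule N cfield Lau"
proof (rule LM.submoduleI')
  show "N \<subseteq> carrier Lau" using DD_closed by (auto simp: N_eq)
  show "\<zero>\<^bsub>Lau\<^esub> \<in> N"
  proof -
    have "DD \<zero>\<^bsub>Lau\<^esub> = \<zero>\<^bsub>Lau\<^esub>" using DD_smult[of "\<zero>\<^bsub>Lau\<^esub>" 0] DD_closed[of "\<zero>\<^bsub>Lau\<^esub>"] by simp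
    then show ?thesis unfolding N_eq by (metis LM.M.zero_closed imageI)
  qed
  show "x \<oplus>\<^bsub>Lau\<^esub> y \<in> N" if "x \<in> N" "y \<in> N" for x y
    using that unfolding N_eq by (auto simp: DD_add[symmetric])
  show "c \<odot>\<^bsub>Lau\<^esub> x \<in> N" if "x \<in> N" for x c
    using that unfolding N_eq by (auto simp: DD_smult[symmetric])
qed

lemma N_submodule_hat: "submodule N cfield (hat_space V Y)"
  using N_submodule by (simp add: submodule_def submodule_axioms_def hat_simps cong: )

subsection \<open>The bracket\<close>

text \<open>Identities of Laurent polynomials are checked after an embedding into a type, where the calculus of
  binomially weighted sums is available.\<close>

definition iota :: "(int \<Rightarrow> 'a) \<Rightarrow> ((int \<Rightarrow> 'a) \<Rightarrow>\<^sub>0 complex)" where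
  "iota = (SOME f. module_embedded Lau psc f)"

lemma iota: "module_embedded Lau psc iota"
proof -
  obtain f :: "(int \<Rightarrow> 'a) \<Rightarrow> ((int \<Rightarrow> 'a) \<Rightarrow>\<^sub>0 complex)" where "module_embedded Lau psc f"
    by (rule obtain_module_embedded[OF Lau_module])
  then show ?thesis unfolding iota_def by (rule someI[of "\<lambda>f. module_embedded Lau psc f"])
qed

sublocale io: module_embedded Lau psc iota by (rule iota)

lemmas iota_hb = mlin_hb(1)[OF io.module_map_axioms] and iota_ev = mlin_hb(2)[OF io.module_map_axioms]

lemma hb_eqI: "x \<in> carrier Lau \<Longrightarrow> y \<in> carrier Lau \<Longrightarrow> iota x = iota y \<Longrightarrow> x = y"
  using io.f_eq_iff by blast

lemma hb_add_left:
  assumes "a \<in> carrier V" "a' \<in> carrier V" "b \<in> carrier V"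
  shows "hb (a \<oplus>\<^bsub>V\<^esub> a') m b n = hb a m b n \<oplus>\<^bsub>Lau\<^esub> hb a' m b n"
  by (rule hb_eqI) (use assms in \<open>simp_all add: io.f_add iota_hb Y_add_left tmono_add Y_closed PM.bin_add iota_ev\<close>)

lemma hb_add_right:
  assumes "a \<in> carrier V" "b \<in> carrier V" "b' \<in> carrier V"
  shows "hb a m (b \<oplus>\<^bsub>V\<^esub> b') n = hb a m b n \<oplus>\<^bsub>Lau\<^esub> hb a m b' n"
  by (rule hb_eqI) (use assms in \<open>simp_all add: io.f_add iota_hb Y_add_right tmono_add Y_closed PM.bin_add iota_ev\<close>)

lemma hb_smult_left:
  assumes "a \<in> carrier V" "b \<in> carrier V"
  shows "hb (c \<odot>\<^bsub>V\<^esub> a) m b n = c \<odot>\<^bsub>Lau\<^esub> hb a m b n"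
  by (rule hb_eqI) (use assms in \<open>simp_all add: io.f_scale iota_hb Y_smult_left tmono_smult Y_closed PM.bin_scale iota_ev\<close>)

lemma hb_smult_right:
  assumes "a \<in> carrier V" "b \<in> carrier V"
  shows "hb a m (c \<odot>\<^bsub>V\<^esub> b) n = c \<odot>\<^bsub>Lau\<^esub> hb a m b n"
  by (rule hb_eqI) (use assms in \<open>simp_all add: io.f_scale iota_hb Y_smult_right tmono_smult Y_closed PM.bin_scale iota_ev\<close>)

lemma hb_zero: "b \<in> carrier V \<Longrightarrow> hb \<zero>\<^bsub>V\<^esub> m b n = \<zero>\<^bsub>Lau\<^esub>" "a \<in> carrier V \<Longrightarrow> hb a m \<zero>\<^bsub>V\<^esub> n = \<zero>\<^bsub>Lau\<^esub>"
  using hb_smult_left[of "\<zero>\<^bsub>V\<^esub>" b 0 m n] hb_smult_right[of a "\<zero>\<^bsub>V\<^esub>" m 0 n] by simp_all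

lemma hat_bracket_alt:
  "hat_bracket V Y f g = (\<Oplus>\<^bsub>Lau\<^esub>m\<in>{m. f m \<noteq> \<zero>\<^bsub>V\<^esub>}. \<Oplus>\<^bsub>Lau\<^esub>n\<in>{n. g n \<noteq> \<zero>\<^bsub>V\<^esub>}. hb (f m) m (g n) n)"
  by (simp add: hat_bracket_def hb_def)

lemma hat_bracket_closed [simp]: "f \<in> carrier Lau \<Longrightarrow> g \<in> carrier Lau \<Longrightarrow> hat_bracket V Y f g \<in> carrier Lau"
  unfolding hat_bracket_alt by (intro LM.M.finsum_closed) (auto simp: Lau_closed(1) intro!: LM.M.finsum_closed)

lemma iota_bracket:
  assumes f: "f \<in> carrier Lau" and g: "g \<in> carrier Lau"
    and A: "finite A" "{m. f m \<noteq> \<zero>\<^bsub>V\<^esub>} \<subseteq> A" and B: "finite B" "{m. g m \<noteq> \<zero>\<^bsub>V\<^esub>} \<subseteq> B"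
  shows "iota (hat_bracket V Y f g) = (\<Sum>m\<in>A. \<Sum>n\<in>B. iota (hb (f m) m (g n) n))"
proof -
  note c = Lau_closed(1)[OF f] Lau_closed(1)[OF g]
  have "iota (hat_bracket V Y f g) = (\<Sum>m\<in>{m. f m \<noteq> \<zero>\<^bsub>V\<^esub>}. iota (\<Oplus>\<^bsub>Lau\<^esub>n\<in>{n. g n \<noteq> \<zero>\<^bsub>V\<^esub>}. hb (f m) m (g n) n))"
    unfolding hat_bracket_alt by (rule io.f_finsum) (auto intro!: LM.M.finsum_closed simp: c)
  also have "\<dots> = (\<Sum>m\<in>{m. f m \<noteq> \<zero>\<^bsub>V\<^esub>}. \<Sum>n\<in>{n. g n \<noteq> \<zero>\<^bsub>V\<^esub>}. iota (hb (f m) m (g n) n))"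
    by (intro sum.cong refl io.f_finsum) (simp add: c)
  also have "\<dots> = (\<Sum>m\<in>{m. f m \<noteq> \<zero>\<^bsub>V\<^esub>}. \<Sum>n\<in>B. iota (hb (f m) m (g n) n))"
    by (intro sum.cong refl sum.mono_neutral_left B) (auto simp: hb_zero c)
  also have "\<dots> = (\<Sum>m\<in>A. \<Sum>n\<in>B. iota (hb (f m) m (g n) n))"
    by (intro sum.mono_neutral_left A) (auto simp: hb_zero c)
  finally show ?thesis .
qed

lemma hat_bracket_add_left:
  assumes f: "f \<in> carrier Lau" and f': "f' \<in> carrier Lau" and g: "g \<in> carrier Lau"
  shows "hat_bracket V Y (f \<oplus>\<^bsub>Lau\<^esub> f') g = hat_bracket V Y f g \<oplus>\<^bsub>Lau\<^esub> hat_bracket V Y f' g"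
proof (rule hb_eqI)
  let ?A = "{m. f m \<noteq> \<zero>\<^bsub>V\<^esub>} \<union> {m. f' m \<noteq> \<zero>\<^bsub>V\<^esub>}" and ?B = "{m. g m \<noteq> \<zero>\<^bsub>V\<^esub>}"
  have fin: "finite ?A" "finite ?B" using f f' g by (auto simp: Lau_simps)
  note c = Lau_closed(1)[OF f] Lau_closed(1)[OF f'] Lau_closed(1)[OF g]
  have e: "(f \<oplus>\<^bsub>Lau\<^esub> f') m = f m \<oplus>\<^bsub>V\<^esub> f' m" for m by (simp add: Lau_simps(3))
  have sub: "{m. (f \<oplus>\<^bsub>Lau\<^esub> f') m \<noteq> \<zero>\<^bsub>V\<^esub>} \<subseteq> ?A" by (auto simp: e)
  have e2: "hb ((f \<oplus>\<^bsub>Lau\<^esub> f') m) m (g n) n = hb (f m) m (g n) n \<oplus>\<^bsub>Lau\<^esub> hb (f' m) m (g n) n" for m n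
    unfolding e by (rule hb_add_left) (rule c)+
  show "iota (hat_bracket V Y (f \<oplus>\<^bsub>Lau\<^esub> f') g) = iota (hat_bracket V Y f g \<oplus>\<^bsub>Lau\<^esub> hat_bracket V Y f' g)"
    using iota_bracket[OF LM.M.a_closed[OF f f'] g fin(1) sub fin(2)]
      iota_bracket[OF f g fin(1) _ fin(2)] iota_bracket[OF f' g fin(1) _ fin(2)] f f' g
    by (simp add: e2 io.f_add c sum.distrib)
qed (use assms in simp_all)

lemma hat_bracket_add_right:
  assumes f: "f \<in> carrier Lau" and f': "f' \<in> carrier Lau" and g: "g \<in> carrier Lau"
  shows "hat_bracket V Y g (f \<oplus>\<^bsub>Lau\<^esub> f') = hat_bracket V Y g f \<oplus>\<^bsub>Lau\<^esub> hat_bracket V Y g f'"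
proof (rule hb_eqI)
  let ?A = "{m. f m \<noteq> \<zero>\<^bsub>V\<^esub>} \<union> {m. f' m \<noteq> \<zero>\<^bsub>V\<^esub>}" and ?B = "{m. g m \<noteq> \<zero>\<^bsub>V\<^esub>}"
  have fin: "finite ?A" "finite ?B" using f f' g by (auto simp: Lau_simps)
  note c = Lau_closed(1)[OF f] Lau_closed(1)[OF f'] Lau_closed(1)[OF g]
  have e: "(f \<oplus>\<^bsub>Lau\<^esub> f') m = f m \<oplus>\<^bsub>V\<^esub> f' m" for m by (simp add: Lau_simps(3))
  have sub: "{m. (f \<oplus>\<^bsub>Lau\<^esub> f') m \<noteq> \<zero>\<^bsub>V\<^esub>} \<subseteq> ?A" by (auto simp: e)
  have e2: "hb (g m) m ((f \<oplus>\<^bsub>Lau\<^esub> f') n) n = hb (g m) m (f n) n \<oplus>\<^bsub>Lau\<^esub> hb (g m) m (f' n) n" for m n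
    unfolding e by (rule hb_add_right) (rule c)+
  show "iota (hat_bracket V Y g (f \<oplus>\<^bsub>Lau\<^esub> f')) = iota (hat_bracket V Y g f \<oplus>\<^bsub>Lau\<^esub> hat_bracket V Y g f')"
    using iota_bracket[OF g LM.M.a_closed[OF f f'] fin(2) _ fin(1) sub]
      iota_bracket[OF g f fin(2) _ fin(1)] iota_bracket[OF g f' fin(2) _ fin(1)] f f' g
    by (simp add: e2 io.f_add c sum.distrib)
qed (use assms in simp_all)

lemma hat_bracket_smult_left:
  assumes f: "f \<in> carrier Lau" and g: "g \<in> carrier Lau"
  shows "hat_bracket V Y (c \<odot>\<^bsub>Lau\<^esub> f) g = c \<odot>\<^bsub>Lau\<^esub> hat_bracket V Y f g"
proof (rule hb_eqI)
  let ?A = "{m. f m \<noteq> \<zero>\<^bsub>V\<^esub>}" and ?B = "{m. g m \<noteq> \<zero>\<^bsub>V\<^esub>}"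
  have fin: "finite ?A" "finite ?B" using f g by (auto simp: Lau_simps)
  note cc = Lau_closed(1)[OF f] Lau_closed(1)[OF g]
  have e: "(c \<odot>\<^bsub>Lau\<^esub> f) m = c \<odot>\<^bsub>V\<^esub> f m" for m by (simp add: Lau_simps(4))
  have sub: "{m. (c \<odot>\<^bsub>Lau\<^esub> f) m \<noteq> \<zero>\<^bsub>V\<^esub>} \<subseteq> ?A" by (auto simp: e)
  have e2: "hb ((c \<odot>\<^bsub>Lau\<^esub> f) m) m (g n) n = c \<odot>\<^bsub>Lau\<^esub> hb (f m) m (g n) n" for m n
    unfolding e by (rule hb_smult_left) (rule cc)+
  show "iota (hat_bracket V Y (c \<odot>\<^bsub>Lau\<^esub> f) g) = iota (c \<odot>\<^bsub>Lau\<^esub> hat_bracket V Y f g)"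
    using iota_bracket[OF LM.sm_closed[OF f] g fin(1) sub fin(2)] iota_bracket[OF f g fin(1) _ fin(2)] f g
    by (simp add: e2 io.f_scale cc PM.scale_sum_right)
qed (use assms in simp_all)

lemma hat_bracket_smult_right:
  assumes f: "f \<in> carrier Lau" and g: "g \<in> carrier Lau"
  shows "hat_bracket V Y g (c \<odot>\<^bsub>Lau\<^esub> f) = c \<odot>\<^bsub>Lau\<^esub> hat_bracket V Y g f"
proof (rule hb_eqI)
  let ?A = "{m. f m \<noteq> \<zero>\<^bsub>V\<^esub>}" and ?B = "{m. g m \<noteq> \<zero>\<^bsub>V\<^esub>}"
  have fin: "finite ?A" "finite ?B" using f g by (auto simp: Lau_simps)
  note cc = Lau_closed(1)[OF f] Lau_closed(1)[OF g]
  have e: "(c \<odot>\<^bsub>Lau\<^esub> f) m = c \<odot>\<^bsub>V\<^esub> f m" for m by (simp add: Lau_simps(4))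
  have sub: "{m. (c \<odot>\<^bsub>Lau\<^esub> f) m \<noteq> \<zero>\<^bsub>V\<^esub>} \<subseteq> ?A" by (auto simp: e)
  have e2: "hb (g m) m ((c \<odot>\<^bsub>Lau\<^esub> f) n) n = c \<odot>\<^bsub>Lau\<^esub> hb (g m) m (f n) n" for m n
    unfolding e by (rule hb_smult_right) (rule cc)+
  show "iota (hat_bracket V Y g (c \<odot>\<^bsub>Lau\<^esub> f)) = iota (c \<odot>\<^bsub>Lau\<^esub> hat_bracket V Y g f)"
    using iota_bracket[OF g LM.sm_closed[OF f] fin(2) _ fin(1) sub] iota_bracket[OF g f fin(2) _ fin(1)] f g
    by (simp add: e2 io.f_scale cc PM.scale_sum_right)
qed (use assms in simp_all)

lemma hat_bracket_mono:
  assumes "a \<in> carrier V" "b \<in> carrier V"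
  shows "hat_bracket V Y (tmono V a m) (tmono V b n) = hb a m b n"
proof (rule hb_eqI)
  have "{k. tmono V a m k \<noteq> \<zero>\<^bsub>V\<^esub>} \<subseteq> {m}" "{k. tmono V b n k \<noteq> \<zero>\<^bsub>V\<^esub>} \<subseteq> {n}" by (auto simp: tmono_def)
  then have "iota (hat_bracket V Y (tmono V a m) (tmono V b n)) = (\<Sum>k\<in>{m}. \<Sum>l\<in>{n}. iota (hb (tmono V a m k) k (tmono V b n l) l))"
    using assms by (intro iota_bracket) auto
  then show "iota (hat_bracket V Y (tmono V a m) (tmono V b n)) = iota (hb a m b n)" by (simp add: tmono_def)
qed (use assms in simp_all)

lemma DD_mlin: "module_map Lau psc (\<lambda>f. iota (DD f))"
  by (intro module_map.intro module_map_axioms.intro LM.complex_module_axioms PM.complex_space_axioms)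
    (simp_all add: DD_add DD_smult io.f_add io.f_scale DD_closed)

text \<open>In the \<open>i\<close>-th term, \<open>D\<close> contributes the factor \<open>-i\<close> and \<open>d/dt\<close> the factor \<open>m\<close>; they cancel by
  \<open>i (m choose i) = m ((m - 1) choose (i - 1))\<close>.\<close>

lemma DD_bracket_left_mono:
  assumes a: "a \<in> carrier V" and b: "b \<in> carrier V"
  shows "hat_bracket V Y (DD (tmono V a m)) (tmono V b n) = \<zero>\<^bsub>Lau\<^esub>"
proof (rule hb_eqI)
  define h where "h = (\<lambda>i::nat. iota (tmono V (Y a (int i - 1) b) (m + n - int i)))"
  have hS: "h (Suc i) = iota (tmono V (Y a (int i) b) (m - 1 + n - int i))" for i by (simp add: h_def algebra_simps)
  have ev: "ev0 (\<lambda>i. h (Suc i))" unfolding hS using iota_ev[OF a b] .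
  then have evh: "ev0 h" by (rule ev0_SucD)
  have "iota (tmono V (Y (D a) (int i) b) (m + n - int i)) = psc (-1) (psc (of_int (int i)) (h i))" for i
    using a b by (simp add: Y_D tmono_smult Y_closed io.f_scale h_def)
  then have "iota (hb (D a) m b n) = PM.bin 1 m (\<lambda>i. psc (-1) (psc (of_int (int i)) (h i)))"
    using iota_hb[OF D_closed[OF a] b] by simp
  also have "\<dots> = psc (-1) (PM.bin 1 m (\<lambda>i. psc (of_int (int i)) (h i)))"
    by (rule PM.bin_scale) (rule ev0_map[OF evh], simp)
  also have "\<dots> = psc (-1) (psc (1 * of_int m) (PM.bin 1 (m - 1) (\<lambda>i. h (Suc i))))"
    unfolding PM.bin_absorb[OF evh] ..
  also have "PM.bin 1 (m - 1) (\<lambda>i. h (Suc i)) = iota (hb a (m - 1) b n)"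
    unfolding hS using iota_hb[OF a b] by simp
  finally have "iota (hb (D a) m b n) = - psc (of_int m) (iota (hb a (m - 1) b n))" by simp
  moreover have "hat_bracket V Y (DD (tmono V a m)) (tmono V b n) = hb (D a) m b n \<oplus>\<^bsub>Lau\<^esub> of_int m \<odot>\<^bsub>Lau\<^esub> hb a (m - 1) b n"
    using a b by (simp add: DD_mono hat_bracket_add_left hat_bracket_mono hb_smult_left)
  ultimately show "iota (hat_bracket V Y (DD (tmono V a m)) (tmono V b n)) = iota \<zero>\<^bsub>Lau\<^esub>"
    using a b by (simp add: io.f_add io.f_scale)
qed (use assms DD_closed in simp_all)

text \<open>The operator \<open>D \<otimes> 1 + 1 \<otimes> d/dt\<close> is a derivation of the bracket, and on the left argument it
  gives zero by \<open>DD_bracket_left_mono\<close>.\<close>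

lemma DD_bracket_right_mono:
  assumes a: "a \<in> carrier V" and b: "b \<in> carrier V"
  shows "hat_bracket V Y (tmono V a m) (DD (tmono V b n)) = DD (hat_bracket V Y (tmono V a m) (tmono V b n))"
proof (rule hb_eqI)
  define h where "h = (\<lambda>i::nat. iota (tmono V (Y a (int i - 1) b) (m + n - int i)))"
  define g where "g = (\<lambda>i::nat. iota (tmono V (Y a (int i) (D b)) (m + n - int i)))"
  have hS: "h (Suc i) = iota (tmono V (Y a (int i) b) (m + (n - 1) - int i))" for i by (simp add: h_def algebra_simps)
  have evS: "ev0 (\<lambda>i. h (Suc i))" unfolding hS using iota_ev[OF a b] .
  then have evh: "ev0 h" by (rule ev0_SucD)
  have evg: "ev0 g" unfolding g_def using iota_ev[OF a D_closed[OF b]] .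
  have evs: "ev0 (\<lambda>i. psc (f i) (h i))" "ev0 (\<lambda>i. psc (f i) (h (Suc i)))" for f
    by (rule ev0_map[OF evh], simp, rule ev0_map[OF evS], simp)
  have "iota (DD (tmono V (Y a (int i) b) (m + n - int i))) =
     g i - psc (of_int (int i)) (h i) + (psc (of_int (m - int i)) (h (Suc i)) + psc (of_int n) (h (Suc i)))" for i
  proof -
    have "iota (DD (tmono V (Y a (int i) b) (m + n - int i))) = iota (tmono V (D (Y a (int i) b)) (m + n - int i)) + psc (of_int (m + n - int i)) (h (Suc i))"
      using a b by (simp add: DD_mono Y_closed io.f_add tmono_smult io.f_scale h_def algebra_simps)
    moreover have "iota (tmono V (D (Y a (int i) b)) (m + n - int i)) = g i - psc (of_int (int i)) (h i)"
      using a b by (simp add: D_Y tmono_add tmono_smult Y_closed io.f_add io.f_scale h_def g_def)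
    moreover have "psc (of_int (m + n - int i)) (h (Suc i)) = psc (of_int (m - int i)) (h (Suc i)) + psc (of_int n) (h (Suc i))"
      by (simp only: PM.scale_left_distrib[symmetric]) (simp add: algebra_simps)
    ultimately show ?thesis by simp
  qed
  then have "iota (DD (hb a m b n)) = PM.bin 1 m (\<lambda>i. g i - psc (of_int (int i)) (h i) + (psc (of_int (m - int i)) (h (Suc i)) + psc (of_int n) (h (Suc i))))"
    using mlin_hb(1)[OF DD_mlin a b, of m n] by simp
  also have "\<dots> = PM.bin 1 m g - PM.bin 1 m (\<lambda>i. psc (of_int (int i)) (h i)) +
     (PM.bin 1 m (\<lambda>i. psc (of_int (m - int i)) (h (Suc i))) + psc (of_int n) (PM.bin 1 m (\<lambda>i. h (Suc i))))"
    by (simp only: PM.bin_add[OF ev0_diff[OF evg evs(1)] ev0_add[OF evs(2) evs(2)]] PM.bin_diff[OF evg evs(1)]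
        PM.bin_add[OF evs(2) evs(2)] PM.bin_scale[OF evS])
  also have "\<dots> = PM.bin 1 m g + psc (of_int n) (PM.bin 1 m (\<lambda>i. h (Suc i)))"
    using PM.bin_weight[OF evh, of 1 1 m] by simp
  also have "PM.bin 1 m g = iota (hb a m (D b) n)" unfolding g_def using iota_hb[OF a D_closed[OF b]] by simp
  also have "PM.bin 1 m (\<lambda>i. h (Suc i)) = iota (hb a m b (n - 1))" unfolding hS using iota_hb[OF a b] by simp
  finally have "iota (DD (hb a m b n)) = iota (hb a m (D b) n) + psc (of_int n) (iota (hb a m b (n - 1)))" .
  moreover have "hat_bracket V Y (tmono V a m) (DD (tmono V b n)) = hb a m (D b) n \<oplus>\<^bsub>Lau\<^esub> of_int n \<odot>\<^bsub>Lau\<^esub> hb a m b (n - 1)"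
    using a b by (simp add: DD_mono hat_bracket_add_right hat_bracket_mono hb_smult_right)
  ultimately show "iota (hat_bracket V Y (tmono V a m) (DD (tmono V b n))) = iota (DD (hat_bracket V Y (tmono V a m) (tmono V b n)))"
    using a b by (simp add: io.f_add io.f_scale hat_bracket_mono)
qed (use assms DD_closed in simp_all)

lemma N_ideal_left: assumes f: "f \<in> carrier Lau" and g: "g \<in> carrier Lau"
  shows "hat_bracket V Y (DD f) g \<in> N"
  using f
proof (induction f rule: laurent_induct)
  case (mono a m)
  show ?case using g
  proof (induction g rule: laurent_induct)
    case (mono b n)
    then show ?case using DD_bracket_left_mono[OF \<open>a \<in> carrier V\<close> mono] LM.submoduleD(2)[OF N_submodule] by simp
  next
    case (add g g')
    then show ?case using hat_bracket_add_right[OF add(1,2) DD_closed[OF tmono_closed[OF \<open>a \<in> carrier V\<close>]]] LM.submoduleD(3)[OF N_submodule] by simp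
  qed
next
  case (add f f')
  then show ?case using hat_bracket_add_left[OF DD_closed DD_closed g] LM.submoduleD(3)[OF N_submodule] by (simp add: DD_add)
qed

lemma N_ideal_right: assumes f: "f \<in> carrier Lau" and g: "g \<in> carrier Lau"
  shows "hat_bracket V Y f (DD g) \<in> N"
proof -
  have "hat_bracket V Y f (DD g) = DD (hat_bracket V Y f g)"
    using f
  proof (induction f rule: laurent_induct)
    case (mono a m)
    show ?case using g
    proof (induction g rule: laurent_induct)
      case (mono b n)
      then show ?case using DD_bracket_right_mono[OF \<open>a \<in> carrier V\<close> mono] by simp
    next
      case (add g g')
      then show ?case using \<open>a \<in> carrier V\<close> by (simp add: DD_add hat_bracket_add_right DD_closed)
    qed
  next
    case (add f f')
    then show ?case using g by (simp add: DD_add hat_bracket_add_left DD_closed)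
  qed
  then show ?thesis using assms by (simp add: N_eq)
qed

end

subsection \<open>The quotient by the image of the translation operator\<close>

context vertex_algebra_modes
begin

definition "L = gV V Y vac"
definition "q f = N +>\<^bsub>hat_space V Y\<^esub> f"

abbreviation "gm \<equiv> gmode V Y vac"

sublocale HQ: subspace_quotient "hat_space V Y" N
  by (intro subspace_quotientI hat_module N_submodule_hat)

lemma gm_q: "gm a m = q (tmono V a m)"
  by (simp add: gmode_def q_def)

lemma L_quot: "L = quot (hat_space V Y) N"
  by (simp add: L_def gV_def)

lemma L_module: "module cfield L" unfolding L_quot by (rule HQ.quot_module)

sublocale Lm: complex_module L by (rule complex_moduleI) (rule L_module)

lemma L_carrier: "carrier L = q ` carrier Lau"
  unfolding L_quot HQ.quot_carrier q_def by (simp add: hat_simps)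

lemma q_closed [simp]: "f \<in> carrier Lau \<Longrightarrow> q f \<in> carrier L" by (simp add: L_carrier)

lemma q_add: "f \<in> carrier Lau \<Longrightarrow> g \<in> carrier Lau \<Longrightarrow> q (f \<oplus>\<^bsub>Lau\<^esub> g) = q f \<oplus>\<^bsub>L\<^esub> q g"
  using HQ.coset_add[of f g] by (simp add: L_quot q_def hat_simps)

lemma q_smult: "f \<in> carrier Lau \<Longrightarrow> q (c \<odot>\<^bsub>Lau\<^esub> f) = c \<odot>\<^bsub>L\<^esub> q f"
  using HQ.coset_smult[of f c] by (simp add: L_quot q_def hat_simps)

lemma q_N: "f \<in> N \<Longrightarrow> q f = \<zero>\<^bsub>L\<^esub>"
  using HQ.coset_mem[of f] by (simp add: L_quot q_def HQ.quot_zero)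

lemma q_zero: "q \<zero>\<^bsub>Lau\<^esub> = \<zero>\<^bsub>L\<^esub>"
  using q_N LM.submoduleD(2)[OF N_submodule] by blast

text \<open>The product of two cosets is a union over all representatives.  It is a single coset, as the image of
  \<open>D \<otimes> 1 + 1 \<otimes> d/dt\<close> is an ideal for the bracket on either side.\<close>

lemma q_mult: assumes f: "f \<in> carrier Lau" and g: "g \<in> carrier Lau"
  shows "q f \<otimes>\<^bsub>L\<^esub> q g = q (hat_bracket V Y f g)"
proof -
  have Nc: "x \<in> carrier Lau" if "x \<in> N" for x using LM.submoduleD(1)[OF N_submodule] that by blast
  have *: "q (hat_bracket V Y a b) = q (hat_bracket V Y f g)" if "a \<in> q f" "b \<in> q g" for a b
  proof -
    obtain n n' where n: "n \<in> N" "a = n \<oplus>\<^bsub>Lau\<^esub> f" and n': "n' \<in> N" "b = n' \<oplus>\<^bsub>Lau\<^esub> g"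
      using \<open>a \<in> q f\<close> \<open>b \<in> q g\<close> unfolding q_def HQ.mem_coset hat_simps by blast
    have b: "b \<in> carrier Lau" using n' Nc g by simp
    have z: "q (hat_bracket V Y n b) = \<zero>\<^bsub>L\<^esub>" "q (hat_bracket V Y f n') = \<zero>\<^bsub>L\<^esub>"
      using n(1) n'(1) N_ideal_left[OF _ b] N_ideal_right[OF f] q_N unfolding N_eq by blast+
    have "q (hat_bracket V Y a b) = q (hat_bracket V Y n b) \<oplus>\<^bsub>L\<^esub> q (hat_bracket V Y f b)"
      using n Nc f b by (simp add: hat_bracket_add_left q_add)
    also have "q (hat_bracket V Y f b) = q (hat_bracket V Y f n') \<oplus>\<^bsub>L\<^esub> q (hat_bracket V Y f g)"
      using n' Nc f g by (simp add: hat_bracket_add_right q_add)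
    finally show ?thesis using f g by (simp add: z)
  qed
  have "f \<in> q f" "g \<in> q g" using HQ.Q.a_rcos_self f g by (simp_all add: q_def hat_simps)
  have "q f \<otimes>\<^bsub>L\<^esub> q g = (\<Union>a\<in>q f. \<Union>b\<in>q g. q (hat_bracket V Y a b))"
    by (simp add: L_quot quot_def rcoset_mult_def q_def hat_simps)
  also have "\<dots> = q (hat_bracket V Y f g)"
    using * \<open>f \<in> q f\<close> \<open>g \<in> q g\<close> by blast
  finally show ?thesis .
qed

lemma L_mult_closed: "x \<in> carrier L \<Longrightarrow> y \<in> carrier L \<Longrightarrow> x \<otimes>\<^bsub>L\<^esub> y \<in> carrier L"
  by (auto simp: L_carrier q_mult)

lemma L_mult_lin:
  assumes "x \<in> carrier L" "y \<in> carrier L" "z \<in> carrier L"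
  shows "(x \<oplus>\<^bsub>L\<^esub> y) \<otimes>\<^bsub>L\<^esub> z = x \<otimes>\<^bsub>L\<^esub> z \<oplus>\<^bsub>L\<^esub> y \<otimes>\<^bsub>L\<^esub> z" "z \<otimes>\<^bsub>L\<^esub> (x \<oplus>\<^bsub>L\<^esub> y) = z \<otimes>\<^bsub>L\<^esub> x \<oplus>\<^bsub>L\<^esub> z \<otimes>\<^bsub>L\<^esub> y"
    "(c \<odot>\<^bsub>L\<^esub> x) \<otimes>\<^bsub>L\<^esub> z = c \<odot>\<^bsub>L\<^esub> (x \<otimes>\<^bsub>L\<^esub> z)" "z \<otimes>\<^bsub>L\<^esub> (c \<odot>\<^bsub>L\<^esub> x) = c \<odot>\<^bsub>L\<^esub> (z \<otimes>\<^bsub>L\<^esub> x)"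
proof -
  obtain f g h where fgh: "f \<in> carrier Lau" "g \<in> carrier Lau" "h \<in> carrier Lau" "x = q f" "y = q g" "z = q h"
    using assms unfolding L_carrier by blast
  show "(x \<oplus>\<^bsub>L\<^esub> y) \<otimes>\<^bsub>L\<^esub> z = x \<otimes>\<^bsub>L\<^esub> z \<oplus>\<^bsub>L\<^esub> y \<otimes>\<^bsub>L\<^esub> z" "z \<otimes>\<^bsub>L\<^esub> (x \<oplus>\<^bsub>L\<^esub> y) = z \<otimes>\<^bsub>L\<^esub> x \<oplus>\<^bsub>L\<^esub> z \<otimes>\<^bsub>L\<^esub> y"
    "(c \<odot>\<^bsub>L\<^esub> x) \<otimes>\<^bsub>L\<^esub> z = c \<odot>\<^bsub>L\<^esub> (x \<otimes>\<^bsub>L\<^esub> z)" "z \<otimes>\<^bsub>L\<^esub> (c \<odot>\<^bsub>L\<^esub> x) = c \<odot>\<^bsub>L\<^esub> (z \<otimes>\<^bsub>L\<^esub> x)"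
    using fgh
    by (simp_all add: q_mult q_add[symmetric] q_smult[symmetric] hat_bracket_add_left hat_bracket_add_right
        hat_bracket_smult_left hat_bracket_smult_right)
qed

lemma gm_closed [simp]: "a \<in> carrier V \<Longrightarrow> gm a m \<in> carrier L" by (simp add: gm_q)

lemma gm_add: "a \<in> carrier V \<Longrightarrow> b \<in> carrier V \<Longrightarrow> gm (a \<oplus>\<^bsub>V\<^esub> b) m = gm a m \<oplus>\<^bsub>L\<^esub> gm b m"
  by (simp add: gm_q tmono_add q_add)

lemma gm_smult: "a \<in> carrier V \<Longrightarrow> gm (c \<odot>\<^bsub>V\<^esub> a) m = c \<odot>\<^bsub>L\<^esub> gm a m"
  by (simp add: gm_q tmono_smult q_smult)

lemma gm_zero: "gm \<zero>\<^bsub>V\<^esub> m = \<zero>\<^bsub>L\<^esub>"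
  by (simp add: gm_q tmono_zero q_zero)

lemma gm_D: assumes "a \<in> carrier V" shows "gm (D a) m \<oplus>\<^bsub>L\<^esub> of_int m \<odot>\<^bsub>L\<^esub> gm a (m - 1) = \<zero>\<^bsub>L\<^esub>"
proof -
  have "DD (tmono V a m) \<in> N" using assms by (simp add: N_eq)
  then have "q (DD (tmono V a m)) = \<zero>\<^bsub>L\<^esub>" by (rule q_N)
  then show ?thesis using assms by (simp add: DD_mono q_add tmono_smult q_smult gm_q)
qed

lemma gm_vac: assumes "n \<noteq> -1" shows "gm vac n = \<zero>\<^bsub>L\<^esub>"
proof -
  have "of_int (n + 1) \<odot>\<^bsub>L\<^esub> gm vac n = \<zero>\<^bsub>L\<^esub>"
    using gm_D[OF vac_closed, of "n + 1"] vac_closed by (simp add: D_vac gm_zero)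
  then have "(1 / of_int (n + 1)) \<odot>\<^bsub>L\<^esub> (of_int (n + 1) \<odot>\<^bsub>L\<^esub> gm vac n) = \<zero>\<^bsub>L\<^esub>" by simp
  moreover have "(of_int (n + 1) :: complex) \<noteq> 0" using assms by (metis add_eq_0_iff of_int_eq_0_iff add.commute minus_equation_iff)
  ultimately show ?thesis using Lm.sm_assoc[of "gm vac n" "1 / of_int (n + 1)" "of_int (n + 1)"] vac_closed by simp
qed

lemma L_induct [consumes 1, case_names mode add]:
  assumes x: "x \<in> carrier L"
    and mode: "\<And>a m. a \<in> carrier V \<Longrightarrow> P (gm a m)"
    and add: "\<And>x y. x \<in> carrier L \<Longrightarrow> y \<in> carrier L \<Longrightarrow> P x \<Longrightarrow> P y \<Longrightarrow> P (x \<oplus>\<^bsub>L\<^esub> y)"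
  shows "P x"
proof -
  obtain f where f: "f \<in> carrier Lau" "x = q f" using x L_carrier by blast
  have "P (q f)" using f(1)
    by (induction f rule: laurent_induct) (simp_all add: mode gm_q[symmetric] q_add add)
  then show ?thesis using f by simp
qed

lemma q_mlin: assumes "module_map L sc G" shows "module_map Lau sc (\<lambda>f. G (q f))"
proof -
  interpret G: module_map L sc G by fact
  show ?thesis
    by (intro module_map.intro module_map_axioms.intro LM.complex_module_axioms G.complex_space_axioms) (simp_all add: q_add q_smult G.f_add G.f_scale)
qed

text \<open>Formulated under an arbitrary linear map \<open>G\<close>, in order that the sum is formed in a type.\<close>

lemma mode_bracket:
  assumes "module_map L sc G" "a \<in> carrier V" "b \<in> carrier V"
  shows "G (gm a m \<otimes>\<^bsub>L\<^esub> gm b n) = complex_space.bin sc 1 m (\<lambda>i. G (gm (Y a (int i) b) (m + n - int i)))"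
    and "ev0 (\<lambda>i. G (gm (Y a (int i) b) (h i)))"
  using mlin_hb[OF q_mlin[OF assms(1)] assms(2,3)] assms(2,3) by (simp_all add: gm_q q_mult hat_bracket_mono)

text \<open>The assignment extends linearly to Laurent polynomials, and its compatibility with \<open>D\<close> says that the image of
  \<open>D \<otimes> 1 + 1 \<otimes> d/dt\<close> is killed.\<close>

lemma mode_lift:
  fixes sc :: "complex \<Rightarrow> 'p::ab_group_add \<Rightarrow> 'p"
  assumes sc: "complex_space sc"
    and add: "\<And>a b m. a \<in> carrier V \<Longrightarrow> b \<in> carrier V \<Longrightarrow> R (a \<oplus>\<^bsub>V\<^esub> b) m = R a m + R b m"
    and smult: "\<And>c a m. a \<in> carrier V \<Longrightarrow> R (c \<odot>\<^bsub>V\<^esub> a) m = sc c (R a m)"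
    and D: "\<And>a m. a \<in> carrier V \<Longrightarrow> R (D a) m + sc (of_int m) (R a (m - 1)) = 0"
  obtains G where "module_map L sc G" "\<And>a m. a \<in> carrier V \<Longrightarrow> G (gm a m) = R a m"
proof -
  interpret P: complex_space sc by fact
  have R0: "R \<zero>\<^bsub>V\<^esub> m = 0" for m using smult[of "\<zero>\<^bsub>V\<^esub>" 0 m] by simp
  define F where "F = (\<lambda>f. \<Sum>m\<in>{m. f m \<noteq> \<zero>\<^bsub>V\<^esub>}. R (f m) m)"
  have Fsup: "F f = (\<Sum>m\<in>A. R (f m) m)" if "finite A" "{m. f m \<noteq> \<zero>\<^bsub>V\<^esub>} \<subseteq> A" for f A
    unfolding F_def by (rule sum.mono_neutral_left) (use that R0 in auto)
  have F: "module_map Lau sc F"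
  proof (intro module_map.intro module_map_axioms.intro LM.complex_module_axioms sc)
    fix f g assume f: "f \<in> carrier Lau" and g: "g \<in> carrier Lau"
    let ?A = "{m. f m \<noteq> \<zero>\<^bsub>V\<^esub>} \<union> {m. g m \<noteq> \<zero>\<^bsub>V\<^esub>}"
    have A: "finite ?A" using f g by (auto simp: Lau_simps)
    have e: "R ((f \<oplus>\<^bsub>Lau\<^esub> g) m) m = R (f m) m + R (g m) m" for m
      using add[OF Lau_closed(1)[OF f] Lau_closed(1)[OF g]] by (simp add: Lau_simps(3))
    have "F (f \<oplus>\<^bsub>Lau\<^esub> g) = (\<Sum>m\<in>?A. R ((f \<oplus>\<^bsub>Lau\<^esub> g) m) m)"
      by (rule Fsup[OF A]) (auto simp: Lau_simps(3))
    then show "F (f \<oplus>\<^bsub>Lau\<^esub> g) = F f + F g"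
      by (simp add: e sum.distrib Fsup[OF A, of f] Fsup[OF A, of g])
  next
    fix f c assume f: "f \<in> carrier Lau"
    let ?A = "{m. f m \<noteq> \<zero>\<^bsub>V\<^esub>}"
    have A: "finite ?A" using f by (auto simp: Lau_simps)
    have e: "R ((c \<odot>\<^bsub>Lau\<^esub> f) m) m = sc c (R (f m) m)" for m
      using smult[OF Lau_closed(1)[OF f]] by (simp add: Lau_simps(4))
    have "F (c \<odot>\<^bsub>Lau\<^esub> f) = (\<Sum>m\<in>?A. R ((c \<odot>\<^bsub>Lau\<^esub> f) m) m)"
      by (rule Fsup[OF A]) (auto simp: Lau_simps(4))
    then show "F (c \<odot>\<^bsub>Lau\<^esub> f) = sc c (F f)"
      by (simp add: e P.scale_sum_right Fsup[OF A, of f])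
  qed
  interpret F: module_map Lau sc F by (rule F)
  have Fm: "F (tmono V a m) = R a m" for a m
  proof -
    have "{k. tmono V a m k \<noteq> \<zero>\<^bsub>V\<^esub>} \<subseteq> {m}" by (auto simp: tmono_def)
    then have "F (tmono V a m) = (\<Sum>k\<in>{m}. R (tmono V a m k) k)" by (intro Fsup) auto
    then show ?thesis by (simp add: tmono_def[of V a m])
  qed
  have FD: "F (DD f) = 0" if "f \<in> carrier Lau" for f
    using that
  proof (induction f rule: laurent_induct)
    case (mono a m)
    then show ?case using D[OF mono, of m] by (simp add: DD_mono F.f_add tmono_smult F.f_scale Fm)
  next
    case (add f g)
    then show ?case by (simp add: DD_add F.f_add DD_closed)
  qed
  have "module_map (hat_space V Y) sc F"
    using F.f_add F.f_scale by (intro module_map.intro module_map_axioms.intro complex_moduleI hat_module sc) (simp_all add: hat_simps)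
  then obtain G where G: "module_map (quot (hat_space V Y) N) sc G" "\<And>f. f \<in> carrier (hat_space V Y) \<Longrightarrow> G (N +>\<^bsub>hat_space V Y\<^esub> f) = F f"
    by (rule HQ.quot_lift) (use FD in \<open>auto simp: N_eq\<close>)
  show ?thesis
  proof (rule that)
    show "module_map L sc G" using G by (simp add: L_quot)
    show "G (gm a m) = R a m" if "a \<in> carrier V" for a m
      using G(2)[of "tmono V a m"] that by (simp add: gm_q q_def hat_simps Fm)
  qed
qed

subsection \<open>The subalgebra of nonnegative modes\<close>

definition "Hp = lin_span L {gm a n | a n. a \<in> carrier V \<and> n \<ge> 0}"

lemma Hp_submodule: "submodule Hp cfield L"
  unfolding Hp_def by (rule Lm.lin_span_submodule) auto

lemma gm_Hp: "a \<in> carrier V \<Longrightarrow> n \<ge> 0 \<Longrightarrow> gm a n \<in> Hp"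
  unfolding Hp_def by (rule subsetD[OF lin_span_superset]) blast

lemmas Hp_D = Lm.submoduleD[OF Hp_submodule]

text \<open>For \<open>m \<ge> 0\<close> the coefficient is zero when \<open>i > m\<close>, so no negative power of \<open>t\<close> occurs.\<close>

lemma hb_Hp: assumes a: "a \<in> carrier V" "b \<in> carrier V" and "m \<ge> 0" "n \<ge> 0" shows "q (hb a m b n) \<in> Hp"
proof -
  have "submodule {f \<in> carrier Lau. q f \<in> Hp} cfield Lau"
    by (rule LM.submoduleI') (auto simp: q_zero q_add q_smult Hp_D)
  moreover have "tmono V ((of_int m gchoose i) \<odot>\<^bsub>V\<^esub> Y a (int i) b) (m + n - int i) \<in> {f \<in> carrier Lau. q f \<in> Hp}" for i
  proof (cases "int i \<le> m")
    case True
    then show ?thesis using gm_Hp[of "(of_int m gchoose i) \<odot>\<^bsub>V\<^esub> Y a (int i) b" "m + n - int i"] assms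
      by (simp add: Y_closed gm_q)
  next
    case False
    obtain k where k: "m = int k" using assms by (metis nat_0_le)
    have "(of_int m gchoose i :: complex) = 0" using False unfolding k by (simp flip: binomial_gbinomial)
    then show ?thesis using a by (simp add: Y_closed tmono_zero q_zero Hp_D(2))
  qed
  ultimately have "hb a m b n \<in> {f \<in> carrier Lau. q f \<in> Hp}"
    unfolding hb_def supp_sum_def by (rule LM.submodule_finsum)
  then show ?thesis by blast
qed

lemma Hp_mult: assumes "x \<in> Hp" "y \<in> Hp" shows "x \<otimes>\<^bsub>L\<^esub> y \<in> Hp"
proof -
  let ?G = "{gm a n | a n. a \<in> carrier V \<and> n \<ge> 0}"
  have 1: "Hp \<subseteq> {x \<in> carrier L. x \<otimes>\<^bsub>L\<^esub> gm b n \<in> Hp}" if b: "b \<in> carrier V" "n \<ge> 0" for b n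
    unfolding Hp_def
  proof (rule lin_span_minimal, unfold Hp_def[symmetric])
    have z: "\<zero>\<^bsub>L\<^esub> \<otimes>\<^bsub>L\<^esub> gm b n = \<zero>\<^bsub>L\<^esub>" using L_mult_lin(3)[of "\<zero>\<^bsub>L\<^esub>" "\<zero>\<^bsub>L\<^esub>" "gm b n" 0] b L_mult_closed by simp
    show "submodule {x \<in> carrier L. x \<otimes>\<^bsub>L\<^esub> gm b n \<in> Hp} cfield L"
      by (rule Lm.submoduleI') (use b in \<open>auto simp: z L_mult_lin Hp_D\<close>)
    show "?G \<subseteq> {x \<in> carrier L. x \<otimes>\<^bsub>L\<^esub> gm b n \<in> Hp}"
      using b hb_Hp by (auto simp: gm_q q_mult hat_bracket_mono)
  qed
  have "Hp \<subseteq> {y \<in> carrier L. x \<otimes>\<^bsub>L\<^esub> y \<in> Hp}"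
    unfolding Hp_def
  proof (rule lin_span_minimal, unfold Hp_def[symmetric])
    have x: "x \<in> carrier L" using assms Hp_D(1) by blast
    have z: "x \<otimes>\<^bsub>L\<^esub> \<zero>\<^bsub>L\<^esub> = \<zero>\<^bsub>L\<^esub>" using L_mult_lin(4)[of "\<zero>\<^bsub>L\<^esub>" "\<zero>\<^bsub>L\<^esub>" x 0] x L_mult_closed by simp
    show "submodule {y \<in> carrier L. x \<otimes>\<^bsub>L\<^esub> y \<in> Hp} cfield L"
      by (rule Lm.submoduleI') (use x in \<open>auto simp: z L_mult_lin Hp_D\<close>)
    show "?G \<subseteq> {y \<in> carrier L. x \<otimes>\<^bsub>L\<^esub> y \<in> Hp}"
      using 1 assms(1) by auto
  qed
  then show ?thesis using assms(2) by blast
qed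

sublocale LP: lie_pair L Hp
  by (intro lie_pair.intro Lm.complex_module_axioms lie_pair_axioms.intro Hp_submodule) (auto simp: L_mult_closed Hp_mult)

abbreviation "cen \<equiv> gm vac (-1)"

lemma cen_closed: "cen \<in> carrier L" by (simp add: vac_closed)

text \<open>Because \<open>a\<^sub>i 1 = 0\<close> for \<open>i \<ge> 0\<close>.\<close>

lemma cen_central: "x \<in> carrier L \<Longrightarrow> x \<otimes>\<^bsub>L\<^esub> cen = \<zero>\<^bsub>L\<^esub>"
proof (induction x rule: L_induct)
  case (mode a m)
  have "hb a m vac (-1) = \<zero>\<^bsub>Lau\<^esub>"
    by (rule hb_eqI) (use mode in \<open>simp_all add: iota_hb vac_closed creation tmono_zero PM.bin_zero\<close>)
  then show ?case using mode by (simp add: gm_q q_mult vac_closed hat_bracket_mono q_zero)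
next
  case (add x y)
  then show ?case by (simp add: L_mult_lin cen_closed)
qed

lemma gV_plus_K: "gV_plus V Y vac = L\<lparr>carrier := Hp\<rparr>"
  by (simp add: gV_plus_def L_def Hp_def)

lemmas LP_defs = LP.W_def[OF cen_closed cen_central] LP.LN_def[OF cen_closed cen_central]
  LP.lact_def[OF cen_closed cen_central] LP.lone_def[OF cen_closed cen_central]

lemma level_W: "level_module V Y vac ell = LP.W cen ell"
  by (simp add: level_module_def IV_def level_null_def IV_act_def gV_plus_K L_def[symmetric] LP_defs LP.IM_def)

lemma level_lact: "level_act V Y vac ell x = LP.lact cen ell x"
  by (simp add: level_act_def IV_def level_null_def IV_act_def gV_plus_K L_def[symmetric] LP_defs LP.IM_def)

lemma level_lone: "level_one V Y vac ell = LP.lone cen ell"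
  by (simp add: level_one_def IV_def level_null_def IV_act_def gV_plus_K L_def[symmetric] LP_defs LP.IM_def)

end

section \<open>The vertex algebra of a given level\<close>

definition hsc :: "(complex \<Rightarrow> 'p \<Rightarrow> 'p) \<Rightarrow> complex \<Rightarrow> ('b \<Rightarrow> 'p) \<Rightarrow> 'b \<Rightarrow> 'p" where
  "hsc sc c h = (\<lambda>n. sc c (h n))"

lemma hsc_cvs: "complex_space sc \<Longrightarrow> complex_space (hsc sc)"
proof -
  assume "complex_space sc"
  then interpret complex_space sc .
  show ?thesis by unfold_locales (simp_all add: hsc_def fun_eq_iff scale_right_distrib scale_left_distrib)
qed

lemma hsc_bin_apply:
  assumes "complex_space sc" "ev0 g" shows "complex_space.bin (hsc sc) e l g x = complex_space.bin sc e l (\<lambda>i. g i x)"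
proof -
  interpret A: complex_space sc by fact
  interpret B: complex_space "hsc sc" by (rule hsc_cvs) fact
  obtain K where K: "\<And>i. i \<ge> K \<Longrightarrow> g i = 0" using assms unfolding ev0_def by blast
  have s: "(\<Sum>i<(k::nat). h i) x = (\<Sum>i<k. h i x)" for h and k by (induction k) auto
  show ?thesis using K by (subst B.bin_eq[of K], simp, subst A.bin_eq[of K]) (auto simp: s hsc_def)
qed

lemma (in complex_space) Sum_any_scale: "c \<noteq> 0 \<Longrightarrow> Sum_any (\<lambda>i. sc c (f i)) = sc c (Sum_any f)"
  by (simp add: Sum_any.expand_set scale_sum_right)

text \<open>An embedding of the module of level \<open>ell\<close> into a type is fixed, so that modes can be treated as fields.\<close>

locale level = vertex_algebra_modes V Y vac for V :: "(complex, 'a) module" and Y vac +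
  fixes ell :: complex and emb :: "'a IV_elem set \<Rightarrow> ('a IV_elem set \<Rightarrow>\<^sub>0 complex)"
  assumes emb: "module_embedded (LP.W cen ell) psc emb"
begin

abbreviation "W \<equiv> LP.W cen ell"
abbreviation "act \<equiv> LP.lact cen ell"
abbreviation "vacW \<equiv> LP.lone cen ell"

sublocale w: module_embedded W psc emb by (rule emb)

definition "S = emb ` carrier W"

lemma W_facts:
  shows "vacW \<in> carrier W" and "x \<in> carrier L \<Longrightarrow> w \<in> carrier W \<Longrightarrow> act x w \<in> carrier W"
    and "x \<in> carrier L \<Longrightarrow> v \<in> carrier W \<Longrightarrow> w \<in> carrier W \<Longrightarrow> act x (v \<oplus>\<^bsub>W\<^esub> w) = act x v \<oplus>\<^bsub>W\<^esub> act x w"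
    and "x \<in> carrier L \<Longrightarrow> w \<in> carrier W \<Longrightarrow> act x (b \<odot>\<^bsub>W\<^esub> w) = b \<odot>\<^bsub>W\<^esub> act x w"
    and "x \<in> carrier L \<Longrightarrow> y \<in> carrier L \<Longrightarrow> w \<in> carrier W \<Longrightarrow> act (x \<oplus>\<^bsub>L\<^esub> y) w = act x w \<oplus>\<^bsub>W\<^esub> act y w"
    and "x \<in> carrier L \<Longrightarrow> w \<in> carrier W \<Longrightarrow> act (b \<odot>\<^bsub>L\<^esub> x) w = b \<odot>\<^bsub>W\<^esub> act x w"
    and "x \<in> carrier L \<Longrightarrow> y \<in> carrier L \<Longrightarrow> w \<in> carrier W \<Longrightarrow> act x (act y w) \<ominus>\<^bsub>W\<^esub> act y (act x w) = act (x \<otimes>\<^bsub>L\<^esub> y) w"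
    and "k \<in> Hp \<Longrightarrow> act k vacW = \<zero>\<^bsub>W\<^esub>"
    and "w \<in> carrier W \<Longrightarrow> act cen w = ell \<odot>\<^bsub>W\<^esub> w"
  by (rule LP.lone_closed[OF cen_closed cen_central]
    LP.lact_closed[OF cen_closed cen_central]
    LP.lact_add_right[OF cen_closed cen_central]
    LP.lact_scale_right[OF cen_closed cen_central]
    LP.lact_add_left[OF cen_closed cen_central]
    LP.lact_scale_left[OF cen_closed cen_central]
    LP.lact_bracket[OF cen_closed cen_central]
    LP.lact_one[OF cen_closed cen_central]
    LP.lact_central[OF cen_closed cen_central];
    assumption)+

lemma act_zero: "w \<in> carrier W \<Longrightarrow> act \<zero>\<^bsub>L\<^esub> w = \<zero>\<^bsub>W\<^esub>" "x \<in> carrier L \<Longrightarrow> act x \<zero>\<^bsub>W\<^esub> = \<zero>\<^bsub>W\<^esub>"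
  using W_facts(6)[of "\<zero>\<^bsub>L\<^esub>" w 0] W_facts(4)[of x "\<zero>\<^bsub>W\<^esub>" 0] W_facts(2) by simp_all

lemma act_mlin: assumes "w \<in> carrier W" shows "module_map L psc (\<lambda>x. emb (act x w))"
  by (intro module_map.intro module_map_axioms.intro Lm.complex_module_axioms PM.complex_space_axioms)
    (use assms in \<open>simp_all add: W_facts w.f_add w.f_scale\<close>)

text \<open>The vectors on which the modes of every \<open>a\<close> are eventually zero form a subspace containing the generator.
  It is stable under modes, because \<open>a(n) b(m) w = b(m) a(n) w + (\<Sum>i. (n choose i) (a\<^sub>i b)(n + m - i) w)\<close>
  and only finitely many \<open>a\<^sub>i b\<close> are nonzero.\<close>

lemma act_trunc: assumes "w \<in> carrier W" shows "\<forall>a\<in>carrier V. \<exists>K. \<forall>n\<ge>K. act (gm a n) w = \<zero>\<^bsub>W\<^esub>"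
proof -
  let ?Q = "{w \<in> carrier W. \<forall>a\<in>carrier V. \<exists>K. \<forall>n\<ge>K. act (gm a n) w = \<zero>\<^bsub>W\<^esub>}"
  have Q_add: "u \<oplus>\<^bsub>W\<^esub> v \<in> ?Q" if "u \<in> ?Q" "v \<in> ?Q" for u v
  proof -
    have "\<exists>K. \<forall>n\<ge>K. act (gm a n) (u \<oplus>\<^bsub>W\<^esub> v) = \<zero>\<^bsub>W\<^esub>" if a: "a \<in> carrier V" for a
    proof -
      obtain K1 K2 where "\<forall>n\<ge>K1. act (gm a n) u = \<zero>\<^bsub>W\<^esub>" "\<forall>n\<ge>K2. act (gm a n) v = \<zero>\<^bsub>W\<^esub>"
        using \<open>u \<in> ?Q\<close> \<open>v \<in> ?Q\<close> a by blast
      then show ?thesis using \<open>u \<in> ?Q\<close> \<open>v \<in> ?Q\<close> a by (intro exI[of _ "max K1 K2"]) (simp add: W_facts)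
    qed
    then show ?thesis using that by simp
  qed
  have Q: "submodule ?Q cfield W"
  proof (rule w.submoduleI')
    show "\<zero>\<^bsub>W\<^esub> \<in> ?Q" by (simp add: act_zero)
    show "b \<odot>\<^bsub>W\<^esub> u \<in> ?Q" if "u \<in> ?Q" for u b
    proof -
      have "\<exists>K. \<forall>n\<ge>K. act (gm a n) (b \<odot>\<^bsub>W\<^esub> u) = \<zero>\<^bsub>W\<^esub>" if a: "a \<in> carrier V" for a
      proof -
        obtain K where "\<forall>n\<ge>K. act (gm a n) u = \<zero>\<^bsub>W\<^esub>" using \<open>u \<in> ?Q\<close> a by blast
        then show ?thesis using \<open>u \<in> ?Q\<close> a by (intro exI[of _ K]) (simp add: W_facts)
      qed
      then show ?thesis using that by simp
    qed
  qed (use Q_add in auto)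
  have "carrier W \<subseteq> ?Q"
  proof (rule LP.W_generated[OF cen_closed cen_central Q])
    show "vacW \<in> ?Q" using W_facts(1) W_facts(8)[OF gm_Hp] by auto
    show "act x u \<in> ?Q" if "x \<in> carrier L" "u \<in> ?Q" for x u
      using that(1)
    proof (induction x rule: L_induct)
      case (add x y)
      then show ?case using Q_add \<open>u \<in> ?Q\<close> by (simp add: W_facts(5))
    next
      case (mode b m)
      have u: "u \<in> carrier W" using that by blast
      have "\<exists>K. \<forall>n\<ge>K. act (gm a n) (act (gm b m) u) = \<zero>\<^bsub>W\<^esub>" if a: "a \<in> carrier V" for a
      proof -
        obtain J where J: "\<And>i. i \<ge> J \<Longrightarrow> Y a (int i) b = \<zero>\<^bsub>V\<^esub>" using Y_nonneg_ev[OF a mode] by blast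
        obtain K1 where K1: "\<And>n. n \<ge> K1 \<Longrightarrow> act (gm a n) u = \<zero>\<^bsub>W\<^esub>" using \<open>u \<in> ?Q\<close> a by blast
        have "\<exists>K. \<forall>n\<ge>K. act (gm (Y a (int i) b) n) u = \<zero>\<^bsub>W\<^esub>" for i using \<open>u \<in> ?Q\<close> Y_closed[OF a mode] by blast
        then obtain K2 where K2: "\<forall>i<J. \<forall>n\<ge>K2. act (gm (Y a (int i) b) n) u = \<zero>\<^bsub>W\<^esub>"
          using trunc_uniform[of J "\<lambda>n i. act (gm (Y a (int i) b) n) u = \<zero>\<^bsub>W\<^esub>"] by blast
        have "act (gm a n) (act (gm b m) u) = \<zero>\<^bsub>W\<^esub>" if n: "n \<ge> max K1 (K2 + int J - m)" for n
        proof -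
          have "emb (act (gm a n \<otimes>\<^bsub>L\<^esub> gm b m) u) = 0"
          proof -
            have "act (gm (Y a (int i) b) (n + m - int i)) u = \<zero>\<^bsub>W\<^esub>" for i
              using J[of i] K2 n by (cases "i < J") (auto simp: gm_zero act_zero u)
            then show ?thesis
              unfolding mode_bracket(1)[OF act_mlin[OF u] a mode] by (intro PM.bin_zero) simp
          qed
          then have "act (gm a n \<otimes>\<^bsub>L\<^esub> gm b m) u = \<zero>\<^bsub>W\<^esub>"
            using w.f_eq_0 W_facts(2) L_mult_closed a mode u by simp
          then have "act (gm a n) (act (gm b m) u) \<ominus>\<^bsub>W\<^esub> \<zero>\<^bsub>W\<^esub> = \<zero>\<^bsub>W\<^esub>"
            using W_facts(7)[of "gm a n" "gm b m" u] K1[of n] n a mode u act_zero by simp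
          then show ?thesis using a mode u W_facts(2) by (simp add: w.M.minus_eq)
        qed
        then show ?thesis by blast
      qed
      then show ?case using mode u by (simp add: W_facts)
    qed
  qed
  then show ?thesis using assms by blast
qed

definition emb_inv :: "('a IV_elem set \<Rightarrow>\<^sub>0 complex) \<Rightarrow> 'a IV_elem set" where "emb_inv = the_inv_into (carrier W) emb"

lemma emb_inv [simp]: "w \<in> carrier W \<Longrightarrow> emb_inv (emb w) = w"
  unfolding emb_inv_def using w.inj by (rule the_inv_into_f_f)

definition fld :: "'a \<Rightarrow> int \<Rightarrow> ('a IV_elem set \<Rightarrow>\<^sub>0 complex) \<Rightarrow> ('a IV_elem set \<Rightarrow>\<^sub>0 complex)" where
  "fld a n p = (if p \<in> S then emb (act (gm a n) (emb_inv p)) else 0)"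

lemma fld_emb: "w \<in> carrier W \<Longrightarrow> fld a n (emb w) = emb (act (gm a n) w)"
  by (simp add: fld_def S_def)

lemma S_sub: "module.subspace psc S"
  unfolding PM.subspace_def S_def
  by (auto simp: w.f_add[symmetric] w.f_scale[symmetric] intro!: imageI) (metis w.f_zero w.M.zero_closed imageI)

sublocale f: field_space psc S
  by unfold_locales (rule S_sub)

lemma fld_vfield: assumes a: "a \<in> carrier V" shows "f.vfield (fld a)"
proof (rule f.vfieldI)
  fix p assume "p \<in> S"
  then obtain w where w: "w \<in> carrier W" "p = emb w" unfolding S_def by blast
  show "fld a n p \<in> S" for n using w a by (simp add: fld_emb W_facts) (simp add: S_def W_facts)
  show "fld a n (psc c p) = psc c (fld a n p)" for n c
    using w a by (simp add: w.f_scale[symmetric] fld_emb W_facts)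
  show "\<exists>K. \<forall>n\<ge>K. fld a n p = 0"
  proof -
    obtain K where "\<forall>n\<ge>K. act (gm a n) w = \<zero>\<^bsub>W\<^esub>" using act_trunc[OF w(1)] a by blast
    then show ?thesis using w by (intro exI[of _ K]) (simp add: fld_emb)
  qed
next
  fix n p q assume "p \<in> S" "q \<in> S"
  then obtain v w where "v \<in> carrier W" "p = emb v" "w \<in> carrier W" "q = emb w" unfolding S_def by blast
  then show "fld a n (p + q) = fld a n p + fld a n q"
    using a by (simp add: w.f_add[symmetric] fld_emb W_facts)
qed (simp add: fld_def)

lemma fld_add: "a \<in> carrier V \<Longrightarrow> b \<in> carrier V \<Longrightarrow> fld (a \<oplus>\<^bsub>V\<^esub> b) = (\<lambda>n p. fld a n p + fld b n p)"
  by (intro ext) (auto simp: S_def fld_def gm_add W_facts w.f_add)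

lemma fld_smult: "a \<in> carrier V \<Longrightarrow> fld (c \<odot>\<^bsub>V\<^esub> a) = (\<lambda>n p. psc c (fld a n p))"
  by (intro ext) (auto simp: S_def fld_def gm_smult W_facts w.f_scale)

lemma fld_zero: "fld \<zero>\<^bsub>V\<^esub> n p = 0"
  by (auto simp: S_def fld_def gm_zero act_zero)

lemma fld_D: assumes a: "a \<in> carrier V" shows "fld (D a) = f.der (fld a)"
proof (intro ext)
  fix n p
  show "fld (D a) n p = f.der (fld a) n p"
  proof (cases "p \<in> S")
    case True
    then obtain w where w: "w \<in> carrier W" "p = emb w" unfolding S_def by blast
    have "emb (act (gm (D a) n \<oplus>\<^bsub>L\<^esub> of_int n \<odot>\<^bsub>L\<^esub> gm a (n - 1)) w) = 0"
      using w by (simp add: gm_D[OF a] act_zero)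
    then have "emb (act (gm (D a) n) w) + psc (of_int n) (emb (act (gm a (n - 1)) w)) = 0"
      using a w by (simp add: W_facts w.f_add w.f_scale)
    then show ?thesis using w by (simp add: f.der_def fld_emb eq_neg_iff_add_eq_0)
  next
    case False
    then show ?thesis by (simp add: f.der_def fld_def)
  qed
qed

text \<open>The bracket of modes, transported to fields; it is the input of \<open>comm_expansion\<close>.\<close>

lemma fld_comm:
  assumes a: "a \<in> carrier V" and b: "b \<in> carrier V" and p: "p \<in> S"
  shows "f.comm (fld a) (fld b) p m n = PM.bin 1 m (\<lambda>i. fld (Y a (int i) b) (m + n - int i) p)"
proof -
  obtain w where w: "w \<in> carrier W" "p = emb w" using p unfolding S_def by blast
  have "f.comm (fld a) (fld b) p m n = emb (act (gm a m) (act (gm b n) w) \<ominus>\<^bsub>W\<^esub> act (gm b n) (act (gm a m) w))"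
    using a b w by (simp add: f.comm_def fld_emb W_facts(2) w.f_minus)
  also have "\<dots> = emb (act (gm a m \<otimes>\<^bsub>L\<^esub> gm b n) w)" using a b w by (simp add: W_facts(7))
  also have "\<dots> = PM.bin 1 m (\<lambda>i. fld (Y a (int i) b) (m + n - int i) p)"
    using mode_bracket(1)[OF act_mlin[OF w(1)] a b] w by (simp add: fld_emb)
  finally show ?thesis .
qed

lemma fld_local: assumes a: "a \<in> carrier V" and b: "b \<in> carrier V"
  shows "f.mlocal (fld a) (fld b)" and "f.prd (fld a) (int k) (fld b) = fld (Y a (int k) b)"
proof -
  obtain K where K: "\<And>i. i \<ge> K \<Longrightarrow> Y a (int i) b = \<zero>\<^bsub>V\<^esub>" using Y_nonneg_ev[OF a b] by blast
  note c = f.comm_expansion[OF fld_vfield[OF a] fld_vfield[OF b], of "\<lambda>i. fld (Y a (int i) b)" K]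
  show "f.mlocal (fld a) (fld b)" unfolding f.mlocal_def
    using c(1) fld_comm[OF a b] fld_vfield Y_closed[OF a b] K fld_zero by auto
  show "f.prd (fld a) (int k) (fld b) = fld (Y a (int k) b)"
    using c(2) fld_comm[OF a b] fld_vfield Y_closed[OF a b] K fld_zero by auto
qed

definition "G = fld ` carrier V"

lemma Gv: "A \<in> G \<Longrightarrow> f.vfield A" and Gloc: "A \<in> G \<Longrightarrow> B \<in> G \<Longrightarrow> f.mlocal A B"
  unfolding G_def using fld_vfield fld_local by auto

abbreviation "E \<equiv> f.fgen G"

sublocale g: local_fields psc S E
  by (rule f.local_fields_fgen) (use Gv Gloc in blast)+

lemma Ev: "A \<in> E \<Longrightarrow> f.vfield A" and E_G: "A \<in> G \<Longrightarrow> A \<in> E"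
  using f.fgen_vfield[of G A] f.fgen_G[of G A] Gv Gloc by blast+

lemma E_sub: "module.subspace PM.fsc E" by (rule f.fgen_subspace)

text \<open>Cut off outside \<open>E\<close>, because only on fields are the products additive in \<open>a\<close>.\<close>

definition "R a m C = (if C \<in> E then f.prd (fld a) m C else 0)"

lemma rho_exists:
  "\<exists>rho. module_map L (hsc PM.fsc) rho \<and> (\<forall>a\<in>carrier V. \<forall>m. rho (gm a m) = R a m)"
proof -
  have R: "R (a \<oplus>\<^bsub>V\<^esub> b) m = R a m + R b m" if "a \<in> carrier V" "b \<in> carrier V" for a b m
    using that by (intro ext) (auto simp: R_def fld_add f.prd_add_left Ev fld_vfield)
  have R2: "R (c \<odot>\<^bsub>V\<^esub> a) m = hsc PM.fsc c (R a m)" if "a \<in> carrier V" for c a m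
    using that by (intro ext) (auto simp: R_def hsc_def fld_smult f.prd_scale_left Ev fld_vfield PM.fsc_def)
  have R3: "R (D a) m + hsc PM.fsc (of_int m) (R a (m - 1)) = 0" if "a \<in> carrier V" for a m
    using that by (intro ext) (auto simp: R_def hsc_def fld_D f.prd_der_left Ev fld_vfield PM.fsc_def)
  obtain G where "module_map L (hsc PM.fsc) G" "\<And>a m. a \<in> carrier V \<Longrightarrow> G (gm a m) = R a m"
    by (rule mode_lift[OF hsc_cvs[OF PM.cvs_fsc] R R2 R3]) blast+
  then show ?thesis by blast
qed

text \<open>The space \<open>E\<close> is a representation of \<open>g(V)\<close>, in which \<open>a(n)\<close> is the \<open>n\<close>-th left multiplication by the field
  \<open>a(x)\<close>: the bracket relation is the commutator formula for products of fields, combined with the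
  identity \<open>a(x)\<^sub>i b(x) = (a\<^sub>i b)(x)\<close> for \<open>i \<ge> 0\<close>.  The field of \<open>1\<close> is \<open>ell\<close> times the identity field, hence
  the level is \<open>ell\<close>, and nonnegative products with the identity field vanish.\<close>

lemma Om_exists:
  "\<exists>Om. module_map W PM.fsc Om \<and> Om vacW = f.idf \<and>
    (\<forall>a\<in>carrier V. \<forall>n. \<forall>w\<in>carrier W. Om (act (gm a n) w) = f.prd (fld a) n (Om w)) \<and> (\<forall>w\<in>carrier W. Om w \<in> E)"
proof -
  obtain rho where rho: "module_map L (hsc PM.fsc) rho" and rho_m: "\<And>a m. a \<in> carrier V \<Longrightarrow> rho (gm a m) = R a m"
    using rho_exists by blast
  interpret rho: module_map L "hsc PM.fsc" rho by (rule rho)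
  have m: "rho (gm a m) C = f.prd (fld a) m C" if "a \<in> carrier V" "C \<in> E" for a m C
    using that by (simp add: rho_m R_def)
  have radd: "rho (x \<oplus>\<^bsub>L\<^esub> y) C = rho x C + rho y C" if "x \<in> carrier L" "y \<in> carrier L" for x y C
    using rho.f_add[OF that] by simp
  have rsc: "rho (b \<odot>\<^bsub>L\<^esub> x) C = PM.fsc b (rho x C)" if "x \<in> carrier L" for x b C
    using rho.f_scale[OF that] by (simp add: hsc_def)
  have mem: "rho x C \<in> E" if "x \<in> carrier L" "C \<in> E" for x C
    using that(1)
  proof (induction x rule: L_induct)
    case (mode a k) then show ?case using that f.fgen_prd[of "fld a" G C k] by (simp add: m G_def)
  next
    case (add x y) then show ?case using f.fgen_add by (simp only: radd)
  qed
  have add: "rho x (A + B) = rho x A + rho x B" if "x \<in> carrier L" "A \<in> E" "B \<in> E" for x A B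
    using that(1)
  proof (induction x rule: L_induct)
    case (mode a k)
    have "f.prd (fld a) k (A + B) = f.prd (fld a) k A + f.prd (fld a) k B"
      using f.prd_add_right[OF fld_vfield[OF mode] Ev[OF that(2)] Ev[OF that(3)], of k] by (simp only: f.fun_plus)
    then show ?case using that mode f.fgen_add[OF that(2,3)] by (simp only: m)
  next
    case (add x y) then show ?case by (simp only: radd ac_simps)
  qed
  have scale: "rho x (PM.fsc b A) = PM.fsc b (rho x A)" if "x \<in> carrier L" "A \<in> E" for x b A
    using that(1)
  proof (induction x rule: L_induct)
    case (mode a k)
    have "f.prd (fld a) k (PM.fsc b A) = PM.fsc b (f.prd (fld a) k A)"
      using f.prd_scale_right[OF fld_vfield[OF mode] Ev[OF that(2)], of k b] by (simp only: PM.fsc_def)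
    then show ?case using that mode f.fgen_scale[OF that(2)] by (simp only: m)
  next
    case (add x y) then show ?case by (simp only: radd g.E.scale_right_distrib)
  qed
  have zero: "rho x 0 = 0" if "x \<in> carrier L" for x
    using scale[OF that f.fgen_idf, of 0] by simp
  have diff: "rho x (A - B) = rho x A - rho x B" if "x \<in> carrier L" "A \<in> E" "B \<in> E" for x A B
    using add[OF that(1,2), of "PM.fsc (-1) B"] scale[OF that(1,3), of "-1"] f.fgen_scale[OF that(3), of "-1"]
    by (simp only: g.E.scale_minus_left g.E.scale_one add_uminus_conv_diff)
  have brm: "rho (gm a k \<otimes>\<^bsub>L\<^esub> gm b n) C = rho (gm a k) (rho (gm b n) C) - rho (gm b n) (rho (gm a k) C)"
    if a: "a \<in> carrier V" and b: "b \<in> carrier V" and C: "C \<in> E" for a b k n C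
  proof -
    have pE: "f.prd (fld a) j C \<in> E" if "a \<in> carrier V" for a j
      using f.fgen_prd[of "fld a" G C j] that C by (simp add: G_def)
    have "rho (gm a k \<otimes>\<^bsub>L\<^esub> gm b n) C = g.E.bin 1 k (\<lambda>i. rho (gm (Y a (int i) b) (k + n - int i)) C)"
      unfolding mode_bracket(1)[OF rho a b] by (rule hsc_bin_apply[OF PM.cvs_fsc mode_bracket(2)[OF rho a b]])
    also have "\<dots> = g.E.bin 1 k (\<lambda>i. f.prd (f.prd (fld a) (int i) (fld b)) (k + n - int i) C)"
      using Y_closed[OF a b] C by (simp add: m fld_local(2)[OF a b])
    also have "\<dots> = f.prd (fld a) k (f.prd (fld b) n C) - f.prd (fld b) n (f.prd (fld a) k C)"
      using g.prd_commutator_formula[of "fld a" "fld b" C k n] a b C E_G by (simp add: G_def)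
    finally show ?thesis using a b C pE by (simp only: m)
  qed
  have bracket: "rho (x \<otimes>\<^bsub>L\<^esub> y) C = rho x (rho y C) - rho y (rho x C)"
    if x: "x \<in> carrier L" and y: "y \<in> carrier L" and C: "C \<in> E" for x y C
    using x
  proof (induction x rule: L_induct)
    case (mode a k)
    show ?case using y
    proof (induction y rule: L_induct)
      case (mode b n) then show ?case using brm \<open>a \<in> carrier V\<close> C by blast
    next
      case (add y y')
      have "rho (gm a k \<otimes>\<^bsub>L\<^esub> (y \<oplus>\<^bsub>L\<^esub> y')) C = rho (gm a k \<otimes>\<^bsub>L\<^esub> y) C + rho (gm a k \<otimes>\<^bsub>L\<^esub> y') C"
        using add mode by (simp only: L_mult_lin(2) radd L_mult_closed gm_closed)
      then show ?case using add mode C mem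
        by (simp only: radd \<open>\<And>x A B. x \<in> carrier L \<Longrightarrow> A \<in> E \<Longrightarrow> B \<in> E \<Longrightarrow> rho x (A + B) = rho x A + rho x B\<close> gm_closed) (simp only: algebra_simps)
    qed
  next
    case (add x x')
    have "rho ((x \<oplus>\<^bsub>L\<^esub> x') \<otimes>\<^bsub>L\<^esub> y) C = rho (x \<otimes>\<^bsub>L\<^esub> y) C + rho (x' \<otimes>\<^bsub>L\<^esub> y) C"
      using add y by (simp only: L_mult_lin(1) radd L_mult_closed)
    then show ?case using add y C mem
      by (simp only: radd \<open>\<And>x A B. x \<in> carrier L \<Longrightarrow> A \<in> E \<Longrightarrow> B \<in> E \<Longrightarrow> rho x (A + B) = rho x A + rho x B\<close>) (simp only: algebra_simps)
  qed
  have kill: "rho k f.idf = 0" if "k \<in> Hp" for k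
  proof -
    have "Hp \<subseteq> {x \<in> carrier L. rho x f.idf = 0}" unfolding Hp_def
    proof (rule lin_span_minimal)
      show "submodule {x \<in> carrier L. rho x f.idf = 0} cfield L"
        by (rule Lm.submoduleI') (simp_all add: radd rsc)
      show "{gm a n |a n. a \<in> carrier V \<and> 0 \<le> n} \<subseteq> {x \<in> carrier L. rho x f.idf = 0}"
        using f.prd_idf_nonneg[OF fld_vfield] by (auto simp: m f.fgen_idf f.fun_zero)
    qed
    then show ?thesis using that by blast
  qed
  have level: "rho cen C = PM.fsc ell C" if C: "C \<in> E" for C
  proof -
    have "fld vac = (\<lambda>n p. psc ell (f.idf n p))"
    proof (intro ext)
      fix n p
      show "fld vac n p = psc ell (f.idf n p)"
      proof (cases "p \<in> S")
        case True
        then obtain w where w: "w \<in> carrier W" "p = emb w" unfolding S_def by blast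
        then show ?thesis using True
          by (cases "n = -1") (simp_all add: fld_emb f.idf_def W_facts w.f_scale gm_vac act_zero)
      qed (simp add: fld_def f.idf_def)
    qed
    then have "f.prd (fld vac) (-1) C = (\<lambda>k p. psc ell (f.prd f.idf (-1) C k p))"
      using f.prd_scale_left[OF Ev[OF C] f.vfield_idf] by simp
    then show ?thesis using m[OF vac_closed C] f.idf_prd[OF Ev[OF C], of "-1"] by (simp add: PM.fsc_def)
  qed
  have "\<exists>Om. module_map W PM.fsc Om \<and> Om vacW = f.idf \<and> (\<forall>x\<in>carrier L. \<forall>w\<in>carrier W. Om (act x w) = rho x (Om w)) \<and>
    (\<forall>w\<in>carrier W. Om w \<in> E)"
  proof (rule LP.W_universal[OF cen_closed cen_central, where sc = PM.fsc and S = E and rho = rho and ell = ell and ?v0.0 = f.idf])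
    show "complex_space PM.fsc" by (rule PM.cvs_fsc)
    show "module.subspace PM.fsc E" by (rule E_sub)
    show "f.idf \<in> E" by (rule f.fgen_idf)
    show "rho k f.idf = 0" if "k \<in> Hp" for k using that by (rule kill)
    show "rho cen C = PM.fsc ell C" if "C \<in> E" for C using that by (rule level)
    fix x C assume x: "x \<in> carrier L" and C: "C \<in> E"
    show "rho x C \<in> E" by (rule mem[OF x C])
    show "rho x (PM.fsc b C) = PM.fsc b (rho x C)" for b by (rule scale[OF x C])
    show "rho (b \<odot>\<^bsub>L\<^esub> x) C = PM.fsc b (rho x C)" for b by (rule rsc[OF x])
    show "rho x (C + B) = rho x C + rho x B" if "B \<in> E" for B by (rule add[OF x C that])
    fix y assume y: "y \<in> carrier L"
    show "rho (x \<oplus>\<^bsub>L\<^esub> y) C = rho x C + rho y C" by (rule radd[OF x y])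
    show "rho (x \<otimes>\<^bsub>L\<^esub> y) C = rho x (rho y C) - rho y (rho x C)" by (rule bracket[OF x y C])
  qed
  then obtain Om where Om: "module_map W PM.fsc Om" "Om vacW = f.idf" "\<forall>x\<in>carrier L. \<forall>w\<in>carrier W. Om (act x w) = rho x (Om w)"
    "\<forall>w\<in>carrier W. Om w \<in> E" by blast
  then have "Om (act (gm a n) w) = f.prd (fld a) n (Om w)" if "a \<in> carrier V" "w \<in> carrier W" for a n w
    using that by (simp add: m)
  then show ?thesis using Om by blast
qed

definition "Om = (SOME Om. module_map W PM.fsc Om \<and> Om vacW = f.idf \<and>
    (\<forall>a\<in>carrier V. \<forall>n. \<forall>w\<in>carrier W. Om (act (gm a n) w) = f.prd (fld a) n (Om w)) \<and> (\<forall>w\<in>carrier W. Om w \<in> E))"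

lemma Om: "module_map W PM.fsc Om" "Om vacW = f.idf"
  "\<And>a n w. a \<in> carrier V \<Longrightarrow> w \<in> carrier W \<Longrightarrow> Om (act (gm a n) w) = f.prd (fld a) n (Om w)"
  using someI_ex[OF Om_exists] unfolding Om_def by blast+

definition "Phi p = Om (emb_inv p)"

lemma Phi_emb: "w \<in> carrier W \<Longrightarrow> Phi (emb w) = Om w" by (simp add: Phi_def)

lemma Phi_facts:
  shows "w \<in> S \<Longrightarrow> Phi w \<in> E"
    and "w \<in> S \<Longrightarrow> Phi w (-1) (emb vacW) = w"
    and "w \<in> S \<Longrightarrow> n \<ge> 0 \<Longrightarrow> Phi w n (emb vacW) = 0"
    and "u \<in> S \<Longrightarrow> v \<in> S \<Longrightarrow> f.Lf (Phi u) (Phi v) l m n w = PM.bin 1 m (\<lambda>i. Phi (Phi u (l + int i) v) (m + n - int i) w)"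
proof -
  interpret Om: module_map W PM.fsc Om by (rule Om)
  have e: "emb vacW \<in> S" by (simp add: S_def W_facts)
  have Ge: "A n (emb vacW) = 0" if "A \<in> G" "n \<ge> 0" for A n
    using that W_facts(8)[OF gm_Hp] W_facts(1) by (auto simp: G_def fld_emb)
  have add: "Phi (v + w) = Phi v + Phi w" if vw: "v \<in> S" "w \<in> S" for v w
  proof -
    obtain x y where "x \<in> carrier W" "v = emb x" "y \<in> carrier W" "w = emb y" using vw unfolding S_def by blast
    then show ?thesis by (simp only: w.f_add[symmetric] Phi_emb Om.f_add w.M.a_closed)
  qed
  have scale: "Phi (psc c w) = PM.fsc c (Phi w)" if w: "w \<in> S" for c w
  proof -
    obtain x where "x \<in> carrier W" "w = emb x" using w unfolding S_def by blast
    then show ?thesis by (simp only: w.f_scale[symmetric] Phi_emb Om.f_scale w.sm_closed)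
  qed
  have Pe: "Phi (emb vacW) = f.idf" by (simp add: Phi_emb W_facts Om)
  have PG: "Phi (A n w) = f.prd A n (Phi w)" if A: "A \<in> G" and w: "w \<in> S" for A n w
  proof -
    obtain x a where "x \<in> carrier W" "w = emb x" "a \<in> carrier V" "A = fld a" using w A unfolding S_def G_def by blast
    then show ?thesis by (simp add: fld_emb Phi_emb W_facts Om)
  qed
  have gen: "S \<subseteq> Q" if Q: "module.subspace psc Q" "emb vacW \<in> Q" "\<And>A n w. A \<in> G \<Longrightarrow> w \<in> Q \<Longrightarrow> w \<in> S \<Longrightarrow> A n w \<in> Q" for Q
  proof -
    let ?Q = "{w \<in> carrier W. emb w \<in> Q}"
    have sub: "submodule ?Q cfield W"
      by (rule w.submoduleI') (use PM.subspace_0[OF Q(1)] PM.subspace_add[OF Q(1)] PM.subspace_scale[OF Q(1)] in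
        \<open>auto simp: w.f_add w.f_scale\<close>)
    have "carrier W \<subseteq> ?Q"
    proof (rule LP.W_generated[OF cen_closed cen_central sub])
      show "vacW \<in> ?Q" using Q W_facts by simp
      show "act x w \<in> ?Q" if "x \<in> carrier L" "w \<in> ?Q" for x w
        using that(1)
      proof (induction x rule: L_induct)
        case (mode a n)
        then have "fld a n (emb w) \<in> Q" using Q(3)[of "fld a" "emb w" n] that by (simp add: G_def S_def)
        then show ?case using mode that by (simp add: fld_emb W_facts)
      next
        case (add x y)
        then show ?case using w.submoduleD(3)[OF sub] that by (simp add: W_facts(5))
      qed
    qed
    then show ?thesis unfolding S_def by blast
  qed
  note rec = f.reconstruction[where G = G and e = "emb vacW" and Phi = Phi]
  show "w \<in> S \<Longrightarrow> Phi w \<in> E"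
    by (rule rec(1)) (erule Gv, erule (1) Gloc, rule e, erule (1) Ge, (rule gen; blast), erule (1) add, erule scale, rule Pe, erule (1) PG, assumption+)
  show "w \<in> S \<Longrightarrow> Phi w (-1) (emb vacW) = w"
    by (rule rec(2)) (erule Gv, erule (1) Gloc, rule e, erule (1) Ge, (rule gen; blast), erule (1) add, erule scale, rule Pe, erule (1) PG, assumption+)
  show "w \<in> S \<Longrightarrow> n \<ge> 0 \<Longrightarrow> Phi w n (emb vacW) = 0"
    by (rule rec(3)) (erule Gv, erule (1) Gloc, rule e, erule (1) Ge, (rule gen; blast), erule (1) add, erule scale, rule Pe, erule (1) PG, assumption+)
  show "u \<in> S \<Longrightarrow> v \<in> S \<Longrightarrow> f.Lf (Phi u) (Phi v) l m n w = PM.bin 1 m (\<lambda>i. Phi (Phi u (l + int i) v) (m + n - int i) w)"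
    by (rule rec(4)) (erule Gv, erule (1) Gloc, rule e, erule (1) Ge, (rule gen; blast), erule (1) add, erule scale, rule Pe, erule (1) PG, assumption+)
qed

definition "Yl u n v = emb_inv (Om u n (emb v))"

lemma emb_S: "w \<in> carrier W \<Longrightarrow> emb w \<in> S" by (simp add: S_def)

lemma Om_vfield: "u \<in> carrier W \<Longrightarrow> f.vfield (Om u)"
  using Phi_facts(1)[OF emb_S] Ev by (simp add: Phi_emb)

lemma emb_emb_inv: "p \<in> S \<Longrightarrow> emb (emb_inv p) = p" "p \<in> S \<Longrightarrow> emb_inv p \<in> carrier W"
  by (auto simp: S_def)

lemma Yl: assumes "u \<in> carrier W" "v \<in> carrier W"
  shows "Yl u n v \<in> carrier W" "emb (Yl u n v) = Om u n (emb v)"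
  using f.vf_mem'[OF Om_vfield[OF assms(1)]] by (simp_all add: Yl_def emb_emb_inv)

lemma Yl_jacobi:
  assumes a: "a \<in> carrier W" and b: "b \<in> carrier W" and c: "c \<in> carrier W"
  shows "supp_sum W (\<lambda>i::nat. ((-1) ^ i * (of_int l gchoose i)) \<odot>\<^bsub>W\<^esub> Yl a (l + m - int i) (Yl b (n + int i) c))
      \<ominus>\<^bsub>W\<^esub> supp_sum W (\<lambda>i::nat. ((-1) powi l * (-1) ^ i * (of_int l gchoose i)) \<odot>\<^bsub>W\<^esub> Yl b (l + n - int i) (Yl a (m + int i) c))
      = supp_sum W (\<lambda>i::nat. (of_int m gchoose i) \<odot>\<^bsub>W\<^esub> Yl (Yl a (l + int i) b) (m + n - int i) c)" (is "?A \<ominus>\<^bsub>W\<^esub> ?B = ?C")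
proof -
  note cl = Yl(1)[OF a b] Yl(1)[OF b c] Yl(1)[OF a c]
  have Yc: "Yl u n v \<in> carrier W" if "u \<in> carrier W" "v \<in> carrier W" for u v n using Yl(1) that by blast
  have A: "emb ?A = PM.bin (-1) l (\<lambda>i. Om a (l + m - int i) (Om b (n + int i) (emb c)))"
    using a b c Yc by (subst w.f_supp_sum) (simp_all add: w.f_scale Yl PM.bin_def)
  have B: "emb ?B = psc ((-1) powi l) (PM.bin (-1) l (\<lambda>i. Om b (l + n - int i) (Om a (m + int i) (emb c))))"
    using a b c Yc by (subst w.f_supp_sum) (simp_all add: w.f_scale Yl PM.bin_def mult.assoc PM.Sum_any_scale flip: PM.scale_scale)
  have C: "emb ?C = PM.bin 1 m (\<lambda>i. Phi (Phi (emb a) (l + int i) (emb b)) (m + n - int i) (emb c))"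
  proof -
    have "Om (Yl a k b) = Phi (Phi (emb a) k (emb b))" for k
      using a b by (simp add: Phi_emb Yl(2)[symmetric] cl)
    then show ?thesis using a b c Yc by (subst w.f_supp_sum) (simp_all add: w.f_scale Yl PM.bin_def)
  qed
  have "emb (?A \<ominus>\<^bsub>W\<^esub> ?B) = emb ?A - emb ?B"
    using a b c Yc by (intro w.f_minus w.supp_sum_closed) auto
  also have "\<dots> = f.Lf (Om a) (Om b) l m n (emb c)" unfolding A B f.Lf_def ..
  also have "\<dots> = emb ?C" unfolding C using Phi_facts(4)[OF emb_S[OF a] emb_S[OF b]] a b by (simp add: Phi_emb)
  finally show ?thesis
    using a b c Yc by (subst w.f_eq_iff[symmetric]) (auto intro!: w.M.minus_closed w.supp_sum_closed)
qed

theorem level_vertex_algebra: "vertex_algebra W Yl vacW"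
proof -
  interpret Om: module_map W PM.fsc Om by (rule Om)
  have eq: "x = y" if "x \<in> carrier W" "y \<in> carrier W" "emb x = emb y" for x y using that w.f_eq_iff by blast
  note v = Om_vfield
  have wm: "module cfield W" using w.complex_module_axioms by (simp add: complex_module_def)
  show ?thesis
  proof (intro vertex_algebra.intro wm vertex_algebra_axioms.intro)
    fix a b assume ab: "a \<in> carrier W" "b \<in> carrier W"
    show "Yl a n b \<in> carrier W" for n using Yl ab by blast
    show "Yl (z \<odot>\<^bsub>W\<^esub> a) n b = z \<odot>\<^bsub>W\<^esub> Yl a n b" for z n
      by (rule eq) (use ab in \<open>simp_all add: Yl w.f_scale Om.f_scale PM.fsc_def\<close>)
    show "Yl a n (z \<odot>\<^bsub>W\<^esub> b) = z \<odot>\<^bsub>W\<^esub> Yl a n b" for z n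
      by (rule eq) (use ab in \<open>simp_all add: Yl w.f_scale f.vf_scale[OF v] emb_S\<close>)
    show "\<exists>N. \<forall>n\<ge>N. Yl a n b = \<zero>\<^bsub>W\<^esub>"
    proof -
      obtain K where "\<forall>n\<ge>K. Om a n (emb b) = 0" using f.vf_trunc[OF v[OF ab(1)] emb_S[OF ab(2)]] by blast
      then show ?thesis using ab w.f_eq_0[OF Yl(1)] by (intro exI[of _ K]) (simp add: Yl)
    qed
    fix c assume c: "c \<in> carrier W"
    show "Yl (a \<oplus>\<^bsub>W\<^esub> b) n c = Yl a n c \<oplus>\<^bsub>W\<^esub> Yl b n c" for n
      by (rule eq) (use ab c in \<open>simp_all add: Yl w.f_add Om.f_add\<close>)
    show "Yl a n (b \<oplus>\<^bsub>W\<^esub> c) = Yl a n b \<oplus>\<^bsub>W\<^esub> Yl a n c" for n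
      by (rule eq) (use ab c in \<open>simp_all add: Yl w.f_add f.vf_add[OF v] emb_S\<close>)
  next
    show "vacW \<in> carrier W" by (rule W_facts)
  next
    fix b n assume b: "b \<in> carrier W"
    show "Yl vacW n b = (if n = - 1 then b else \<zero>\<^bsub>W\<^esub>)"
      by (rule eq) (use b W_facts(1) in \<open>simp_all add: Yl Om f.idf_def emb_S\<close>)
  next
    fix a assume a: "a \<in> carrier W"
    show "Yl a (-1) vacW = a"
      by (rule eq) (use a W_facts(1) Phi_facts(2)[OF emb_S[OF a]] in \<open>simp_all add: Yl Phi_emb\<close>)
    show "Yl a n vacW = \<zero>\<^bsub>W\<^esub>" if "n \<ge> 0" for n
      by (rule eq) (use a W_facts(1) Phi_facts(3)[OF emb_S[OF a] that] in \<open>simp_all add: Yl Phi_emb\<close>)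
  qed (rule Yl_jacobi)
qed

text \<open>The field of \<open>a(-1) 1\<close> is \<open>a(x)\<^sub>-\<^sub>1 id = a(x)\<close>.\<close>

lemma Yl_natural: assumes "a \<in> carrier V" "w \<in> carrier W"
  shows "Yl (act (gm a (-1)) vacW) n w = act (gm a n) w"
proof -
  have "Om (act (gm a (-1)) vacW) = fld a"
    using assms W_facts(1) by (simp add: Om f.prd_idf fld_vfield)
  then have "emb (Yl (act (gm a (-1)) vacW) n w) = emb (act (gm a n) w)"
    using assms by (subst Yl(2)) (auto simp: W_facts fld_emb)
  moreover have "act (gm a (-1)) vacW \<in> carrier W" using assms W_facts(1) by (simp add: W_facts(2))
  ultimately show ?thesis using assms w.f_eq_iff[OF Yl(1), of _ w "act (gm a n) w" n] W_facts(2) by simp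
qed

end

theorem theorem5p2:
  fixes V :: "(complex, 'a) module" and Y :: "'a \<Rightarrow> int \<Rightarrow> 'a \<Rightarrow> 'a" and vac :: 'a
    and ell :: complex
  assumes "vertex_algebra V Y vac"
  shows "\<exists>Y'. vertex_algebra (level_module V Y vac ell) Y' (level_one V Y vac ell) \<and>
    (\<forall>a\<in>carrier V. \<forall>n. \<forall>w\<in>carrier (level_module V Y vac ell).
       Y' (level_act V Y vac ell (gmode V Y vac a (-1)) (level_one V Y vac ell)) n w
         = level_act V Y vac ell (gmode V Y vac a n) w)"
proof -
  interpret vertex_algebra_modes V Y vac using assms by (simp add: vertex_algebra_modes_def)
  have "module cfield (LP.W cen ell)" by (rule LP.W_module[OF cen_closed cen_central])
  then obtain emb :: "'a IV_elem set \<Rightarrow> ('a IV_elem set \<Rightarrow>\<^sub>0 complex)" where emb: "module_embedded (LP.W cen ell) psc emb"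
    by (rule obtain_module_embedded)
  then have lv: "level V Y vac ell emb" by (intro level.intro level_axioms.intro vertex_algebra_modes_axioms)
  show ?thesis unfolding level_W level_lact level_lone
    by (rule exI, rule conjI, rule level.level_vertex_algebra[OF lv]) (intro ballI allI level.Yl_natural[OF lv])
qed


end
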